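(* Let $A=\bigoplus_{i\geq0}A_i$ be a positively graded algebra over a field $K$, generated in degrees $0,1$, with $A_0$ semisimple. Let $(\mathcal{S},\mathcal{U})$ be a right modular pair of subsets of $\mathbf{Z}$ and let $X\in Gr_{A_{\mathcal{U}}}$ be generated in degrees belonging to $(\mathcal{S}:\mathcal{U})$. Let $n\geq2$ and $r\geq 0$ be integers with $0\leq2r<n$. (1) If $\mathcal{U}=\bigcup_{k\in\mathbf{Z}}[kn,kn+r]$, then $X$ is liftable if and only if $\mathrm{Ker}(\mu_{m,r})A_{n-r}\subseteq\mathrm{Ker}(\mu_{m,n})$ for all $m\in(\mathcal{S}:\mathcal{U})$. (2) If $\mathcal{U}=\bigcup_{k\in\mathbf{Z}}[kn-r,kn]$, then $X$ is liftable if and only if $\mathrm{Ker}(\mu_{m,u})A_{v-u}\subseteq\mathrm{Ker}(\mu_{m,v})$ for all $m\in(\mathcal{S}:\mathcal{U})$ and all $n-r\leq u<v\leq n$.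
   Context: Intervals are intervals of integers. Algebras are associative with unit, modules are right modules, $Gr$ denotes categories of $\mathbf{Z}$-graded right modules with degree-preserving morphisms; $A$ is viewed as $\mathbf{Z}$-graded with $A_i=0$ for $i<0$. $(\mathcal{S}:\mathcal{U})=\{m\in\mathbf{Z}:m+\mathcal{U}=\mathcal{S}\}$. $\mathcal{U}\subseteq\mathbf{Z}$ is ring-supporting if $0\in\mathcal{U}$ and whenever $u,v,w,u+v+w\in\mathcal{U}$, $u+v\in\mathcal{U}\iff v+w\in\mathcal{U}$ (the sets in (1), (2) are ring-supporting). A pair $(\mathcal{S},\mathcal{U})$ of nonempty subsets of $\mathbf{Z}$ is right modular if $\mathcal{U}$ is ring-supporting and for all $(s,u,v)\in\mathcal{S}\times\mathcal{U}\times\mathcal{U}$ with $s+u+v\in\mathcal{S}$, $s+u\in\mathcal{S}\iff u+v\in\mathcal{U}$. $A_{\mathcal{U}}=\bigoplus_{u\in\mathcal{U}}A_u$ is the graded algebra with multiplication of nonzero homogeneous elements $a\cdot b=ab$ if $\deg(a)+\deg(b)\in\mathcal{U}$, and $0$ otherwise. $(-)_{\mathcal{S}}:Gr_A\to Gr_{A_{\mathcal{U}}}$ sends $M$ to $M_{\mathcal{S}}=\bigoplus_{s\in\mathcal{S}}M_s$ with, for nonzero homogeneous $x\in M_{\mathcal S}$ and $a\in A_{\mathcal U}$, $x\cdot a=xa$ if $\deg(x)+\deg(a)\in\mathcal{S}$ and $0$ otherwise. $X$ is liftable if it is isomorphic in $Gr_{A_{\mathcal{U}}}$ to $M_{\mathcal{S}}$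 for some $M\in Gr_A$. $X$ is generated in degrees belonging to $\mathcal{X}$ if it is generated by its homogeneous elements with degree in $\mathcal{X}$. $\otimes$ means $\otimes_{A_0}$. For $X\in Gr_{A_{\mathcal{U}}}$ with support in $\mathcal{S}$, $\mu_{s,u}:X_s\otimes A_u\to X_{s+u}$ is the multiplication map, for $(s,u)\in\mathcal{S}\times\mathcal{U}$ with $s+u\in\mathcal{S}$. Since $X\otimes A$ is a graded right $A$-module, $\mathrm{Ker}(\mu_{s,u})A_i$ is an $A_0$-submodule of $X_s\otimes A_{u+i}$ for $i\geq0$. *)

theory Defs
  imports "HOL-Algebra.Module" "HOL-Algebra.Subrings" "HOL-Algebra.Free_Abelian_Groups"
begin

section \<open>Internal direct sum decompositions indexed by the integers\<close>

definition is_decomp ::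
  "('g, 'c) ring_scheme \<Rightarrow> (int \<Rightarrow> 'g set) \<Rightarrow> 'g \<Rightarrow> (int \<Rightarrow> 'g) \<Rightarrow> bool" where
  "is_decomp G D x f \<longleftrightarrow> (\<forall>i. f i \<in> D i) \<and> finite {i. f i \<noteq> \<zero>\<^bsub>G\<^esub>} \<and>
     finsum G f {i. f i \<noteq> \<zero>\<^bsub>G\<^esub>} = x"

definition graded_by :: "('g, 'c) ring_scheme \<Rightarrow> (int \<Rightarrow> 'g set) \<Rightarrow> bool" where
  "graded_by G D \<longleftrightarrow> (\<forall>i. additive_subgroup (D i) G) \<and>
     (\<forall>x\<in>carrier G. \<exists>!f. is_decomp G D x f)"

definition hcomp :: "('g, 'c) ring_scheme \<Rightarrow> (int \<Rightarrow> 'g set) \<Rightarrow> 'g \<Rightarrow> int \<Rightarrow> 'g" where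
  "hcomp G D x = (THE f. is_decomp G D x f)"

definition hsupp :: "('g, 'c) ring_scheme \<Rightarrow> (int \<Rightarrow> 'g set) \<Rightarrow> 'g \<Rightarrow> int set" where
  "hsupp G D x = {i. hcomp G D x i \<noteq> \<zero>\<^bsub>G\<^esub>}"


section \<open>Right modules over noncommutative rings\<close>

text \<open>As with the library's records for modules, the fields \<open>mult\<close> and \<open>one\<close> inherited from
  \<open>ring\<close> are ignored; only the additive group structure of a module matters.\<close>

record ('r, 'm) right_module = "'m ring" +
  ract :: "['m, 'r] \<Rightarrow> 'm" (infixl \<open>\<triangleleft>\<index>\<close> 70)

locale right_module = R?: ring R + M?: abelian_group M
  for R :: "('r, 'c) ring_scheme" (structure) and M :: "('r, 'm, 'd) right_module_scheme" (structure) +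
  assumes ract_closed:
      "\<lbrakk>x \<in> carrier M; a \<in> carrier R\<rbrakk> \<Longrightarrow> x \<triangleleft>\<^bsub>M\<^esub> a \<in> carrier M"
    and ract_l_distr:
      "\<lbrakk>x \<in> carrier M; y \<in> carrier M; a \<in> carrier R\<rbrakk> \<Longrightarrow>
        (x \<oplus>\<^bsub>M\<^esub> y) \<triangleleft>\<^bsub>M\<^esub> a = x \<triangleleft>\<^bsub>M\<^esub> a \<oplus>\<^bsub>M\<^esub> y \<triangleleft>\<^bsub>M\<^esub> a"
    and ract_r_distr:
      "\<lbrakk>x \<in> carrier M; a \<in> carrier R; b \<in> carrier R\<rbrakk> \<Longrightarrow>
        x \<triangleleft>\<^bsub>M\<^esub> (a \<oplus>\<^bsub>R\<^esub> b) = x \<triangleleft>\<^bsub>M\<^esub> a \<oplus>\<^bsub>M\<^esub> x \<triangleleft>\<^bsub>M\<^esub> b"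
    and ract_assoc:
      "\<lbrakk>x \<in> carrier M; a \<in> carrier R; b \<in> carrier R\<rbrakk> \<Longrightarrow>
        x \<triangleleft>\<^bsub>M\<^esub> (a \<otimes>\<^bsub>R\<^esub> b) = (x \<triangleleft>\<^bsub>M\<^esub> a) \<triangleleft>\<^bsub>M\<^esub> b"
    and ract_one: "x \<in> carrier M \<Longrightarrow> x \<triangleleft>\<^bsub>M\<^esub> \<one>\<^bsub>R\<^esub> = x"

definition right_submodule ::
  "('r, 'c) ring_scheme \<Rightarrow> ('r, 'm, 'd) right_module_scheme \<Rightarrow> 'm set \<Rightarrow> bool" where
  "right_submodule R M N \<longleftrightarrow> additive_subgroup N M \<and>
     (\<forall>x\<in>N. \<forall>a\<in>carrier R. x \<triangleleft>\<^bsub>M\<^esub> a \<in> N)"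

definition simple_submodule ::
  "('r, 'c) ring_scheme \<Rightarrow> ('r, 'm, 'd) right_module_scheme \<Rightarrow> 'm set \<Rightarrow> bool" where
  "simple_submodule R M N \<longleftrightarrow> right_submodule R M N \<and> N \<noteq> {\<zero>\<^bsub>M\<^esub>} \<and>
     (\<forall>L. right_submodule R M L \<and> L \<subseteq> N \<longrightarrow> L = {\<zero>\<^bsub>M\<^esub>} \<or> L = N)"

text \<open>A module is semisimple if it is the sum of its simple submodules, i.e. if no proper
  submodule contains all of them.\<close>

definition semisimple_module ::
  "('r, 'c) ring_scheme \<Rightarrow> ('r, 'm, 'd) right_module_scheme \<Rightarrow> bool" where
  "semisimple_module R M \<longleftrightarrow>
     (\<forall>N. right_submodule R M N \<and> (\<forall>L. simple_submodule R M L \<longrightarrow> L \<subseteq> N) \<longrightarrow> N = carrier M)"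

definition regular_module :: "('r, 'c) ring_scheme \<Rightarrow> ('r, 'r) right_module" where
  "regular_module R = \<lparr>carrier = carrier R, monoid.mult = monoid.mult R, one = \<one>\<^bsub>R\<^esub>,
     ring.zero = \<zero>\<^bsub>R\<^esub>, add = add R, ract = monoid.mult R\<rparr>"

definition semisimple_ring :: "('r, 'c) ring_scheme \<Rightarrow> bool" where
  "semisimple_ring R \<longleftrightarrow> ring R \<and> semisimple_module R (regular_module R)"


section \<open>Tensor products over noncommutative rings\<close>

text \<open>The tensor product of a right \<open>R\<close>-module \<open>P\<close> and a left \<open>R\<close>-module \<open>Q\<close> (whose left action
  is \<open>smult Q\<close>) is the free abelian group on \<open>P \<times> Q\<close> modulo the usual relations. Its elements are
  cosets, and the group is written multiplicatively as all groups in HOL-Algebra.\<close>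

definition tensor_gens ::
  "('r, 'm, 'd) right_module_scheme \<Rightarrow> ('r, 'q, 'e) module_scheme \<Rightarrow> ('m \<times> 'q \<Rightarrow>\<^sub>0 int) monoid" where
  "tensor_gens P Q = free_Abelian_group (carrier P \<times> carrier Q)"

definition tensor_rels ::
  "('r, 'c) ring_scheme \<Rightarrow> ('r, 'm, 'd) right_module_scheme \<Rightarrow> ('r, 'q, 'e) module_scheme
    \<Rightarrow> ('m \<times> 'q \<Rightarrow>\<^sub>0 int) set" where
  "tensor_rels R P Q = generate (tensor_gens P Q)
     ({frag_of (x \<oplus>\<^bsub>P\<^esub> y, q) - frag_of (x, q) - frag_of (y, q) | x y q.
         x \<in> carrier P \<and> y \<in> carrier P \<and> q \<in> carrier Q} \<union>
      {frag_of (x, p \<oplus>\<^bsub>Q\<^esub> q) - frag_of (x, p) - frag_of (x, q) | x p q.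
         x \<in> carrier P \<and> p \<in> carrier Q \<and> q \<in> carrier Q} \<union>
      {frag_of (x \<triangleleft>\<^bsub>P\<^esub> c, q) - frag_of (x, c \<odot>\<^bsub>Q\<^esub> q) | x c q.
         x \<in> carrier P \<and> c \<in> carrier R \<and> q \<in> carrier Q})"

definition tensor_prod ::
  "('r, 'c) ring_scheme \<Rightarrow> ('r, 'm, 'd) right_module_scheme \<Rightarrow> ('r, 'q, 'e) module_scheme
    \<Rightarrow> ('m \<times> 'q \<Rightarrow>\<^sub>0 int) set monoid" where
  "tensor_prod R P Q = tensor_gens P Q Mod tensor_rels R P Q"

definition tensor_elem ::
  "('r, 'c) ring_scheme \<Rightarrow> ('r, 'm, 'd) right_module_scheme \<Rightarrow> ('r, 'q, 'e) module_scheme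
    \<Rightarrow> 'm \<Rightarrow> 'q \<Rightarrow> ('m \<times> 'q \<Rightarrow>\<^sub>0 int) set" where
  "tensor_elem R P Q x q = tensor_rels R P Q #>\<^bsub>tensor_gens P Q\<^esub> frag_of (x, q)"

text \<open>For a balanced biadditive map \<open>\<beta>\<close> into an abelian group \<open>H\<close>, this is the induced homomorphism
  with \<open>x \<otimes> q \<mapsto> \<beta> x q\<close>: a coset is sent to the common value at all of its representatives.\<close>

definition tensor_lift ::
  "('h, 'c) monoid_scheme \<Rightarrow> ('m \<Rightarrow> 'q \<Rightarrow> 'h) \<Rightarrow> ('m \<times> 'q \<Rightarrow>\<^sub>0 int) set \<Rightarrow> 'h" where
  "tensor_lift H \<beta> t = the_elem
     ((\<lambda>c. finprod H (\<lambda>p. \<beta> (fst p) (snd p) [^]\<^bsub>H\<^esub> Poly_Mapping.lookup c p)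
              (Poly_Mapping.keys c)) ` t)"


section \<open>Graded algebras and graded right modules\<close>

record ('k, 'a) graded_algebra = "('k, 'a) module" +
  alg_part :: "int \<Rightarrow> 'a set"

record ('a, 'm) graded_right_module = "('a, 'm) right_module" +
  mod_part :: "int \<Rightarrow> 'm set"

text \<open>The library's locale \<open>algebra\<close> is restricted to commutative algebras.\<close>

definition K_algebra :: "'k ring \<Rightarrow> ('k, 'a, 'c) module_scheme \<Rightarrow> bool" where
  "K_algebra K A \<longleftrightarrow> field K \<and> ring A \<and> module K A \<and>
     (\<forall>k\<in>carrier K. \<forall>a\<in>carrier A. \<forall>b\<in>carrier A.
        (k \<odot>\<^bsub>A\<^esub> a) \<otimes>\<^bsub>A\<^esub> b = k \<odot>\<^bsub>A\<^esub> (a \<otimes>\<^bsub>A\<^esub> b) \<and>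
        a \<otimes>\<^bsub>A\<^esub> (k \<odot>\<^bsub>A\<^esub> b) = k \<odot>\<^bsub>A\<^esub> (a \<otimes>\<^bsub>A\<^esub> b))"

definition graded_K_algebra :: "'k ring \<Rightarrow> ('k, 'a) graded_algebra \<Rightarrow> bool" where
  "graded_K_algebra K A \<longleftrightarrow> K_algebra K A \<and> graded_by A (alg_part A) \<and>
     \<one>\<^bsub>A\<^esub> \<in> alg_part A 0 \<and>
     (\<forall>i. \<forall>k\<in>carrier K. \<forall>a\<in>alg_part A i. k \<odot>\<^bsub>A\<^esub> a \<in> alg_part A i) \<and>
     (\<forall>i j. \<forall>a\<in>alg_part A i. \<forall>b\<in>alg_part A j. a \<otimes>\<^bsub>A\<^esub> b \<in> alg_part A (i + j))"

definition positively_graded_K_algebra :: "'k ring \<Rightarrow> ('k, 'a) graded_algebra \<Rightarrow> bool" where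
  "positively_graded_K_algebra K A \<longleftrightarrow> graded_K_algebra K A \<and>
     (\<forall>i<0. alg_part A i = {\<zero>\<^bsub>A\<^esub>})"

definition subalgebra_of :: "'k ring \<Rightarrow> ('k, 'a, 'c) module_scheme \<Rightarrow> 'a set \<Rightarrow> bool" where
  "subalgebra_of K A B \<longleftrightarrow> subring B A \<and> (\<forall>k\<in>carrier K. \<forall>b\<in>B. k \<odot>\<^bsub>A\<^esub> b \<in> B)"

definition alg_generated_in_degrees :: "'k ring \<Rightarrow> ('k, 'a) graded_algebra \<Rightarrow> int set \<Rightarrow> bool" where
  "alg_generated_in_degrees K A D \<longleftrightarrow>
     (\<forall>B. subalgebra_of K A B \<and> (\<Union>d\<in>D. alg_part A d) \<subseteq> B \<longrightarrow> B = carrier A)"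

definition deg0_ring :: "('k, 'a) graded_algebra \<Rightarrow> ('k, 'a) graded_algebra" where
  "deg0_ring A = A\<lparr>carrier := alg_part A 0\<rparr>"

definition graded_right_module ::
  "('k, 'a) graded_algebra \<Rightarrow> ('a, 'm) graded_right_module \<Rightarrow> bool" where
  "graded_right_module B M \<longleftrightarrow> right_module B M \<and> graded_by M (mod_part M) \<and>
     (\<forall>i j. \<forall>x\<in>mod_part M i. \<forall>b\<in>alg_part B j. x \<triangleleft>\<^bsub>M\<^esub> b \<in> mod_part M (i + j))"

definition mod_generated_in_degrees ::
  "('k, 'a) graded_algebra \<Rightarrow> ('a, 'm) graded_right_module \<Rightarrow> int set \<Rightarrow> bool" where
  "mod_generated_in_degrees B M D \<longleftrightarrow>
     (\<forall>N. right_submodule B M N \<and> (\<Union>d\<in>D. mod_part M d) \<subseteq> N \<longrightarrow> N = carrier M)"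

definition graded_isos ::
  "('k, 'a) graded_algebra \<Rightarrow> ('a, 'm) graded_right_module \<Rightarrow> ('a, 'n) graded_right_module
    \<Rightarrow> ('m \<Rightarrow> 'n) set" where
  "graded_isos B X Y = {f. bij_betw f (carrier X) (carrier Y) \<and>
     (\<forall>x\<in>carrier X. \<forall>y\<in>carrier X. f (x \<oplus>\<^bsub>X\<^esub> y) = f x \<oplus>\<^bsub>Y\<^esub> f y) \<and>
     (\<forall>x\<in>carrier X. \<forall>b\<in>carrier B. f (x \<triangleleft>\<^bsub>X\<^esub> b) = f x \<triangleleft>\<^bsub>Y\<^esub> b) \<and>
     (\<forall>i. f ` mod_part X i \<subseteq> mod_part Y i)}"


section \<open>Ring-supporting sets, right modular pairs and truncations\<close>

definition colon :: "int set \<Rightarrow> int set \<Rightarrow> int set" where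
  "colon S U = {m. (\<lambda>u. m + u) ` U = S}"

definition ring_supporting :: "int set \<Rightarrow> bool" where
  "ring_supporting U \<longleftrightarrow> 0 \<in> U \<and>
     (\<forall>u\<in>U. \<forall>v\<in>U. \<forall>w\<in>U. u + v + w \<in> U \<longrightarrow> (u + v \<in> U \<longleftrightarrow> v + w \<in> U))"

definition right_modular :: "int set \<Rightarrow> int set \<Rightarrow> bool" where
  "right_modular S U \<longleftrightarrow> S \<noteq> {} \<and> U \<noteq> {} \<and> ring_supporting U \<and>
     (\<forall>s\<in>S. \<forall>u\<in>U. \<forall>v\<in>U. s + u + v \<in> S \<longrightarrow> (s + u \<in> S \<longleftrightarrow> u + v \<in> U))"

text \<open>The truncated operations are given on homogeneous elements and extended biadditively to the
  elements with homogeneous components in the given degrees.\<close>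

definition alg_trunc :: "('k, 'a) graded_algebra \<Rightarrow> int set \<Rightarrow> ('k, 'a) graded_algebra" where
  "alg_trunc A U = A\<lparr>
     carrier := {a \<in> carrier A. hsupp A (alg_part A) a \<subseteq> U},
     monoid.mult := (\<lambda>a b. \<Oplus>\<^bsub>A\<^esub>i\<in>hsupp A (alg_part A) a. \<Oplus>\<^bsub>A\<^esub>j\<in>hsupp A (alg_part A) b.
       if i + j \<in> U then hcomp A (alg_part A) a i \<otimes>\<^bsub>A\<^esub> hcomp A (alg_part A) b j else \<zero>\<^bsub>A\<^esub>),
     alg_part := (\<lambda>i. if i \<in> U then alg_part A i else {\<zero>\<^bsub>A\<^esub>})\<rparr>"

definition mod_trunc ::
  "('k, 'a) graded_algebra \<Rightarrow> ('a, 'm) graded_right_module \<Rightarrow> int set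
    \<Rightarrow> ('a, 'm) graded_right_module" where
  "mod_trunc A M S = M\<lparr>
     carrier := {x \<in> carrier M. hsupp M (mod_part M) x \<subseteq> S},
     ract := (\<lambda>x a. \<Oplus>\<^bsub>M\<^esub>i\<in>hsupp M (mod_part M) x. \<Oplus>\<^bsub>M\<^esub>j\<in>hsupp A (alg_part A) a.
       if i + j \<in> S then hcomp M (mod_part M) x i \<triangleleft>\<^bsub>M\<^esub> hcomp A (alg_part A) a j else \<zero>\<^bsub>M\<^esub>),
     mod_part := (\<lambda>i. if i \<in> S then mod_part M i else {\<zero>\<^bsub>M\<^esub>})\<rparr>"

text \<open>HOL cannot quantify existentially over types, so the type of the elements of the lift \<open>M\<close>
  has to be chosen. The lemma \<open>liftable_if_lift_in_any_type\<close> at the end shows that this is no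
  restriction: a lift whose elements have an arbitrary type \<open>'m\<close> yields one with elements in the
  chosen type, because the submodule generated by the image of \<open>X\<close> consists of finite sums of
  products \<open>x a\<close> and is therefore no larger than the set of lists of pairs \<open>(x, a)\<close>.\<close>

definition liftable ::
  "('k, 'a) graded_algebra \<Rightarrow> int set \<Rightarrow> int set \<Rightarrow> ('a, 'x) graded_right_module \<Rightarrow> bool" where
  "liftable A S U X \<longleftrightarrow> (\<exists>M :: ('a, ('x \<times> 'a) list) graded_right_module.
     graded_right_module A M \<and> graded_isos (alg_trunc A U) X (mod_trunc A M S) \<noteq> {})"


section \<open>The multiplication maps and their kernels\<close>

definition comp_right ::
  "('a, 'x) graded_right_module \<Rightarrow> int \<Rightarrow> ('a, 'x) graded_right_module" where
  "comp_right X s = X\<lparr>carrier := mod_part X s\<rparr>"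

definition comp_left :: "('k, 'a) graded_algebra \<Rightarrow> int \<Rightarrow> ('a, 'a) module" where
  "comp_left A u = \<lparr>carrier = alg_part A u, monoid.mult = monoid.mult A, one = \<one>\<^bsub>A\<^esub>,
     ring.zero = \<zero>\<^bsub>A\<^esub>, add = add A, smult = monoid.mult A\<rparr>"

definition tensor_comp ::
  "('k, 'a) graded_algebra \<Rightarrow> ('a, 'x) graded_right_module \<Rightarrow> int \<Rightarrow> int
    \<Rightarrow> ('x \<times> 'a \<Rightarrow>\<^sub>0 int) set monoid" where
  "tensor_comp A X s u = tensor_prod (deg0_ring A) (comp_right X s) (comp_left A u)"

definition mu ::
  "('a, 'x) graded_right_module \<Rightarrow> ('x \<times> 'a \<Rightarrow>\<^sub>0 int) set \<Rightarrow> 'x" where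
  "mu X = tensor_lift (add_monoid X) (ract X)"

definition Ker_mu ::
  "('k, 'a) graded_algebra \<Rightarrow> ('a, 'x) graded_right_module \<Rightarrow> int \<Rightarrow> int
    \<Rightarrow> ('x \<times> 'a \<Rightarrow>\<^sub>0 int) set set" where
  "Ker_mu A X s u = kernel (tensor_comp A X s u) (add_monoid X) (mu X)"

text \<open>The right action \<open>(x \<otimes> a) b = x \<otimes> (a b)\<close> of \<open>b \<in> A\<^sub>i\<close>, from
  \<open>X\<^sub>s \<otimes> A\<^sub>u\<close> to \<open>X\<^sub>s \<otimes> A\<^sub>u\<^sub>+\<^sub>i\<close>.\<close>

definition tensor_act ::
  "('k, 'a) graded_algebra \<Rightarrow> ('a, 'x) graded_right_module \<Rightarrow> int \<Rightarrow> int \<Rightarrow> int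
    \<Rightarrow> ('x \<times> 'a \<Rightarrow>\<^sub>0 int) set \<Rightarrow> 'a \<Rightarrow> ('x \<times> 'a \<Rightarrow>\<^sub>0 int) set" where
  "tensor_act A X s u i t b = tensor_lift (tensor_comp A X s (u + i))
     (\<lambda>x a. tensor_elem (deg0_ring A) (comp_right X s) (comp_left A (u + i)) x (a \<otimes>\<^bsub>A\<^esub> b)) t"

text \<open>\<open>Ker(\<mu>\<^sub>s\<^sub>,\<^sub>u) A\<^sub>i\<close>, the set of finite sums of products.\<close>

definition Ker_mu_times ::
  "('k, 'a) graded_algebra \<Rightarrow> ('a, 'x) graded_right_module \<Rightarrow> int \<Rightarrow> int \<Rightarrow> int
    \<Rightarrow> ('x \<times> 'a \<Rightarrow>\<^sub>0 int) set set" where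
  "Ker_mu_times A X s u i = generate (tensor_comp A X s (u + i))
     {tensor_act A X s u i t b | t b. t \<in> Ker_mu A X s u \<and> b \<in> alg_part A i}"

section \<open>Independence of liftability from the type of the lift\<close>

context abelian_group
begin

lemma is_decomp_superset:
  assumes "graded_by G D" "is_decomp G D x f" "finite I" "{i. f i \<noteq> \<zero>} \<subseteq> I"
  shows "finsum G f I = x"
proof -
  have c: "f i \<in> carrier G" for i
    using assms(1,2) additive_subgroup.a_Hcarr unfolding graded_by_def is_decomp_def by metis
  have "finsum G f I = finsum G f {i. f i \<noteq> \<zero>}"
    by (rule add.finprod_mono_neutral_cong_right) (use assms c in auto)
  then show ?thesis using assms(2) by (simp add: is_decomp_def)
qed

lemma is_decompI:
  assumes "graded_by G D" "\<And>i. f i \<in> D i" "finite I" "{i. f i \<noteq> \<zero>} \<subseteq> I" "finsum G f I = x"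
  shows "is_decomp G D x f"
proof -
  have c: "f i \<in> carrier G" for i
    using assms(1,2) additive_subgroup.a_Hcarr unfolding graded_by_def by metis
  have "finsum G f I = finsum G f {i. f i \<noteq> \<zero>}"
    by (rule add.finprod_mono_neutral_cong_right) (use assms c in auto)
  then show ?thesis using assms finite_subset by (auto simp: is_decomp_def)
qed

lemma hcomp_eq:
  assumes "graded_by G D" "is_decomp G D x f" "x \<in> carrier G"
  shows "hcomp G D x = f"
  unfolding hcomp_def using assms by (intro the1_equality) (auto simp: graded_by_def)

lemma is_decomp_hcomp:
  assumes "graded_by G D" "x \<in> carrier G"
  shows "is_decomp G D x (hcomp G D x)"
  unfolding hcomp_def by (rule theI'[of "is_decomp G D x"]) (use assms in \<open>simp add: graded_by_def\<close>)

lemma graded_part_carrier: "graded_by G D \<Longrightarrow> x \<in> D i \<Longrightarrow> x \<in> carrier G"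
  using additive_subgroup.a_Hcarr unfolding graded_by_def by metis

lemma graded_part_zero: "graded_by G D \<Longrightarrow> \<zero> \<in> D i"
  by (simp add: additive_subgroup.zero_closed graded_by_def)

lemma graded_part_add: "graded_by G D \<Longrightarrow> x \<in> D i \<Longrightarrow> y \<in> D i \<Longrightarrow> x \<oplus> y \<in> D i"
  by (simp add: additive_subgroup.a_closed graded_by_def)

lemma hcomp_in: "graded_by G D \<Longrightarrow> x \<in> carrier G \<Longrightarrow> hcomp G D x i \<in> D i"
  using is_decomp_hcomp unfolding is_decomp_def by blast

lemma finite_hsupp: "graded_by G D \<Longrightarrow> x \<in> carrier G \<Longrightarrow> finite (hsupp G D x)"
  using is_decomp_hcomp unfolding is_decomp_def hsupp_def by blast

lemma finsum_hcomp:
  "graded_by G D \<Longrightarrow> x \<in> carrier G \<Longrightarrow> finsum G (hcomp G D x) (hsupp G D x) = x"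
  using is_decomp_hcomp unfolding is_decomp_def hsupp_def by blast

lemma hcomp_homogeneous:
  assumes "graded_by G D" "x \<in> D i"
  shows "hcomp G D x = (\<lambda>j. if j = i then x else \<zero>)"
proof (rule hcomp_eq[OF assms(1)])
  show c: "x \<in> carrier G" using assms graded_part_carrier by blast
  show "is_decomp G D x (\<lambda>j. if j = i then x else \<zero>)"
    by (rule is_decompI[where I = "{i}"]) (use assms c graded_part_zero in auto)
qed

lemma hcomp_add:
  assumes g: "graded_by G D" and x: "x \<in> carrier G" and y: "y \<in> carrier G"
  shows "hcomp G D (x \<oplus> y) = (\<lambda>i. hcomp G D x i \<oplus> hcomp G D y i)"
proof (rule hcomp_eq[OF g])
  let ?I = "hsupp G D x \<union> hsupp G D y"
  have c: "hcomp G D z i \<in> carrier G" if "z \<in> carrier G" for z i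
    using graded_part_carrier[OF g] hcomp_in[OF g that] by blast
  have f: "finite ?I" using finite_hsupp[OF g] x y by blast
  show "is_decomp G D (x \<oplus> y) (\<lambda>i. hcomp G D x i \<oplus> hcomp G D y i)"
  proof (rule is_decompI[OF g _ f])
    show "hcomp G D x i \<oplus> hcomp G D y i \<in> D i" for i
      using graded_part_add[OF g] hcomp_in[OF g] x y by blast
    show "{i. hcomp G D x i \<oplus> hcomp G D y i \<noteq> \<zero>} \<subseteq> ?I"
      by (auto simp: hsupp_def)
    have "finsum G (hcomp G D x) ?I = x"
      by (rule is_decomp_superset[OF g is_decomp_hcomp[OF g x] f]) (auto simp: hsupp_def)
    moreover have "finsum G (hcomp G D y) ?I = y"
      by (rule is_decomp_superset[OF g is_decomp_hcomp[OF g y] f]) (auto simp: hsupp_def)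
    ultimately show "(\<Oplus>i\<in>?I. hcomp G D x i \<oplus> hcomp G D y i) = x \<oplus> y"
      by (subst finsum_addf) (use c x y in auto)
  qed
  show "x \<oplus> y \<in> carrier G" using x y by simp
qed

lemma finsum_induct:
  assumes "finite I" "\<And>i. i \<in> I \<Longrightarrow> h i \<in> carrier G" "\<And>i. i \<in> I \<Longrightarrow> P (h i)" "P \<zero>"
    and add: "\<And>x y. x \<in> carrier G \<Longrightarrow> y \<in> carrier G \<Longrightarrow> P x \<Longrightarrow> P y \<Longrightarrow> P (x \<oplus> y)"
  shows "P (finsum G h I)"
  using assms(1,2,3)
proof (induction I)
  case empty then show ?case using assms(4) by simp
next
  case (insert i I)
  have "finsum G h (insert i I) = h i \<oplus> finsum G h I"
    by (rule finsum_insert) (use insert in auto)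
  then show ?case using insert by (auto intro!: add finsum_closed)
qed

lemma graded_induct:
  assumes g: "graded_by G D" and x: "x \<in> carrier G" and "P \<zero>"
    and "\<And>i y. y \<in> D i \<Longrightarrow> P y"
    and "\<And>x y. x \<in> carrier G \<Longrightarrow> y \<in> carrier G \<Longrightarrow> P x \<Longrightarrow> P y \<Longrightarrow> P (x \<oplus> y)"
  shows "P x"
proof -
  have "P (finsum G (hcomp G D x) (hsupp G D x))"
    using graded_part_carrier[OF g hcomp_in[OF g x]] assms(4)[OF hcomp_in[OF g x]] assms(3,5)
    by (rule finsum_induct[OF finite_hsupp[OF g x]])
  then show ?thesis by (simp add: finsum_hcomp[OF g x])
qed

end

text \<open>The submodule \<open>N\<close> of \<open>M\<close>, carried along a map \<open>g\<close> injective on \<open>N\<close>.\<close>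

definition transport ::
  "('a, 'm) graded_right_module \<Rightarrow> 'm set \<Rightarrow> ('m \<Rightarrow> 'n) \<Rightarrow> ('a, 'n) graded_right_module" where
  "transport M N g = \<lparr>carrier = g ` N, monoid.mult = undefined, one = undefined,
     ring.zero = g \<zero>\<^bsub>M\<^esub>,
     add = (\<lambda>p q. g (inv_into N g p \<oplus>\<^bsub>M\<^esub> inv_into N g q)),
     ract = (\<lambda>p a. g (inv_into N g p \<triangleleft>\<^bsub>M\<^esub> a)),
     mod_part = (\<lambda>i. g ` (N \<inter> mod_part M i))\<rparr>"

locale transport_setup =
  fixes A :: "('k, 'a) graded_algebra" and M :: "('a, 'm) graded_right_module"
    and N :: "'m set" and g :: "'m \<Rightarrow> 'n"
  assumes M: "graded_right_module A M" and N: "right_submodule A M N"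
    and gA: "graded_by A (alg_part A)"
    and comps: "\<And>x i. x \<in> N \<Longrightarrow> hcomp M (mod_part M) x i \<in> N" and inj: "inj_on g N"
begin

sublocale right_module A M using M by (simp add: graded_right_module_def)

sublocale N: additive_subgroup N M using N by (simp add: right_submodule_def)

abbreviation "T \<equiv> transport M N g"
abbreviation "k \<equiv> inv_into N g"

lemma gM: "graded_by M (mod_part M)" using M by (simp add: graded_right_module_def)

lemma kg [simp]: "x \<in> N \<Longrightarrow> k (g x) = x" using inj by simp

lemma ract_N: "x \<in> N \<Longrightarrow> a \<in> carrier A \<Longrightarrow> x \<triangleleft>\<^bsub>M\<^esub> a \<in> N"
  using N by (simp add: right_submodule_def)

lemma T_sel:
  "carrier T = g ` N" "\<zero>\<^bsub>T\<^esub> = g \<zero>\<^bsub>M\<^esub>" "mod_part T = (\<lambda>i. g ` (N \<inter> mod_part M i))"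
  by (simp_all add: transport_def)

lemma T_add [simp]: "x \<in> N \<Longrightarrow> y \<in> N \<Longrightarrow> g x \<oplus>\<^bsub>T\<^esub> g y = g (x \<oplus>\<^bsub>M\<^esub> y)"
  by (simp add: transport_def)

lemma T_ract [simp]: "x \<in> N \<Longrightarrow> g x \<triangleleft>\<^bsub>T\<^esub> a = g (x \<triangleleft>\<^bsub>M\<^esub> a)"
  by (simp add: transport_def)

lemma N_carr [simp]: "x \<in> N \<Longrightarrow> x \<in> carrier M" by (rule N.a_Hcarr)

lemma N_neg: "x \<in> N \<Longrightarrow> \<ominus>\<^bsub>M\<^esub> x \<in> N"
  using N.a_inv_closed M.abelian_group_axioms by blast

lemma abelian_group_T: "abelian_group T"
proof (rule abelian_groupI)
  show "\<exists>y\<in>carrier T. y \<oplus>\<^bsub>T\<^esub> x = \<zero>\<^bsub>T\<^esub>" if "x \<in> carrier T" for x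
  proof -
    from that obtain z where z: "z \<in> N" "x = g z" by (auto simp: T_sel)
    then have "g (\<ominus>\<^bsub>M\<^esub> z) \<oplus>\<^bsub>T\<^esub> x = \<zero>\<^bsub>T\<^esub>"
      using N_neg by (simp add: T_sel M.l_neg)
    then show ?thesis using z N_neg by (auto simp: T_sel)
  qed
qed (auto simp: T_sel M.a_ac N.a_closed)

lemma right_module_T: "right_module A T"
proof (intro right_module.intro right_module_axioms.intro)
  show "ring A" by (rule R.ring_axioms)
  show "abelian_group T" by (rule abelian_group_T)
qed (auto simp: T_sel ract_N ract_l_distr ract_r_distr ract_assoc ract_one N.a_closed)

lemma finsum_T:
  assumes "finite I" "\<And>i. i \<in> I \<Longrightarrow> h i \<in> N"
  shows "finsum T (\<lambda>i. g (h i)) I = g (finsum M h I) \<and> finsum M h I \<in> N"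
proof -
  interpret T: abelian_group T by (rule abelian_group_T)
  show ?thesis using assms
  proof (induction I)
    case empty then show ?case by (simp add: T_sel(2)[symmetric])
  next
    case (insert i I)
    have "finsum T (\<lambda>i. g (h i)) (insert i I) = g (h i) \<oplus>\<^bsub>T\<^esub> finsum T (\<lambda>i. g (h i)) I"
      by (rule T.finsum_insert) (use insert in \<open>auto simp: T_sel\<close>)
    moreover have "finsum M h (insert i I) = h i \<oplus>\<^bsub>M\<^esub> finsum M h I"
      by (rule M.finsum_insert) (use insert in auto)
    ultimately show ?case using insert by (simp add: N.a_closed)
  qed
qed

lemma g_eq_zero: "x \<in> N \<Longrightarrow> g x = g \<zero>\<^bsub>M\<^esub> \<longleftrightarrow> x = \<zero>\<^bsub>M\<^esub>"
  using inj by (simp add: inj_on_eq_iff)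

lemma decomp_T:
  assumes "\<And>i. f i \<in> N" "x \<in> N"
  shows "is_decomp T (mod_part T) (g x) (\<lambda>i. g (f i)) \<longleftrightarrow> is_decomp M (mod_part M) x f"
proof -
  have 1: "{i. g (f i) \<noteq> \<zero>\<^bsub>T\<^esub>} = {i. f i \<noteq> \<zero>\<^bsub>M\<^esub>}"
    using assms g_eq_zero by (auto simp: T_sel)
  have 2: "g (f i) \<in> mod_part T i \<longleftrightarrow> f i \<in> mod_part M i" for i
    using assms(1) inj by (auto simp: T_sel inj_on_eq_iff)
  show ?thesis unfolding is_decomp_def 1 2
    using finsum_T[of "{i. f i \<noteq> \<zero>\<^bsub>M\<^esub>}" f] assms inj by (auto simp: inj_on_eq_iff)
qed

lemma ex1_decomp_T:
  assumes x: "x \<in> N"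
  shows "\<exists>!f. is_decomp T (mod_part T) (g x) f"
proof (rule ex1I)
  show "is_decomp T (mod_part T) (g x) (\<lambda>i. g (hcomp M (mod_part M) x i))"
    using decomp_T[OF comps[OF x] x] M.is_decomp_hcomp[OF gM] x by simp
next
  fix f assume f: "is_decomp T (mod_part T) (g x) f"
  then have fi: "f i \<in> g ` N" for i by (auto simp: is_decomp_def T_sel)
  have e: "f = (\<lambda>i. g (k (f i)))" using fi by (auto simp: f_inv_into_f)
  have "is_decomp M (mod_part M) x (\<lambda>i. k (f i))"
    using decomp_T[of "\<lambda>i. k (f i)" x] f e fi x by (simp add: inv_into_into)
  then have "hcomp M (mod_part M) x = (\<lambda>i. k (f i))"
    using M.hcomp_eq[OF gM] x by simp
  then show "f = (\<lambda>i. g (hcomp M (mod_part M) x i))" using e by simp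
qed

lemma graded_T: "graded_by T (mod_part T)"
  unfolding graded_by_def
proof (intro conjI allI ballI)
  interpret T: abelian_group T by (rule abelian_group_T)
  fix i
  interpret Mi: additive_subgroup "mod_part M i" M using gM by (simp add: graded_by_def)
  show "additive_subgroup (mod_part T i) T"
  proof (intro additive_subgroup.intro T.add.subgroupI)
    show "mod_part T i \<subseteq> carrier T" by (auto simp: T_sel)
    have "\<zero>\<^bsub>M\<^esub> \<in> N \<inter> mod_part M i" using N.zero_closed Mi.zero_closed by blast
    then show "mod_part T i \<noteq> {}" unfolding T_sel by blast
    show "x \<oplus>\<^bsub>T\<^esub> y \<in> mod_part T i" if "x \<in> mod_part T i" "y \<in> mod_part T i" for x y
      using that by (auto simp: T_sel N.a_closed Mi.a_closed)
    show "\<ominus>\<^bsub>T\<^esub> x \<in> mod_part T i" if xi: "x \<in> mod_part T i" for x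
    proof -
      obtain y where y: "y \<in> N" "y \<in> mod_part M i" "x = g y" using xi by (auto simp: T_sel)
      have n: "\<ominus>\<^bsub>M\<^esub> y \<in> mod_part M i"
        using y Mi.a_inv_closed M.abelian_group_axioms by blast
      have "\<ominus>\<^bsub>T\<^esub> x = g (\<ominus>\<^bsub>M\<^esub> y)"
        by (rule T.minus_equality) (use y N_neg in \<open>auto simp: T_sel M.l_neg\<close>)
      then show ?thesis using y N_neg n by (auto simp: T_sel)
    qed
  qed
next
  fix p assume "p \<in> carrier T"
  then obtain x where "x \<in> N" "p = g x" by (auto simp: T_sel)
  then show "\<exists>!f. is_decomp T (mod_part T) p f" using ex1_decomp_T by simp
qed

lemma graded_right_module_T: "graded_right_module A T"
  unfolding graded_right_module_def
proof (intro conjI allI ballI right_module_T graded_T)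
  fix i j p b assume p: "p \<in> mod_part T i" and b: "b \<in> alg_part A j"
  obtain x where x: "x \<in> N" "x \<in> mod_part M i" "p = g x" using p by (auto simp: T_sel)
  have "b \<in> carrier A" using R.graded_part_carrier gA b by blast
  moreover have "x \<triangleleft>\<^bsub>M\<^esub> b \<in> mod_part M (i + j)"
    using M x b by (simp add: graded_right_module_def)
  ultimately show "p \<triangleleft>\<^bsub>T\<^esub> b \<in> mod_part T (i + j)" using x by (auto simp: T_sel ract_N)
qed

lemma hcomp_T:
  assumes "x \<in> N"
  shows "hcomp T (mod_part T) (g x) = (\<lambda>i. g (hcomp M (mod_part M) x i))"
proof (rule abelian_group.hcomp_eq[OF abelian_group_T graded_T])
  show "is_decomp T (mod_part T) (g x) (\<lambda>i. g (hcomp M (mod_part M) x i))"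
    using decomp_T[OF comps[OF assms] assms] M.is_decomp_hcomp[OF gM] assms by simp
  show "g x \<in> carrier T" using assms by (simp add: T_sel)
qed

lemma hsupp_T: "x \<in> N \<Longrightarrow> hsupp T (mod_part T) (g x) = hsupp M (mod_part M) x"
  by (simp add: hsupp_def hcomp_T T_sel(2) comps g_eq_zero)

lemma trunc_ract_T:
  assumes x: "x \<in> N" and a: "a \<in> carrier A"
  shows "g x \<triangleleft>\<^bsub>mod_trunc A T S\<^esub> a = g (x \<triangleleft>\<^bsub>mod_trunc A M S\<^esub> a)"
proof -
  let ?t = "\<lambda>i j. if i + j \<in> S
    then hcomp M (mod_part M) x i \<triangleleft>\<^bsub>M\<^esub> hcomp A (alg_part A) a j else \<zero>\<^bsub>M\<^esub>"
  let ?I = "hsupp M (mod_part M) x" and ?J = "hsupp A (alg_part A) a"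
  have ha: "hcomp A (alg_part A) a j \<in> carrier A" for j
    using R.hcomp_in[OF gA a] R.graded_part_carrier[OF gA] by blast
  have t: "?t i j \<in> N" for i j using comps[OF x] ha ract_N N.zero_closed by simp
  have fJ: "finite ?J" using R.finite_hsupp[OF gA a] .
  have fI: "finite ?I" using M.finite_hsupp[OF gM] x by simp
  have eq: "(if i + j \<in> S then hcomp T (mod_part T) (g x) i \<triangleleft>\<^bsub>T\<^esub> hcomp A (alg_part A) a j
      else \<zero>\<^bsub>T\<^esub>) = g (?t i j)" for i j
    using x comps[OF x] by (simp add: hcomp_T T_sel(2))
  have inner: "finsum T (\<lambda>j. g (?t i j)) ?J = g (finsum M (?t i) ?J)" "finsum M (?t i) ?J \<in> N" for i
    using finsum_T[OF fJ, of "?t i"] t by blast+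
  have "finsum T (\<lambda>i. finsum T (\<lambda>j. g (?t i j)) ?J) ?I = g (finsum M (\<lambda>i. finsum M (?t i) ?J) ?I)"
    unfolding inner(1) using finsum_T[OF fI, of "\<lambda>i. finsum M (?t i) ?J"] inner(2) by blast
  then show ?thesis unfolding mod_trunc_def by (simp add: hsupp_T[OF x] eq)
qed

lemma trunc_T_iso:
  assumes f: "f \<in> graded_isos (alg_trunc A U) X (mod_trunc A M S)" and fN: "f ` carrier X \<subseteq> N"
    and X: "\<And>i. mod_part X i \<subseteq> carrier X"
  shows "g \<circ> f \<in> graded_isos (alg_trunc A U) X (mod_trunc A T S)"
proof -
  have b: "bij_betw f (carrier X) (carrier (mod_trunc A M S))"
    using f by (simp add: graded_isos_def)
  then have im: "f ` carrier X = carrier (mod_trunc A M S)" by (simp add: bij_betw_def)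
  have "carrier (mod_trunc A T S) = g ` {x \<in> N. hsupp M (mod_part M) x \<subseteq> S}"
    by (auto simp: mod_trunc_def T_sel(1) hsupp_T)
  also have "{x \<in> N. hsupp M (mod_part M) x \<subseteq> S} = carrier (mod_trunc A M S)"
    using fN im by (auto simp: mod_trunc_def)
  finally have c: "carrier (mod_trunc A T S) = g ` carrier (mod_trunc A M S)" .
  have "inj_on g (carrier (mod_trunc A M S))" using inj fN im inj_on_subset by metis
  then have "bij_betw (g \<circ> f) (carrier X) (carrier (mod_trunc A T S))"
    unfolding c using b by (auto intro: bij_betw_trans inj_on_imp_bij_betw)
  moreover have "g (f (x \<oplus>\<^bsub>X\<^esub> y)) = g (f x) \<oplus>\<^bsub>mod_trunc A T S\<^esub> g (f y)"
    if "x \<in> carrier X" "y \<in> carrier X" for x y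
  proof -
    have "f (x \<oplus>\<^bsub>X\<^esub> y) = f x \<oplus>\<^bsub>M\<^esub> f y"
      using f that by (simp add: graded_isos_def mod_trunc_def)
    moreover have "f x \<in> N" "f y \<in> N" using fN that by auto
    ultimately show ?thesis by (simp add: mod_trunc_def)
  qed
  moreover have "g (f (x \<triangleleft>\<^bsub>X\<^esub> a)) = g (f x) \<triangleleft>\<^bsub>mod_trunc A T S\<^esub> a"
    if "x \<in> carrier X" "a \<in> carrier (alg_trunc A U)" for x a
  proof -
    have "f (x \<triangleleft>\<^bsub>X\<^esub> a) = f x \<triangleleft>\<^bsub>mod_trunc A M S\<^esub> a" using f that by (simp add: graded_isos_def)
    moreover have "f x \<in> N" "a \<in> carrier A" using fN that by (auto simp: alg_trunc_def)
    ultimately show ?thesis by (simp add: trunc_ract_T)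
  qed
  moreover have "g (f x) \<in> mod_part (mod_trunc A T S) i" if x: "x \<in> mod_part X i" for x i
  proof -
    have "f x \<in> mod_part (mod_trunc A M S) i" using f x unfolding graded_isos_def by blast
    moreover have "f x \<in> N" using fN X x by blast
    ultimately show ?thesis by (auto simp: mod_trunc_def T_sel split: if_splits)
  qed
  ultimately show ?thesis by (auto simp: graded_isos_def)
qed

end

lemma liftable_if_lift_in_any_type:
  fixes A :: "('k, 'a) graded_algebra" and X :: "('a, 'x) graded_right_module"
    and M :: "('a, 'm) graded_right_module"
  assumes A: "graded_K_algebra K A" and X: "graded_right_module (alg_trunc A U) X"
    and M: "graded_right_module A M"
    and f: "f \<in> graded_isos (alg_trunc A U) X (mod_trunc A M S)"
  shows "liftable A S U X"
proof -
  interpret right_module A M using M by (simp add: graded_right_module_def)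
  have gA: "graded_by A (alg_part A)" using A by (simp add: graded_K_algebra_def)
  have gM: "graded_by M (mod_part M)" using M by (simp add: graded_right_module_def)
  have Xp: "mod_part X i \<subseteq> carrier X" for i
    using X abelian_group.graded_part_carrier[of X "mod_part X"] right_module.axioms(2)
    unfolding graded_right_module_def by blast
  have im: "f ` carrier X = {x \<in> carrier M. hsupp M (mod_part M) x \<subseteq> S}"
    using f by (auto simp: graded_isos_def bij_betw_def mod_trunc_def)
  have fc: "f x \<in> carrier M" if "x \<in> carrier X" for x using im that by blast
  define ev where "ev l = foldr (\<lambda>p m. f (fst p) \<triangleleft>\<^bsub>M\<^esub> snd p \<oplus>\<^bsub>M\<^esub> m) l \<zero>\<^bsub>M\<^esub>" for l
  define L where "L = {l. set l \<subseteq> carrier X \<times> carrier A}"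
  define N where "N = ev ` L"
  have ev_simps: "ev [] = \<zero>\<^bsub>M\<^esub>" "ev (p # l) = f (fst p) \<triangleleft>\<^bsub>M\<^esub> snd p \<oplus>\<^bsub>M\<^esub> ev l" for p l
    by (simp_all add: ev_def)
  have ev_c: "ev l \<in> carrier M" if "l \<in> L" for l
    using that by (induction l) (auto simp: ev_simps L_def fc ract_closed)
  have ev_append: "ev (l @ l') = ev l \<oplus>\<^bsub>M\<^esub> ev l'" if "l \<in> L" "l' \<in> L" for l l'
    using that
  proof (induction l)
    case Nil then show ?case by (simp add: ev_simps ev_c)
  next
    case (Cons p l)
    then have "l \<in> L" "f (fst p) \<triangleleft>\<^bsub>M\<^esub> snd p \<in> carrier M" by (auto simp: L_def fc ract_closed)
    then show ?case using Cons by (simp add: ev_simps M.a_assoc ev_c)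
  qed
  have N_add: "x \<oplus>\<^bsub>M\<^esub> y \<in> N" if xy: "x \<in> N" "y \<in> N" for x y
  proof -
    obtain l l' where l: "l \<in> L" "l' \<in> L" "x = ev l" "y = ev l'" using xy by (auto simp: N_def)
    then have "x \<oplus>\<^bsub>M\<^esub> y = ev (l @ l')" by (simp add: ev_append)
    moreover have "l @ l' \<in> L" using l by (simp add: L_def)
    ultimately show ?thesis by (simp add: N_def)
  qed
  have N_zero: "\<zero>\<^bsub>M\<^esub> \<in> N"
    unfolding N_def by (rule image_eqI[of _ _ "[]"]) (simp_all add: ev_simps L_def)
  have N_prod: "f x \<triangleleft>\<^bsub>M\<^esub> a \<in> N" if "x \<in> carrier X" "a \<in> carrier A" for x a
  proof -
    have "[(x, a)] \<in> L" using that by (simp add: L_def)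
    moreover have "ev [(x, a)] = f x \<triangleleft>\<^bsub>M\<^esub> a"
      using that by (simp add: ev_simps fc ract_closed)
    ultimately show ?thesis unfolding N_def by (metis image_eqI)
  qed
  have N_ind: "P z" if z: "z \<in> N" and P0: "P \<zero>\<^bsub>M\<^esub>"
    and P1: "\<And>x a z. \<lbrakk>x \<in> carrier X; a \<in> carrier A; z \<in> N; P z\<rbrakk> \<Longrightarrow> P (f x \<triangleleft>\<^bsub>M\<^esub> a \<oplus>\<^bsub>M\<^esub> z)"
    for z P
  proof -
    have "P (ev l)" if "l \<in> L" for l
      using that
    proof (induction l)
      case Nil then show ?case by (simp add: ev_simps P0)
    next
      case (Cons p l)
      then have "l \<in> L" "fst p \<in> carrier X" "snd p \<in> carrier A" by (auto simp: L_def)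
      then show ?case using Cons P1 by (simp add: ev_simps N_def)
    qed
    then show ?thesis using z by (auto simp: N_def)
  qed
  have N_c: "N \<subseteq> carrier M" using ev_c by (auto simp: N_def)
  have zero_ract: "\<zero>\<^bsub>M\<^esub> \<triangleleft>\<^bsub>M\<^esub> b = \<zero>\<^bsub>M\<^esub>" if b: "b \<in> carrier A" for b
  proof -
    have "\<zero>\<^bsub>M\<^esub> \<triangleleft>\<^bsub>M\<^esub> b \<oplus>\<^bsub>M\<^esub> \<zero>\<^bsub>M\<^esub> \<triangleleft>\<^bsub>M\<^esub> b = \<zero>\<^bsub>M\<^esub> \<triangleleft>\<^bsub>M\<^esub> b"
      using ract_l_distr[of "\<zero>\<^bsub>M\<^esub>" "\<zero>\<^bsub>M\<^esub>" b] b by simp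
    then show ?thesis using ract_closed[of "\<zero>\<^bsub>M\<^esub>" b] b M.add.r_cancel_one by simp
  qed
  have N_ract: "z \<triangleleft>\<^bsub>M\<^esub> b \<in> N" if z: "z \<in> N" and b: "b \<in> carrier A" for z b
    using z
  proof (rule N_ind)
    show "\<zero>\<^bsub>M\<^esub> \<triangleleft>\<^bsub>M\<^esub> b \<in> N" using zero_ract[OF b] N_zero by simp
  next
    fix x a z assume h: "x \<in> carrier X" "a \<in> carrier A" "z \<in> N" "z \<triangleleft>\<^bsub>M\<^esub> b \<in> N"
    then have "(f x \<triangleleft>\<^bsub>M\<^esub> a \<oplus>\<^bsub>M\<^esub> z) \<triangleleft>\<^bsub>M\<^esub> b = f x \<triangleleft>\<^bsub>M\<^esub> (a \<otimes>\<^bsub>A\<^esub> b) \<oplus>\<^bsub>M\<^esub> z \<triangleleft>\<^bsub>M\<^esub> b"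
      using N_c b fc by (auto simp: ract_l_distr ract_closed ract_assoc)
    then show "(f x \<triangleleft>\<^bsub>M\<^esub> a \<oplus>\<^bsub>M\<^esub> z) \<triangleleft>\<^bsub>M\<^esub> b \<in> N" using h b N_add N_prod by simp
  qed
  have ract_zero: "x \<triangleleft>\<^bsub>M\<^esub> \<zero>\<^bsub>A\<^esub> = \<zero>\<^bsub>M\<^esub>" if x: "x \<in> carrier M" for x
  proof -
    have "x \<triangleleft>\<^bsub>M\<^esub> \<zero>\<^bsub>A\<^esub> \<oplus>\<^bsub>M\<^esub> x \<triangleleft>\<^bsub>M\<^esub> \<zero>\<^bsub>A\<^esub> = x \<triangleleft>\<^bsub>M\<^esub> \<zero>\<^bsub>A\<^esub>"
      using ract_r_distr[of x "\<zero>\<^bsub>A\<^esub>" "\<zero>\<^bsub>A\<^esub>"] x by simp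
    then show ?thesis using ract_closed[of x "\<zero>\<^bsub>A\<^esub>"] x M.add.r_cancel_one by simp
  qed
  have N_neg: "\<ominus>\<^bsub>M\<^esub> z \<in> N" if z: "z \<in> N" for z
  proof -
    have zc: "z \<in> carrier M" using z N_c by blast
    have "z \<triangleleft>\<^bsub>M\<^esub> (\<ominus>\<^bsub>A\<^esub> \<one>\<^bsub>A\<^esub>) \<oplus>\<^bsub>M\<^esub> z = z \<triangleleft>\<^bsub>M\<^esub> (\<ominus>\<^bsub>A\<^esub> \<one>\<^bsub>A\<^esub> \<oplus>\<^bsub>A\<^esub> \<one>\<^bsub>A\<^esub>)"
      using zc by (simp add: ract_r_distr ract_one)
    also have "\<dots> = \<zero>\<^bsub>M\<^esub>" using zc by (simp add: R.l_neg ract_zero)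
    finally have "\<ominus>\<^bsub>M\<^esub> z = z \<triangleleft>\<^bsub>M\<^esub> (\<ominus>\<^bsub>A\<^esub> \<one>\<^bsub>A\<^esub>)"
      using zc by (intro M.minus_equality) (auto simp: ract_closed)
    then show ?thesis using N_ract[OF z] by simp
  qed
  have N_sub: "right_submodule A M N"
    unfolding right_submodule_def
  proof (intro conjI ballI additive_subgroup.intro M.add.subgroupI)
    show "\<ominus>\<^bsub>M\<^esub> z \<in> N" if "z \<in> N" for z
      using N_neg[OF that] .
  qed (use N_c N_zero N_add N_ract in auto)
  define C where "C z \<longleftrightarrow> (\<forall>i. hcomp M (mod_part M) z i \<in> N)" for z
  have C_hom: "C z" if "z \<in> N" "z \<in> mod_part M i" for z i
    using M.hcomp_homogeneous[OF gM that(2)] that(1) N_zero by (simp add: C_def)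
  have C_zero: "C \<zero>\<^bsub>M\<^esub>" using C_hom N_zero M.graded_part_zero[OF gM] by blast
  have C_add: "C (x \<oplus>\<^bsub>M\<^esub> y)" if "x \<in> carrier M" "y \<in> carrier M" "C x" "C y" for x y
    using that M.hcomp_add[OF gM] N_add by (simp add: C_def)
  have C_hom_prod: "C (x \<triangleleft>\<^bsub>M\<^esub> a)" if x: "x \<in> mod_part M s" "x \<in> f ` carrier X" and a: "a \<in> carrier A"
    for x s a
    using gA a
  proof (rule R.graded_induct)
    have xc: "x \<in> carrier M" using M.graded_part_carrier[OF gM x(1)] .
    show "C (x \<triangleleft>\<^bsub>M\<^esub> \<zero>\<^bsub>A\<^esub>)" using ract_zero[OF xc] C_zero by simp
    show "C (x \<triangleleft>\<^bsub>M\<^esub> b)" if b: "b \<in> alg_part A j" for b j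
    proof (rule C_hom)
      show "x \<triangleleft>\<^bsub>M\<^esub> b \<in> mod_part M (s + j)"
        using M x b by (simp add: graded_right_module_def)
      show "x \<triangleleft>\<^bsub>M\<^esub> b \<in> N" using N_prod x R.graded_part_carrier[OF gA b] by blast
    qed
    show "C (x \<triangleleft>\<^bsub>M\<^esub> (b \<oplus>\<^bsub>A\<^esub> c))"
      if "b \<in> carrier A" "c \<in> carrier A" "C (x \<triangleleft>\<^bsub>M\<^esub> b)" "C (x \<triangleleft>\<^bsub>M\<^esub> c)" for b c
      using that xc C_add by (simp add: ract_r_distr ract_closed)
  qed
  have C_prod: "C (f x \<triangleleft>\<^bsub>M\<^esub> a)" if x: "x \<in> carrier X" and a: "a \<in> carrier A" for x a
  proof -
    let ?h = "hcomp M (mod_part M) (f x)" and ?I = "hsupp M (mod_part M) (f x)"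
    have fx: "f x \<in> carrier M" "?I \<subseteq> S" using im x by auto
    have hc: "?h i \<in> carrier M" for i
      using M.hcomp_in[OF gM fx(1)] M.graded_part_carrier[OF gM] by blast
    have "?h i \<in> f ` carrier X" if "i \<in> ?I" for i
    proof -
      have "hsupp M (mod_part M) (?h i) \<subseteq> {i}"
        using M.hcomp_homogeneous[OF gM M.hcomp_in[OF gM fx(1), of i]] by (auto simp: hsupp_def)
      then show ?thesis using hc fx(2) that unfolding im by blast
    qed
    then have "C (?h i \<triangleleft>\<^bsub>M\<^esub> a)" if "i \<in> ?I" for i
      using C_hom_prod[OF M.hcomp_in[OF gM fx(1)] _ a] that by blast
    then have "C (finsum M ?h ?I \<triangleleft>\<^bsub>M\<^esub> a)"
      by (intro M.finsum_induct[where P = "\<lambda>z. C (z \<triangleleft>\<^bsub>M\<^esub> a)"])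
        (use M.finite_hsupp[OF gM fx(1)] hc zero_ract a C_zero C_add
          in \<open>auto simp: ract_l_distr ract_closed\<close>)
    then show ?thesis using M.finsum_hcomp[OF gM fx(1)] by simp
  qed
  have N_comps: "hcomp M (mod_part M) z i \<in> N" if "z \<in> N" for z i
  proof -
    have "C z"
      using that by (rule N_ind) (use C_zero C_add C_prod fc N_c ract_closed in auto)
    then show ?thesis by (simp add: C_def)
  qed
  interpret transport_setup A M N "inv_into L ev"
    by unfold_locales (use gA M N_sub N_comps in \<open>auto simp: N_def inj_on_inv_into\<close>)
  have "f ` carrier X \<subseteq> N"
    using N_prod[of _ "\<one>\<^bsub>A\<^esub>"] fc by (auto simp: ract_one)
  then have "inv_into L ev \<circ> f \<in> graded_isos (alg_trunc A U) X (mod_trunc A T S)"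
    using trunc_T_iso[OF f] Xp by blast
  then show ?thesis unfolding liftable_def using graded_right_module_T by blast
qed

end

theory Submission
  imports Defs
begin

text \<open>Since \<open>X\<close> is generated in degrees \<open>m \<in> (S : U)\<close>, one has
  \<open>X\<^sub>s = \<Sum>\<^sub>m X\<^sub>m A\<^sub>s\<^sub>-\<^sub>m\<close>, and a lift forces \<open>(\<Sum> x\<^sub>k a\<^sub>k) b = \<Sum> x\<^sub>k (a\<^sub>k b)\<close>
  whenever \<open>s\<close> and \<open>s + deg b\<close> lie in \<open>S\<close>. If this partial action of all of \<open>A\<close> on \<open>X\<close> is
  well defined, then \<open>X\<close> is a functor on the full subcategory \<open>S\<close> of the category with objects
  the integers and \<open>Hom(i, j) = A\<^sub>j\<^sub>-\<^sub>i\<close>, and its right Kan extension is a lift: in degree \<open>t\<close> it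
  consists of the additive maps \<open>\<phi> : A \<rightarrow> X\<close> of degree \<open>t\<close> with \<open>\<phi>(a b) = \<phi>(a) b\<close>, with the
  action \<open>(\<phi> c)(a) = \<phi>(c a)\<close>, and \<open>\<phi> \<mapsto> \<phi>(1)\<close> identifies its truncation with \<open>X\<close>.

  For well-definedness, \<open>A\<^sub>i\<^sub>+\<^sub>j = A\<^sub>i A\<^sub>j\<close> allows one to replace all \<open>m\<close> by the largest
  \<open>p \<le> s\<close> in \<open>(S : U)\<close>, and then to factor \<open>b\<close> so that only products with degrees in \<open>U\<close>,
  where associativity in \<open>X\<close> applies, and the kernel conditions of the theorem are needed.\<close>

section \<open>Generation of graded groups and algebras\<close>

text \<open>The bound \<open>2 * r < n\<close> enters as the equality of U \<inter> -U with the
  multiples of n: a non-multiple and its negative have residues adding up to n, which cannot both be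
  at most r. Hence (S : U), unless empty, is one residue class modulo n. This gives the largest p
  \<le> s a meaning and puts p - m into U, so that moving from m to p uses products that X already
  has. What remains is a relation in a single X_p \<otimes> A_j with 0 \<le> j < n and j \<in> U, to
  be multiplied by b of degree i with j + i \<in> U. The obstacle is that i itself may lie outside
  U, so that b does not act on X. In case (1) with j + i \<ge> n, j is raised to r inside the block
  [0, r], the gap from r to n is crossed by the kernel condition, and the remaining degree j + i - n
  lies in U by periodicity. In case (2) a positive j lies in [n - r, n], and steps inside this block
  have degrees from 1 to r, none of which is in U; this is why there is a condition for each pair u
  < v. From degree n onwards periodicity helps again.\<close>

inductive_set add_span :: "('g, 'c) ring_scheme \<Rightarrow> 'g set \<Rightarrow> 'g set" for G E where
  zero: "\<zero>\<^bsub>G\<^esub> \<in> add_span G E"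
| step: "\<lbrakk>e \<in> E; z \<in> add_span G E\<rbrakk> \<Longrightarrow> e \<oplus>\<^bsub>G\<^esub> z \<in> add_span G E"

context abelian_group
begin

lemma add_span_carrier: "E \<subseteq> carrier G \<Longrightarrow> add_span G E \<subseteq> carrier G"
proof
  fix z assume "E \<subseteq> carrier G" "z \<in> add_span G E"
  from this(2,1) show "z \<in> carrier G" by induction auto
qed

lemma add_span_incl: "e \<in> E \<Longrightarrow> e \<in> carrier G \<Longrightarrow> e \<in> add_span G E"
  using add_span.step[OF _ add_span.zero, of e E G] by simp

lemma add_span_add:
  assumes E: "E \<subseteq> carrier G" and "x \<in> add_span G E" "y \<in> add_span G E"
  shows "x \<oplus> y \<in> add_span G E"
  using assms(2)
proof induction
  case zero
  then show ?case using assms(3) add_span_carrier[OF E] by auto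
next
  case (step e z)
  then have "e \<oplus> z \<oplus> y = e \<oplus> (z \<oplus> y)"
    using assms add_span_carrier[OF E] by (intro a_assoc) auto
  then show ?case using step add_span.step by metis
qed

lemma add_span_neg:
  assumes E: "E \<subseteq> carrier G" and neg: "\<And>e. e \<in> E \<Longrightarrow> \<ominus> e \<in> E" and "x \<in> add_span G E"
  shows "\<ominus> x \<in> add_span G E"
  using assms(3)
proof induction
  case zero
  have "\<ominus> \<zero> = \<zero>" by (rule minus_equality) auto
  then show ?case using add_span.zero by metis
next
  case (step e z)
  then have "\<ominus> (e \<oplus> z) = \<ominus> e \<oplus> \<ominus> z"
    using add_span_carrier[OF E] E by (intro minus_add) auto
  then show ?case using step neg add_span.step by metis
qed

text \<open>The inductive span contains sums only, so inverses have to come from closure of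
  \<open>E\<close> under negation; all spans below are taken of sets with this property.\<close>

lemma add_span_subgroup:
  assumes "E \<subseteq> carrier G" and "\<And>e. e \<in> E \<Longrightarrow> \<ominus> e \<in> E"
  shows "additive_subgroup (add_span G E) G"
proof (intro additive_subgroup.intro add.subgroupI)
  show "add_span G E \<noteq> {}" using add_span.zero by blast
qed (use assms add_span_carrier add_span_add add_span_neg in auto)

lemma eq_if_add_minus:
  assumes "x \<in> carrier G" "y \<in> carrier G" "x \<oplus> \<ominus> y = \<zero>"
  shows "x = y"
  using minus_equality[of x "\<ominus> y"] assms by simp

text \<open>Existence follows by induction on the span, each new homogeneous summand changing one
  component; uniqueness follows by applying independence to the difference of two
  decompositions.\<close>

lemma graded_byI:
  assumes sub: "\<And>i. additive_subgroup (D i) G"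
    and span: "carrier G \<subseteq> add_span G (\<Union>i. D i)"
    and indep: "\<And>f I i. \<lbrakk>finite I; \<And>i. f i \<in> D i; finsum G f I = \<zero>; i \<in> I\<rbrakk> \<Longrightarrow> f i = \<zero>"
  shows "graded_by G D"
  unfolding graded_by_def
proof (intro conjI allI ballI sub)
  fix x assume x: "x \<in> carrier G"
  have Dc: "y \<in> carrier G" if "y \<in> D i" for y i
    using additive_subgroup.a_Hcarr[OF sub that] .
  have sup: "finsum G f I = z" if "is_decomp G D z f" "finite I" "{i. f i \<noteq> \<zero>} \<subseteq> I" for f I z
  proof -
    have "finsum G f I = finsum G f {i. f i \<noteq> \<zero>}"
      by (rule add.finprod_mono_neutral_cong_right) (use that Dc in \<open>auto simp: is_decomp_def\<close>)
    then show ?thesis using that by (simp add: is_decomp_def)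
  qed
  have "x \<in> add_span G (\<Union>i. D i)" using x span by blast
  then have ex: "\<exists>f. is_decomp G D x f"
  proof induction
    case zero
    have "is_decomp G D \<zero> (\<lambda>_. \<zero>)"
      using additive_subgroup.zero_closed[OF sub] by (simp add: is_decomp_def)
    then show ?case by blast
  next
    case (step e z)
    then obtain f i where f: "is_decomp G D z f" and e: "e \<in> D i" by blast
    have fD: "f j \<in> D j" for j using f by (simp add: is_decomp_def)
    let ?I = "{j. f j \<noteq> \<zero>}" and ?f = "f(i := e \<oplus> f i)"
    have fin: "finite ?I" using f by (simp add: is_decomp_def)
    have c: "e \<in> carrier G" "f j \<in> carrier G" for j using e fD Dc by auto
    have f'D: "?f j \<in> D j" for j
      using fD e additive_subgroup.a_closed[OF sub] by simp
    \<comment> \<open>Isolating the index \<open>i\<close> treats uniformly the cases where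
      \<open>i\<close> does or does not already belong to the support of \<open>f\<close>.\<close>
    have s: "insert i ?I = insert i (?I - {i})" by blast
    have "finsum G ?f (insert i ?I) = (e \<oplus> f i) \<oplus> finsum G ?f (?I - {i})"
      unfolding s by (subst finsum_insert) (use fin c in auto)
    also have "finsum G ?f (?I - {i}) = finsum G f (?I - {i})"
      by (rule finsum_cong') (use c in auto)
    also have "(e \<oplus> f i) \<oplus> \<dots> = e \<oplus> (f i \<oplus> finsum G f (?I - {i}))"
      by (rule a_assoc) (use c in auto)
    also have "f i \<oplus> finsum G f (?I - {i}) = finsum G f (insert i ?I)"
      unfolding s by (subst finsum_insert) (use fin c in auto)
    also have "\<dots> = z" by (rule sup[OF f]) (use fin in auto)
    finally have eq: "finsum G ?f (insert i ?I) = e \<oplus> z" .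
    have "finsum G ?f (insert i ?I) = finsum G ?f {j. ?f j \<noteq> \<zero>}"
      by (rule add.finprod_mono_neutral_cong_right) (use fin c in auto)
    moreover have "finite {j. ?f j \<noteq> \<zero>}"
      by (rule finite_subset[of _ "insert i ?I"]) (use fin in auto)
    ultimately have "is_decomp G D (e \<oplus> z) ?f" using f'D eq by (simp add: is_decomp_def)
    then show ?case by blast
  qed
  have "f = g" if f: "is_decomp G D x f" and g: "is_decomp G D x g" for f g
  proof
    fix i
    \<comment> \<open>Adding \<open>i\<close> itself lets independence conclude at an arbitrary
      index, including one outside both supports.\<close>
    let ?I = "insert i ({i. f i \<noteq> \<zero>} \<union> {i. g i \<noteq> \<zero>})"
    have fin: "finite ?I" using f g by (simp add: is_decomp_def)
    have D: "f j \<in> D j" "g j \<in> D j" for j using f g by (simp_all add: is_decomp_def)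
    then have c: "f j \<in> carrier G" "g j \<in> carrier G" for j using Dc by auto
    have sf: "finsum G f ?I = x" and sg: "finsum G g ?I = x"
      by (rule sup, rule f g, use fin in auto)+
    have d: "\<ominus> g j \<in> D j" for j
      using additive_subgroup.a_inv_closed[OF sub D(2)] abelian_group_axioms by blast
    have "finsum G (\<lambda>j. f j \<oplus> \<ominus> g j) ?I = finsum G f ?I \<oplus> finsum G (\<lambda>j. \<ominus> g j) ?I"
      by (rule finsum_addf) (use c in auto)
    also have "finsum G (\<lambda>j. \<ominus> g j) ?I = \<ominus> finsum G g ?I"
    proof -
      have "finsum G g ?I \<oplus> finsum G (\<lambda>j. \<ominus> g j) ?I = finsum G (\<lambda>j. g j \<oplus> \<ominus> g j) ?I"
        by (rule finsum_addf[symmetric]) (use c in auto)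
      also have "\<dots> = \<zero>" using c by (simp add: r_neg)
      finally show ?thesis
        using c by (metis (no_types, lifting) finsum_closed Pi_I add.inv_closed minus_equality a_comm)
    qed
    finally have "finsum G (\<lambda>j. f j \<oplus> \<ominus> g j) ?I = \<zero>" using sf sg x by (simp add: r_neg)
    then have "f i \<oplus> \<ominus> g i = \<zero>"
      by (intro indep[OF fin, of "\<lambda>j. f j \<oplus> \<ominus> g j"])
        (use D d additive_subgroup.a_closed[OF sub] in auto)
    then show "f i = g i" using c by (metis minus_equality minus_minus a_inv_closed a_comm)
  qed
  then show "\<exists>!f. is_decomp G D x f" using ex by blast
qed

lemma graded_part_neg: "graded_by G D \<Longrightarrow> x \<in> D i \<Longrightarrow> \<ominus> x \<in> D i"
  using additive_subgroup.a_inv_closed[of "D i" G x] abelian_group_axioms by (simp add: graded_by_def)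

lemma hsupp_homogeneous: "graded_by G D \<Longrightarrow> x \<in> D i \<Longrightarrow> hsupp G D x \<subseteq> {i}"
  by (auto simp: hsupp_def hcomp_homogeneous)

lemma hcomp_zero: "graded_by G D \<Longrightarrow> hcomp G D \<zero> i = \<zero>"
  using hcomp_homogeneous[of D \<zero> 0] graded_part_zero[of D 0] by auto

lemma hcomp_finsum:
  assumes g: "graded_by G D" and "finite I" "\<And>i. i \<in> I \<Longrightarrow> h i \<in> carrier G"
  shows "hcomp G D (finsum G h I) k = finsum G (\<lambda>i. hcomp G D (h i) k) I"
  using assms(2,3)
proof (induction I)
  case empty
  then show ?case using hcomp_zero[OF g] by simp
next
  case (insert i I)
  have c: "hcomp G D (h j) k \<in> carrier G" if "j \<in> insert i I" for j
    using insert that graded_part_carrier[OF g hcomp_in[OF g]] by blast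
  have "finsum G h (insert i I) = h i \<oplus> finsum G h I"
    by (rule finsum_insert) (use insert in auto)
  moreover have "finsum G (\<lambda>i. hcomp G D (h i) k) (insert i I)
      = hcomp G D (h i) k \<oplus> finsum G (\<lambda>i. hcomp G D (h i) k) I"
    by (rule finsum_insert) (use insert c in auto)
  moreover have "finsum G h I \<in> carrier G" using insert by (intro finsum_closed) auto
  ultimately show ?case using insert by (simp add: hcomp_add[OF g])
qed

end

text \<open>The span of A_0 and all products A_k A_1 with k \<ge> 0 is a subalgebra containing A_0
  and A_1, hence all of A. Its component in degree k + 1 comes from A_k A_1 alone.\<close>

lemma generated_degree_one:
  assumes A: "positively_graded_K_algebra K A" and gen: "alg_generated_in_degrees K A {0, 1}"
    and a: "a \<in> alg_part A (k + 1)" and k: "0 \<le> k"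
  shows "a \<in> add_span A {b \<otimes>\<^bsub>A\<^esub> c | b c. b \<in> alg_part A k \<and> c \<in> alg_part A 1}"
proof -
  have gK: "graded_K_algebra K A" and neg: "\<And>i. i < 0 \<Longrightarrow> alg_part A i = {\<zero>\<^bsub>A\<^esub>}"
    using A by (auto simp: positively_graded_K_algebra_def)
  have KA: "K_algebra K A" and g: "graded_by A (alg_part A)" and one0: "\<one>\<^bsub>A\<^esub> \<in> alg_part A 0"
    and Ksm: "\<And>i k a. k \<in> carrier K \<Longrightarrow> a \<in> alg_part A i \<Longrightarrow> k \<odot>\<^bsub>A\<^esub> a \<in> alg_part A i"
    and mult: "\<And>i j a b. a \<in> alg_part A i \<Longrightarrow> b \<in> alg_part A j \<Longrightarrow> a \<otimes>\<^bsub>A\<^esub> b \<in> alg_part A (i + j)"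
    using gK by (auto simp: graded_K_algebra_def)
  interpret A: ring A using KA by (simp add: K_algebra_def)
  interpret KA: module K A using KA by (simp add: K_algebra_def)
  have Dc: "x \<in> carrier A" if "x \<in> alg_part A i" for x i
    using A.graded_part_carrier[OF g that] .
  define P where "P k = {b \<otimes>\<^bsub>A\<^esub> c | b c. b \<in> alg_part A k \<and> c \<in> alg_part A 1}" for k
  define E where "E = alg_part A 0 \<union> (\<Union>k\<in>{0..}. P k)"
  have EI: "x \<in> alg_part A 0 \<Longrightarrow> x \<in> E"
    "b \<in> alg_part A k \<Longrightarrow> c \<in> alg_part A 1 \<Longrightarrow> 0 \<le> k \<Longrightarrow> b \<otimes>\<^bsub>A\<^esub> c \<in> E" for x b c k
    by (auto simp: E_def P_def)
  have EE: "(x \<in> alg_part A 0 \<Longrightarrow> thesis) \<Longrightarrow>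
      (\<And>k b c. 0 \<le> k \<Longrightarrow> b \<in> alg_part A k \<Longrightarrow> c \<in> alg_part A 1 \<Longrightarrow> x = b \<otimes>\<^bsub>A\<^esub> c \<Longrightarrow> thesis)
      \<Longrightarrow> thesis" if "x \<in> E" for x thesis
    using that unfolding E_def P_def by auto
  have Ec: "E \<subseteq> carrier A" using Dc by (auto simp: E_def P_def)
  have Eneg: "\<ominus>\<^bsub>A\<^esub> e \<in> E" if "e \<in> E" for e
    using that
  proof (rule EE)
    show "\<ominus>\<^bsub>A\<^esub> e \<in> E" if "e \<in> alg_part A 0" using A.graded_part_neg[OF g that] EI by blast
    fix k b c assume h: "0 \<le> k" "b \<in> alg_part A k" "c \<in> alg_part A 1" "e = b \<otimes>\<^bsub>A\<^esub> c"
    then have "\<ominus>\<^bsub>A\<^esub> e = (\<ominus>\<^bsub>A\<^esub> b) \<otimes>\<^bsub>A\<^esub> c" using Dc by (simp add: A.l_minus)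
    then show "\<ominus>\<^bsub>A\<^esub> e \<in> E" using EI(2) A.graded_part_neg[OF g h(2)] h by simp
  qed
  \<comment> \<open>A right factor from A_0 is absorbed into A_1, and for a right factor b c with c
    in A_1 the left factor is absorbed into b; in both cases a last factor from A_1
    survives.\<close>
  have Emult: "e \<otimes>\<^bsub>A\<^esub> e' \<in> E" if e: "e \<in> E" and e': "e' \<in> E" for e e'
    using e'
  proof (rule EE)
    assume 0: "e' \<in> alg_part A 0"
    show ?thesis using e
    proof (rule EE)
      show ?thesis if "e \<in> alg_part A 0" using mult[OF that 0] EI by simp
      fix k b c assume h: "0 \<le> k" "b \<in> alg_part A k" "c \<in> alg_part A 1" "e = b \<otimes>\<^bsub>A\<^esub> c"
      then have "e \<otimes>\<^bsub>A\<^esub> e' = b \<otimes>\<^bsub>A\<^esub> (c \<otimes>\<^bsub>A\<^esub> e')" using 0 Dc by (simp add: A.m_assoc)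
      then show ?thesis using EI(2)[OF h(2) _ h(1)] mult[OF h(3) 0] by simp
    qed
  next
    fix k b c assume h: "0 \<le> k" "b \<in> alg_part A k" "c \<in> alg_part A 1" "e' = b \<otimes>\<^bsub>A\<^esub> c"
    have "\<exists>j\<ge>0. e \<in> alg_part A j" using e
    proof (rule EE)
      show "\<exists>j\<ge>0. e \<in> alg_part A j" if "e \<in> alg_part A 0" using that by blast
      fix k b c assume "0 \<le> k" "b \<in> alg_part A k" "c \<in> alg_part A 1" "e = b \<otimes>\<^bsub>A\<^esub> c"
      then show "\<exists>j\<ge>0. e \<in> alg_part A j" using mult[of b k c 1] by (intro exI[of _ "k + 1"]) simp
    qed
    then obtain j where j: "0 \<le> j" "e \<in> alg_part A j" by blast
    then have "e \<otimes>\<^bsub>A\<^esub> e' = (e \<otimes>\<^bsub>A\<^esub> b) \<otimes>\<^bsub>A\<^esub> c" using h Dc by (simp add: A.m_assoc)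
    then show ?thesis using EI(2)[OF mult[OF j(2) h(2)] h(3)] h(1) j(1) by simp
  qed
  let ?B = "add_span A E"
  have Bc: "?B \<subseteq> carrier A" by (rule A.add_span_carrier[OF Ec])
  have E_B: "e \<otimes>\<^bsub>A\<^esub> z \<in> ?B" if e: "e \<in> E" and z: "z \<in> ?B" for e z
    using z
  proof induction
    case zero
    then show ?case using subsetD[OF Ec e] by (simp add: add_span.zero)
  next
    case (step e' z)
    then have "e \<otimes>\<^bsub>A\<^esub> (e' \<oplus>\<^bsub>A\<^esub> z) = e \<otimes>\<^bsub>A\<^esub> e' \<oplus>\<^bsub>A\<^esub> e \<otimes>\<^bsub>A\<^esub> z"
      using e Ec Bc by (intro A.r_distr) auto
    then show ?case using step Emult[OF e] add_span.step by metis
  qed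
  have B_B: "y \<otimes>\<^bsub>A\<^esub> z \<in> ?B" if y: "y \<in> ?B" and z: "z \<in> ?B" for y z
    using y
  proof induction
    case zero
    then show ?case using subsetD[OF Bc z] by (simp add: add_span.zero)
  next
    case (step e y)
    then have "(e \<oplus>\<^bsub>A\<^esub> y) \<otimes>\<^bsub>A\<^esub> z = e \<otimes>\<^bsub>A\<^esub> z \<oplus>\<^bsub>A\<^esub> y \<otimes>\<^bsub>A\<^esub> z"
      using z Ec Bc by (intro A.l_distr) auto
    then show ?case using step E_B[OF _ z] A.add_span_add[OF Ec] by metis
  qed
  have B_K: "\<kappa> \<odot>\<^bsub>A\<^esub> z \<in> ?B" if k: "\<kappa> \<in> carrier K" and z: "z \<in> ?B" for \<kappa> z
    using z
  proof induction
    case zero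
    then show ?case using k by (auto intro: add_span.zero)
  next
    case (step e z)
    have "\<kappa> \<odot>\<^bsub>A\<^esub> e \<in> E" using step(1)
    proof (rule EE)
      show "\<kappa> \<odot>\<^bsub>A\<^esub> e \<in> E" if "e \<in> alg_part A 0" using Ksm[OF k that] EI by blast
      fix i b c assume h: "0 \<le> i" "b \<in> alg_part A i" "c \<in> alg_part A 1" "e = b \<otimes>\<^bsub>A\<^esub> c"
      then have "\<kappa> \<odot>\<^bsub>A\<^esub> e = (\<kappa> \<odot>\<^bsub>A\<^esub> b) \<otimes>\<^bsub>A\<^esub> c" using KA Dc k by (simp add: K_algebra_def)
      then show "\<kappa> \<odot>\<^bsub>A\<^esub> e \<in> E" using EI(2) Ksm[OF k h(2)] h by simp
    qed
    moreover have "\<kappa> \<odot>\<^bsub>A\<^esub> (e \<oplus>\<^bsub>A\<^esub> z) = \<kappa> \<odot>\<^bsub>A\<^esub> e \<oplus>\<^bsub>A\<^esub> \<kappa> \<odot>\<^bsub>A\<^esub> z"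
      using k step Ec Bc by (intro KA.smult_r_distr) auto
    ultimately show ?case using step add_span.step by metis
  qed
  \<comment> \<open>A_1 is covered by the products with k = 0, written as 1 x.\<close>
  have D1: "x \<in> ?B" if "x \<in> alg_part A 1" for x
    using A.add_span_incl[OF EI(2)[OF one0 that]] that Dc by simp
  have "subring ?B A"
    by (rule A.subringI)
      (use Bc B_B A.add_span_add[OF Ec] A.add_span_neg[OF Ec Eneg] EI(1)[OF one0]
        A.add_span_incl in auto)
  then have "?B = carrier A"
    using gen B_K D1 EI(1) Dc A.add_span_incl
    unfolding alg_generated_in_degrees_def subalgebra_of_def by auto
  then have aB: "a \<in> ?B" using Dc[OF a] by simp
  have Pc: "P i \<subseteq> carrier A" for i using Dc by (auto simp: P_def)
  \<comment> \<open>Taking components discards the generators of other degrees; since k \<ge> 0,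
    elements of A_0 never contribute to degree k + 1.\<close>
  have "hcomp A (alg_part A) z (k + 1) \<in> add_span A (P k)" if "z \<in> ?B" for z
    using that
  proof induction
    case zero
    then show ?case by (simp add: A.hcomp_zero[OF g] add_span.zero)
  next
    case (step e z)
    have ec: "e \<in> carrier A" "z \<in> carrier A" using step Ec Bc by auto
    have "hcomp A (alg_part A) e (k + 1) \<in> add_span A (P k)" using step(1)
    proof (rule EE)
      assume "e \<in> alg_part A 0"
      then show ?thesis using k by (simp add: A.hcomp_homogeneous[OF g] add_span.zero)
    next
      fix i b c assume h: "0 \<le> i" "b \<in> alg_part A i" "c \<in> alg_part A 1" "e = b \<otimes>\<^bsub>A\<^esub> c"
      then have "e \<in> alg_part A (i + 1)" using mult by simp
      moreover have "e \<in> add_span A (P i)"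
        using A.add_span_incl[of e "P i"] h ec by (auto simp: P_def)
      ultimately show ?thesis by (simp add: A.hcomp_homogeneous[OF g] add_span.zero)
    qed
    then show ?case
      using step ec A.add_span_add[OF Pc] by (simp add: A.hcomp_add[OF g])
  qed
  then have "hcomp A (alg_part A) a (k + 1) \<in> add_span A (P k)" using aB .
  then show ?thesis using a by (simp add: A.hcomp_homogeneous[OF g] P_def)
qed

text \<open>Induction on j: a last factor of degree 1 is split off from A_(i+j+1) and, by
  associativity, joined to the right factor of the decomposition of A_(i+j).\<close>

lemma generated_degree_add:
  assumes A: "positively_graded_K_algebra K A" and gen: "alg_generated_in_degrees K A {0, 1}"
    and a: "a \<in> alg_part A (i + j)" and i: "0 \<le> i" and j: "0 \<le> j"
  shows "a \<in> add_span A {b \<otimes>\<^bsub>A\<^esub> c | b c. b \<in> alg_part A i \<and> c \<in> alg_part A j}"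
proof -
  have KA: "K_algebra K A" and g: "graded_by A (alg_part A)" and one0: "\<one>\<^bsub>A\<^esub> \<in> alg_part A 0"
    and mult: "\<And>i j a b. a \<in> alg_part A i \<Longrightarrow> b \<in> alg_part A j \<Longrightarrow> a \<otimes>\<^bsub>A\<^esub> b \<in> alg_part A (i + j)"
    using A by (auto simp: graded_K_algebra_def positively_graded_K_algebra_def)
  interpret A: ring A using KA by (simp add: K_algebra_def)
  have Dc: "x \<in> carrier A" if "x \<in> alg_part A i" for x i
    using A.graded_part_carrier[OF g that] .
  define P where "P j = {b \<otimes>\<^bsub>A\<^esub> c | b c. b \<in> alg_part A i \<and> c \<in> alg_part A j}" for j
  have Pc: "P j \<subseteq> carrier A" for j using Dc by (auto simp: P_def)
  have "\<forall>a\<in>alg_part A (i + j). a \<in> add_span A (P j)"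
    using j
  proof (induction j rule: int_ge_induct)
    case base
    show ?case
    proof
      fix a assume a: "a \<in> alg_part A (i + 0)"
      then have "a = a \<otimes>\<^bsub>A\<^esub> \<one>\<^bsub>A\<^esub>" "a \<in> alg_part A i" using Dc by auto
      then have "a \<in> P 0" using one0 unfolding P_def by blast
      then show "a \<in> add_span A (P 0)" using A.add_span_incl Pc by blast
    qed
  next
    case (step j)
    note IH = step.IH
    have mul: "z \<otimes>\<^bsub>A\<^esub> c \<in> add_span A (P (j + 1))"
      if "z \<in> add_span A (P j)" and c: "c \<in> alg_part A 1" for z c
      using that(1)
    proof induction
      case zero
      then show ?case using Dc[OF c] by (simp add: add_span.zero)
    next
      case (step e z)
      then obtain b d where e: "b \<in> alg_part A i" "d \<in> alg_part A j" "e = b \<otimes>\<^bsub>A\<^esub> d"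
        by (auto simp: P_def)
      have "e \<otimes>\<^bsub>A\<^esub> c = b \<otimes>\<^bsub>A\<^esub> (d \<otimes>\<^bsub>A\<^esub> c)" using e c Dc by (simp add: A.m_assoc)
      then have "e \<otimes>\<^bsub>A\<^esub> c \<in> P (j + 1)" using e c mult unfolding P_def by blast
      moreover have "(e \<oplus>\<^bsub>A\<^esub> z) \<otimes>\<^bsub>A\<^esub> c = e \<otimes>\<^bsub>A\<^esub> c \<oplus>\<^bsub>A\<^esub> z \<otimes>\<^bsub>A\<^esub> c"
        using step Pc A.add_span_carrier[OF Pc] c Dc by (intro A.l_distr) auto
      ultimately show ?case using step add_span.step by metis
    qed
    show ?case
    proof
      fix a assume "a \<in> alg_part A (i + (j + 1))"
      then have "a \<in> alg_part A (i + j + 1)" by (simp add: add.assoc)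
      from generated_degree_one[OF A gen this]
      have "a \<in> add_span A {b \<otimes>\<^bsub>A\<^esub> c | b c. b \<in> alg_part A (i + j) \<and> c \<in> alg_part A 1}"
        using i step by simp
      then show "a \<in> add_span A (P (j + 1))"
      proof induction
        case zero
        then show ?case by (simp add: add_span.zero)
      next
        case (step e z)
        then show ?case using A.add_span_add[OF Pc] mul IH by blast
      qed
    qed
  qed
  then show ?thesis using a by (simp add: P_def)
qed


section \<open>Elements of tensor products\<close>

text \<open>The formula is the one that \<open>tensor_lift\<close> applies to representatives. The
  supports of \<open>c\<close>, \<open>d\<close> and \<open>c + d\<close> differ, so all three
  products are extended to the union of the first two supports, where coefficients add
  pointwise.\<close>

lemma (in comm_group) free_Abelian_group_hom:
  assumes g: "\<And>p. p \<in> B \<Longrightarrow> g p \<in> carrier G"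
  shows "(\<lambda>c. finprod G (\<lambda>p. g p [^] Poly_Mapping.lookup c p) (Poly_Mapping.keys c))
    \<in> hom (free_Abelian_group B) G" (is "?h \<in> _")
proof (rule homI)
  fix c assume "c \<in> carrier (free_Abelian_group B)"
  then show "?h c \<in> carrier G" using g by (auto intro!: finprod_closed)
next
  fix c d assume cd: "c \<in> carrier (free_Abelian_group B)" "d \<in> carrier (free_Abelian_group B)"
  let ?K = "Poly_Mapping.keys c \<union> Poly_Mapping.keys d"
  have ext: "?h e = finprod G (\<lambda>p. g p [^] Poly_Mapping.lookup e p) ?K"
    if "Poly_Mapping.keys e \<subseteq> ?K" for e
    by (rule finprod_mono_neutral_cong_left)
      (use that cd g in \<open>auto simp: in_keys_iff\<close>)
  have "?h (c + d) = finprod G (\<lambda>p. g p [^] Poly_Mapping.lookup (c + d) p) ?K"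
    by (rule ext[OF keys_add])
  also have "\<dots> = finprod G (\<lambda>p. g p [^] Poly_Mapping.lookup c p \<otimes> g p [^] Poly_Mapping.lookup d p) ?K"
    by (rule finprod_cong') (use cd g in \<open>auto simp: lookup_add int_pow_mult\<close>)
  also have "\<dots> = ?h c \<otimes> ?h d"
    unfolding ext[OF Un_upper1] ext[OF Un_upper2]
    by (rule finprod_multf) (use cd g in auto)
  finally show "?h (c \<otimes>\<^bsub>free_Abelian_group B\<^esub> d) = ?h c \<otimes> ?h d" by simp
qed

text \<open>Lists carry no integer coefficients: multiplicities become repetitions and signs are
  absorbed into the first factor.\<close>

definition tensor_sum ::
  "('r, 'c) ring_scheme \<Rightarrow> ('r, 'm, 'd) right_module_scheme \<Rightarrow> ('r, 'q, 'e) module_scheme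
    \<Rightarrow> ('m \<times> 'q) list \<Rightarrow> ('m \<times> 'q \<Rightarrow>\<^sub>0 int) set" where
  "tensor_sum R P Q L = foldr (\<lambda>p t. tensor_elem R P Q (fst p) (snd p) \<otimes>\<^bsub>tensor_prod R P Q\<^esub> t) L
     \<one>\<^bsub>tensor_prod R P Q\<^esub>"

text \<open>Besides the group \<open>P\<close>, these are the closure properties that place the
  relators inside the free group on \<open>carrier P \<times> carrier Q\<close>. Bilinearity is a
  matter of the maps that are lifted.\<close>

locale tensor_pair = P: abelian_group P
  for R :: "('r, 'c) ring_scheme" and P :: "('r, 'm, 'd) right_module_scheme"
    and Q :: "('r, 'q, 'e) module_scheme" +
  assumes Q_add: "\<lbrakk>p \<in> carrier Q; q \<in> carrier Q\<rbrakk> \<Longrightarrow> p \<oplus>\<^bsub>Q\<^esub> q \<in> carrier Q"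
    and P_act: "\<lbrakk>x \<in> carrier P; c \<in> carrier R\<rbrakk> \<Longrightarrow> x \<triangleleft>\<^bsub>P\<^esub> c \<in> carrier P"
    and Q_act: "\<lbrakk>q \<in> carrier Q; c \<in> carrier R\<rbrakk> \<Longrightarrow> c \<odot>\<^bsub>Q\<^esub> q \<in> carrier Q"
begin

abbreviation "F \<equiv> tensor_gens P Q"
abbreviation "N \<equiv> tensor_rels R P Q"
abbreviation "T \<equiv> tensor_prod R P Q"

abbreviation relators where "relators \<equiv>
     {frag_of (x \<oplus>\<^bsub>P\<^esub> y, q) - frag_of (x, q) - frag_of (y, q) | x y q.
         x \<in> carrier P \<and> y \<in> carrier P \<and> q \<in> carrier Q} \<union>
      {frag_of (x, p \<oplus>\<^bsub>Q\<^esub> q) - frag_of (x, p) - frag_of (x, q) | x p q.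
         x \<in> carrier P \<and> p \<in> carrier Q \<and> q \<in> carrier Q} \<union>
      {frag_of (x \<triangleleft>\<^bsub>P\<^esub> c, q) - frag_of (x, c \<odot>\<^bsub>Q\<^esub> q) | x c q.
         x \<in> carrier P \<and> c \<in> carrier R \<and> q \<in> carrier Q}"

sublocale F: comm_group F
  unfolding tensor_gens_def by (rule abelian_free_Abelian_group)

lemma F_sel [simp]:
  "c \<in> carrier F \<longleftrightarrow> Poly_Mapping.keys c \<subseteq> carrier P \<times> carrier Q"
  "c \<otimes>\<^bsub>F\<^esub> d = c + d" "\<one>\<^bsub>F\<^esub> = 0"
  by (simp_all add: tensor_gens_def)

lemma F_diff: "c \<in> carrier F \<Longrightarrow> d \<in> carrier F \<Longrightarrow> c - d \<in> carrier F"
  using keys_diff[of c d] by auto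

lemma F_inv: "c \<in> carrier F \<Longrightarrow> inv\<^bsub>F\<^esub> c = - c"
  by (simp add: tensor_gens_def)

lemma relators_F: "relators \<subseteq> carrier F"
proof -
  have 1: "frag_of a - frag_of b \<in> carrier F" "frag_of a - frag_of b - frag_of d \<in> carrier F"
    if "a \<in> carrier P \<times> carrier Q" "b \<in> carrier P \<times> carrier Q" "d \<in> carrier P \<times> carrier Q"
    for a b d
    using that by (auto intro!: F_diff simp del: F_sel(1)) (auto simp: F_sel(1))
  show ?thesis
    by (intro Un_least subsetI; clarify; intro 1) (use Q_add P_act Q_act in auto)
qed

lemma N_subgroup: "subgroup N F"
  unfolding tensor_rels_def by (rule F.generate_is_subgroup[OF relators_F])

lemma relators_N: "c \<in> relators \<Longrightarrow> c \<in> N"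
  unfolding tensor_rels_def by (rule generate.incl)

sublocale N: normal N F
  using F.subgroup_imp_normal[OF N_subgroup] .

lemma N_diff: "c \<in> N \<Longrightarrow> d \<in> N \<Longrightarrow> c - d \<in> N"
proof -
  assume cd: "c \<in> N" "d \<in> N"
  have "inv\<^bsub>F\<^esub> d = - d" by (rule F_inv[OF N.mem_carrier[OF cd(2)]])
  then show ?thesis using N.m_closed[OF cd(1) N.m_inv_closed[OF cd(2)]] by simp
qed

lemma N_add: "c \<in> N \<Longrightarrow> d \<in> N \<Longrightarrow> c + d \<in> N"
  using N.m_closed[of c d] by simp

lemma T_comm_group: "comm_group T"
  unfolding tensor_prod_def by (rule F.abelian_FactGroup[OF N_subgroup])

lemma carrier_T: "carrier T = (\<lambda>c. N #>\<^bsub>F\<^esub> c) ` carrier F"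
  by (simp add: tensor_prod_def carrier_FactGroup)

lemma T_mult: "c \<in> carrier F \<Longrightarrow> d \<in> carrier F \<Longrightarrow>
    (N #>\<^bsub>F\<^esub> c) \<otimes>\<^bsub>T\<^esub> (N #>\<^bsub>F\<^esub> d) = N #>\<^bsub>F\<^esub> (c + d)"
  using N.rcos_sum[of c d] by (simp add: tensor_prod_def FactGroup_def)

lemma T_one: "\<one>\<^bsub>T\<^esub> = N #>\<^bsub>F\<^esub> 0"
  using F.coset_join2[OF F.one_closed N_subgroup N.one_closed]
  by (simp add: tensor_prod_def FactGroup_def)

lemma coset_eqI:
  assumes "c \<in> carrier F" "d \<in> carrier F" "c - d \<in> N"
  shows "N #>\<^bsub>F\<^esub> c = N #>\<^bsub>F\<^esub> d"
proof -
  have "c \<in> N #>\<^bsub>F\<^esub> d"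
    unfolding r_coset_def using assms by (auto intro!: bexI[of _ "c - d"])
  then show ?thesis using F.repr_independence[OF _ _ N_subgroup] assms by metis
qed

abbreviation pairs where "pairs \<equiv> carrier P \<times> carrier Q"

definition frag_sum where "frag_sum (L :: ('m \<times> 'q) list) = foldr (\<lambda>p c. frag_of p + c) L 0"

lemma frag_sum_simps [simp]:
  "frag_sum [] = 0" "frag_sum (p # L) = frag_of p + frag_sum L"
  by (simp_all add: frag_sum_def)

lemma frag_sum_append: "frag_sum (L @ L') = frag_sum L + frag_sum L'"
  by (induction L) (auto simp: add.assoc)

lemma frag_sum_F: "set L \<subseteq> pairs \<Longrightarrow> frag_sum L \<in> carrier F"
proof (induction L)
  case (Cons p L)
  then show ?case using F.m_closed[of "frag_of p" "frag_sum L"] by (simp del: F_sel(1)) simp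
qed simp

lemma tensor_sum_coset:
  assumes "set L \<subseteq> pairs"
  shows "tensor_sum R P Q L = N #>\<^bsub>F\<^esub> frag_sum L"
  using assms
proof (induction L)
  case Nil
  then show ?case by (simp add: tensor_sum_def T_one)
next
  case (Cons p L)
  then have "frag_of p \<in> carrier F" "frag_sum L \<in> carrier F" using frag_sum_F by auto
  from T_mult[OF this] show ?case using Cons by (simp add: tensor_sum_def tensor_elem_def)
qed

text \<open>The relator for 0 + 0 puts the generator (0, q) into \<open>N\<close>, and the relator
  for (-x) + x compares it with the given sum.\<close>

lemma frag_of_neg_N:
  assumes x: "x \<in> carrier P" and q: "q \<in> carrier Q"
  shows "frag_of (\<ominus>\<^bsub>P\<^esub> x, q) + frag_of (x, q) \<in> N"
proof -
  have 1: "frag_of (y \<oplus>\<^bsub>P\<^esub> z, q) - frag_of (y, q) - frag_of (z, q) \<in> N"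
    if "y \<in> carrier P" "z \<in> carrier P" for y z
    by (rule relators_N) (use that q in blast)
  have a: "frag_of (\<zero>\<^bsub>P\<^esub>, q) - frag_of (\<zero>\<^bsub>P\<^esub>, q) - frag_of (\<zero>\<^bsub>P\<^esub>, q) \<in> N"
    using 1[of "\<zero>\<^bsub>P\<^esub>" "\<zero>\<^bsub>P\<^esub>"] by simp
  have b: "frag_of (\<zero>\<^bsub>P\<^esub>, q) - frag_of (\<ominus>\<^bsub>P\<^esub> x, q) - frag_of (x, q) \<in> N"
    using 1[of "\<ominus>\<^bsub>P\<^esub> x" x] x by (simp add: P.l_neg)
  have z: "0 \<in> N" using N.one_closed by simp
  show ?thesis using N_diff[OF z N_add[OF a b]] by (simp add: algebra_simps)
qed

text \<open>Induction over the free group works with differences; a subtracted list is replaced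
  modulo \<open>N\<close> by the list with negated first entries.\<close>

lemma ex_frag_sum:
  assumes "c \<in> carrier F"
  shows "\<exists>L. set L \<subseteq> pairs \<and> c - frag_sum L \<in> N"
proof -
  have "Poly_Mapping.keys c \<subseteq> pairs" using assms by simp
  then show ?thesis
  proof (rule free_Abelian_group_induct)
    show "\<exists>L. set L \<subseteq> pairs \<and> 0 - frag_sum L \<in> N"
      using N.one_closed by (intro exI[of _ "[]"]) simp
    show "\<exists>L. set L \<subseteq> pairs \<and> frag_of a - frag_sum L \<in> N" if "a \<in> pairs" for a
      using that N.one_closed by (intro exI[of _ "[a]"]) simp
    fix c d
    assume "\<exists>L. set L \<subseteq> pairs \<and> c - frag_sum L \<in> N" "\<exists>L. set L \<subseteq> pairs \<and> d - frag_sum L \<in> N"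
    then obtain L L' where L: "set L \<subseteq> pairs" "c - frag_sum L \<in> N"
      and L': "set L' \<subseteq> pairs" "d - frag_sum L' \<in> N" by blast
    let ?n = "map (\<lambda>p. (\<ominus>\<^bsub>P\<^esub> fst p, snd p))"
    have n: "frag_sum (?n M) + frag_sum M \<in> N" if "set M \<subseteq> pairs" for M
      using that
    proof (induction M)
      case Nil
      then show ?case using N.one_closed by simp
    next
      case (Cons p M)
      then have "frag_of (\<ominus>\<^bsub>P\<^esub> fst p, snd p) + frag_of p \<in> N"
        using frag_of_neg_N[of "fst p" "snd p"] by auto
      from N_add[OF this Cons.IH] Cons.prems show ?case by (simp add: algebra_simps)
    qed
    have "(c - frag_sum L) - (d - frag_sum L') - (frag_sum (?n L') + frag_sum L') \<in> N"
      by (intro N_diff L L' n)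
    then have "(c - d) - frag_sum (L @ ?n L') \<in> N"
      by (simp add: frag_sum_append algebra_simps)
    moreover have "set (L @ ?n L') \<subseteq> pairs" using L L' by auto
    ultimately show "\<exists>L. set L \<subseteq> pairs \<and> (c - d) - frag_sum L \<in> N" by blast
  qed
qed

lemma ex_tensor_sum:
  assumes "t \<in> carrier T"
  shows "\<exists>L. set L \<subseteq> carrier P \<times> carrier Q \<and> t = tensor_sum R P Q L"
proof -
  obtain c where c: "c \<in> carrier F" "t = N #>\<^bsub>F\<^esub> c" using assms by (auto simp: carrier_T)
  then show ?thesis
    using ex_frag_sum[OF c(1)] coset_eqI[OF c(1) frag_sum_F] tensor_sum_coset by metis
qed

lemma tensor_sum_T: "set L \<subseteq> pairs \<Longrightarrow> tensor_sum R P Q L \<in> carrier T"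
  using frag_sum_F by (simp add: tensor_sum_coset carrier_T del: F_sel(1))

lemma tensor_sum_append:
  "set L \<subseteq> pairs \<Longrightarrow> set L' \<subseteq> pairs \<Longrightarrow>
    tensor_sum R P Q (L @ L') = tensor_sum R P Q L \<otimes>\<^bsub>T\<^esub> tensor_sum R P Q L'"
  by (simp add: tensor_sum_coset frag_sum_append T_mult frag_sum_F del: F_sel(1))

lemma tensor_elem_eq: "x \<in> carrier P \<Longrightarrow> q \<in> carrier Q \<Longrightarrow>
    tensor_elem R P Q x q = N #>\<^bsub>F\<^esub> frag_of (x, q)"
  by (simp add: tensor_elem_def)

lemma tensor_elem_T: "x \<in> carrier P \<Longrightarrow> q \<in> carrier Q \<Longrightarrow> tensor_elem R P Q x q \<in> carrier T"
  by (simp add: tensor_elem_eq carrier_T)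

lemma tensor_elem_add_left:
  assumes "x \<in> carrier P" "y \<in> carrier P" "q \<in> carrier Q"
  shows "tensor_elem R P Q (x \<oplus>\<^bsub>P\<^esub> y) q = tensor_elem R P Q x q \<otimes>\<^bsub>T\<^esub> tensor_elem R P Q y q"
proof -
  have "frag_of (x \<oplus>\<^bsub>P\<^esub> y, q) - (frag_of (x, q) + frag_of (y, q)) \<in> N"
    unfolding diff_diff_eq[symmetric] by (rule relators_N) (use assms in blast)
  moreover have "frag_of (x, q) + frag_of (y, q) \<in> carrier F"
    using F.m_closed[of "frag_of (x, q)" "frag_of (y, q)"] assms by (simp add: F_sel(2) del: F_sel(1)) simp
  ultimately show ?thesis
    using assms coset_eqI by (simp add: tensor_elem_eq T_mult)
qed

lemma tensor_elem_add_right: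
  assumes "x \<in> carrier P" "p \<in> carrier Q" "q \<in> carrier Q"
  shows "tensor_elem R P Q x (p \<oplus>\<^bsub>Q\<^esub> q) = tensor_elem R P Q x p \<otimes>\<^bsub>T\<^esub> tensor_elem R P Q x q"
proof -
  have "frag_of (x, p \<oplus>\<^bsub>Q\<^esub> q) - (frag_of (x, p) + frag_of (x, q)) \<in> N"
    unfolding diff_diff_eq[symmetric] by (rule relators_N) (use assms in blast)
  moreover have "frag_of (x, p) + frag_of (x, q) \<in> carrier F"
    using F.m_closed[of "frag_of (x, p)" "frag_of (x, q)"] assms by (simp add: F_sel(2) del: F_sel(1)) simp
  ultimately show ?thesis
    using assms Q_add coset_eqI by (simp add: tensor_elem_eq T_mult)
qed

lemma tensor_elem_act:
  assumes "x \<in> carrier P" "c \<in> carrier R" "q \<in> carrier Q"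
  shows "tensor_elem R P Q (x \<triangleleft>\<^bsub>P\<^esub> c) q = tensor_elem R P Q x (c \<odot>\<^bsub>Q\<^esub> q)"
proof -
  have "frag_of (x \<triangleleft>\<^bsub>P\<^esub> c, q) - frag_of (x, c \<odot>\<^bsub>Q\<^esub> q) \<in> N"
    by (rule relators_N) (use assms in blast)
  then show ?thesis using assms P_act Q_act coset_eqI by (simp add: tensor_elem_eq)
qed

text \<open>The homomorphism on the free group kills the relators and hence \<open>N\<close>, so it
  is constant on the coset. Its image there is a singleton, which is what gives
  \<open>the_elem\<close> in \<open>tensor_lift\<close> its value.\<close>

lemma tensor_lift_tensor_sum:
  assumes H: "comm_group H"
    and \<beta>: "\<And>x q. x \<in> carrier P \<Longrightarrow> q \<in> carrier Q \<Longrightarrow> \<beta> x q \<in> carrier H"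
    and l: "\<And>x y q. \<lbrakk>x \<in> carrier P; y \<in> carrier P; q \<in> carrier Q\<rbrakk> \<Longrightarrow>
        \<beta> (x \<oplus>\<^bsub>P\<^esub> y) q = \<beta> x q \<otimes>\<^bsub>H\<^esub> \<beta> y q"
    and r: "\<And>x p q. \<lbrakk>x \<in> carrier P; p \<in> carrier Q; q \<in> carrier Q\<rbrakk> \<Longrightarrow>
        \<beta> x (p \<oplus>\<^bsub>Q\<^esub> q) = \<beta> x p \<otimes>\<^bsub>H\<^esub> \<beta> x q"
    and bal: "\<And>x c q. \<lbrakk>x \<in> carrier P; c \<in> carrier R; q \<in> carrier Q\<rbrakk> \<Longrightarrow>
        \<beta> (x \<triangleleft>\<^bsub>P\<^esub> c) q = \<beta> x (c \<odot>\<^bsub>Q\<^esub> q)"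
    and L: "set L \<subseteq> carrier P \<times> carrier Q"
  shows "tensor_lift H \<beta> (tensor_sum R P Q L)
    = foldr (\<lambda>p h. \<beta> (fst p) (snd p) \<otimes>\<^bsub>H\<^esub> h) L \<one>\<^bsub>H\<^esub>"
proof -
  interpret H: comm_group H by (rule H)
  define h where "h c = finprod H (\<lambda>p. \<beta> (fst p) (snd p) [^]\<^bsub>H\<^esub> Poly_Mapping.lookup c p)
    (Poly_Mapping.keys c)" for c :: "'m \<times> 'q \<Rightarrow>\<^sub>0 int"
  have hom: "h \<in> hom F H"
    unfolding tensor_gens_def h_def by (rule H.free_Abelian_group_hom) (use \<beta> in auto)
  interpret h: group_hom F H h by unfold_locales (rule hom)
  have frag: "h (frag_of p) = \<beta> (fst p) (snd p)" if "p \<in> pairs" for p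
  proof -
    have "h (frag_of p) = \<beta> (fst p) (snd p) [^]\<^bsub>H\<^esub> (1::int)"
      using that \<beta> by (simp add: h_def H.finprod_insert mem_Times_iff)
    then show ?thesis using that \<beta> by (simp add: mem_Times_iff)
  qed
  have add: "h (c + d) = h c \<otimes>\<^bsub>H\<^esub> h d" if "c \<in> carrier F" "d \<in> carrier F" for c d
    using h.hom_mult[OF that] by simp
  have diff: "h (c - d) = h c \<otimes>\<^bsub>H\<^esub> inv\<^bsub>H\<^esub> h d" if "c \<in> carrier F" "d \<in> carrier F" for c d
  proof -
    have "- d \<in> carrier F" "h (- d) = inv\<^bsub>H\<^esub> h d" using that F_inv[of d] h.hom_inv[of d] by auto
    then show ?thesis using add[of c "- d"] that by simp
  qed
  have fF: "frag_of p \<in> carrier F" if "p \<in> pairs" for p using that by simp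
  have rel: "c \<in> kernel F H h" if "c \<in> relators" for c
  proof -
    have e: "h (frag_of a - frag_of b - frag_of d) = h (frag_of a) \<otimes>\<^bsub>H\<^esub> inv\<^bsub>H\<^esub> h (frag_of b) \<otimes>\<^bsub>H\<^esub> inv\<^bsub>H\<^esub> h (frag_of d)"
      "h (frag_of a - frag_of b) = h (frag_of a) \<otimes>\<^bsub>H\<^esub> inv\<^bsub>H\<^esub> h (frag_of b)"
      if "a \<in> pairs" "b \<in> pairs" "d \<in> pairs" for a b d
      using that diff[OF F_diff fF, OF fF fF] diff[OF fF fF] by auto
    \<comment> \<open>By additivity of \<open>\<beta>\<close>, the two kinds of additive relators
      are sent to expressions of exactly this shape.\<close>
    have g: "u \<otimes>\<^bsub>H\<^esub> v \<otimes>\<^bsub>H\<^esub> inv\<^bsub>H\<^esub> u \<otimes>\<^bsub>H\<^esub> inv\<^bsub>H\<^esub> v = \<one>\<^bsub>H\<^esub>"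
      if "u \<in> carrier H" "v \<in> carrier H" for u v
      using that by (simp add: H.m_comm[of u v] H.m_assoc)
    have "h c = \<one>\<^bsub>H\<^esub>" using \<open>c \<in> relators\<close>
    proof (elim UnE CollectE exE conjE)
      fix x y q assume "c = frag_of (x \<oplus>\<^bsub>P\<^esub> y, q) - frag_of (x, q) - frag_of (y, q)"
        and m: "x \<in> carrier P" "y \<in> carrier P" "q \<in> carrier Q"
      then have "h c = \<beta> (x \<oplus>\<^bsub>P\<^esub> y) q \<otimes>\<^bsub>H\<^esub> inv\<^bsub>H\<^esub> \<beta> x q \<otimes>\<^bsub>H\<^esub> inv\<^bsub>H\<^esub> \<beta> y q"
        using e(1)[of "(x \<oplus>\<^bsub>P\<^esub> y, q)" "(x, q)" "(y, q)"] by (simp add: frag)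
      then show ?thesis using m l \<beta> g by simp
    next
      fix x p q assume "c = frag_of (x, p \<oplus>\<^bsub>Q\<^esub> q) - frag_of (x, p) - frag_of (x, q)"
        and m: "x \<in> carrier P" "p \<in> carrier Q" "q \<in> carrier Q"
      then have "h c = \<beta> x (p \<oplus>\<^bsub>Q\<^esub> q) \<otimes>\<^bsub>H\<^esub> inv\<^bsub>H\<^esub> \<beta> x p \<otimes>\<^bsub>H\<^esub> inv\<^bsub>H\<^esub> \<beta> x q"
        using e(1)[of "(x, p \<oplus>\<^bsub>Q\<^esub> q)" "(x, p)" "(x, q)"] Q_add by (simp add: frag)
      then show ?thesis using m r \<beta> g by simp
    next
      fix x d q assume "c = frag_of (x \<triangleleft>\<^bsub>P\<^esub> d, q) - frag_of (x, d \<odot>\<^bsub>Q\<^esub> q)"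
        and m: "x \<in> carrier P" "d \<in> carrier R" "q \<in> carrier Q"
      then have "h c = \<beta> (x \<triangleleft>\<^bsub>P\<^esub> d) q \<otimes>\<^bsub>H\<^esub> inv\<^bsub>H\<^esub> \<beta> x (d \<odot>\<^bsub>Q\<^esub> q)"
        using e(2)[of "(x \<triangleleft>\<^bsub>P\<^esub> d, q)" "(x, d \<odot>\<^bsub>Q\<^esub> q)" "(x, q)"] P_act Q_act by (simp add: frag)
      then show ?thesis using m bal[OF m] \<beta> Q_act by simp
    qed
    then show ?thesis using subsetD[OF relators_F that] by (simp only: kernel_def mem_Collect_eq)
  qed
  have ker: "h c = \<one>\<^bsub>H\<^esub>" if "c \<in> N" for c
  proof -
    have "N \<subseteq> kernel F H h"
      unfolding tensor_rels_def by (rule F.generate_subgroup_incl[OF subsetI[OF rel] h.subgroup_kernel])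
    then show ?thesis using that by (auto simp: kernel_def)
  qed
  have sum: "h (frag_sum L) = foldr (\<lambda>p h. \<beta> (fst p) (snd p) \<otimes>\<^bsub>H\<^esub> h) L \<one>\<^bsub>H\<^esub>"
    using L
  proof (induction L)
    case Nil
    then show ?case using h.hom_one by simp
  next
    case (Cons p L)
    then show ?case using add[OF fF frag_sum_F, of p L] frag[of p] by simp
  qed
  have c: "frag_sum L \<in> carrier F" by (rule frag_sum_F[OF L])
  have "h ` (N #>\<^bsub>F\<^esub> frag_sum L) = {h (frag_sum L)}"
  proof
    show "h ` (N #>\<^bsub>F\<^esub> frag_sum L) \<subseteq> {h (frag_sum L)}"
    proof
      fix y assume "y \<in> h ` (N #>\<^bsub>F\<^esub> frag_sum L)"
      then obtain d where d: "d \<in> N" "y = h (d \<otimes>\<^bsub>F\<^esub> frag_sum L)"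
        unfolding r_coset_def by blast
      then have "y = h d \<otimes>\<^bsub>H\<^esub> h (frag_sum L)" using h.hom_mult[OF _ c] N.subset by blast
      then show "y \<in> {h (frag_sum L)}" using ker[OF d(1)] h.hom_closed[OF c] by simp
    qed
    show "{h (frag_sum L)} \<subseteq> h ` (N #>\<^bsub>F\<^esub> frag_sum L)"
      using F.rcos_self[OF c N_subgroup] by blast
  qed
  then show ?thesis
    unfolding tensor_lift_def h_def[symmetric] tensor_sum_coset[OF L] by (simp add: sum)
qed

end


section \<open>Modules over a truncated algebra\<close>

text \<open>A list of pairs stands for a sum of tensors x \<otimes> a, \<open>act_sum\<close> for
  its image under multiplication, and \<open>times_right\<close> for the right action on the second
  factors. From here on relations are studied as lists, and tensors reappear only in the kernel
  conditions.\<close>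

definition act_sum :: "('r, 'm, 'd) right_module_scheme \<Rightarrow> ('m \<times> 'r) list \<Rightarrow> 'm" where
  "act_sum M L = foldr (\<lambda>p y. fst p \<triangleleft>\<^bsub>M\<^esub> snd p \<oplus>\<^bsub>M\<^esub> y) L \<zero>\<^bsub>M\<^esub>"

lemma act_sum_simps [simp]:
  "act_sum M [] = \<zero>\<^bsub>M\<^esub>"
  "act_sum M (p # L) = fst p \<triangleleft>\<^bsub>M\<^esub> snd p \<oplus>\<^bsub>M\<^esub> act_sum M L"
  by (simp_all add: act_sum_def)

abbreviation times_right :: "('r, 'c) ring_scheme \<Rightarrow> 'r \<Rightarrow> ('m \<times> 'r) list \<Rightarrow> ('m \<times> 'r) list" where
  "times_right A b \<equiv> map (\<lambda>p. (fst p, snd p \<otimes>\<^bsub>A\<^esub> b))"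

context right_module
begin

lemma zero_ract: "a \<in> carrier R \<Longrightarrow> \<zero>\<^bsub>M\<^esub> \<triangleleft>\<^bsub>M\<^esub> a = \<zero>\<^bsub>M\<^esub>"
  using ract_l_distr[of "\<zero>\<^bsub>M\<^esub>" "\<zero>\<^bsub>M\<^esub>" a] ract_closed[of "\<zero>\<^bsub>M\<^esub>" a] M.add.r_cancel_one by simp

lemma ract_zero: "x \<in> carrier M \<Longrightarrow> x \<triangleleft>\<^bsub>M\<^esub> \<zero> = \<zero>\<^bsub>M\<^esub>"
  using ract_r_distr[of x \<zero> \<zero>] ract_closed[of x \<zero>] M.add.r_cancel_one by simp

lemma minus_ract:
  assumes "x \<in> carrier M" "a \<in> carrier R"
  shows "(\<ominus>\<^bsub>M\<^esub> x) \<triangleleft>\<^bsub>M\<^esub> a = \<ominus>\<^bsub>M\<^esub> (x \<triangleleft>\<^bsub>M\<^esub> a)"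
proof -
  have "(\<ominus>\<^bsub>M\<^esub> x) \<triangleleft>\<^bsub>M\<^esub> a \<oplus>\<^bsub>M\<^esub> x \<triangleleft>\<^bsub>M\<^esub> a = \<zero>\<^bsub>M\<^esub>"
    using ract_l_distr[of "\<ominus>\<^bsub>M\<^esub> x" x a] assms by (simp add: M.l_neg zero_ract)
  then show ?thesis using assms M.minus_equality ract_closed by (metis M.a_inv_closed)
qed

lemma finsum_ract:
  assumes "finite I" "\<And>i. i \<in> I \<Longrightarrow> h i \<in> carrier M" "a \<in> carrier R"
  shows "finsum M h I \<triangleleft>\<^bsub>M\<^esub> a = (\<Oplus>\<^bsub>M\<^esub>i\<in>I. h i \<triangleleft>\<^bsub>M\<^esub> a)"
  using assms(1,2)
proof (induction I)
  case empty
  then show ?case using assms(3) by (simp add: zero_ract)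
next
  case (insert i I)
  have "finsum M h (insert i I) = h i \<oplus>\<^bsub>M\<^esub> finsum M h I"
    by (rule M.finsum_insert) (use insert in auto)
  moreover have "(\<Oplus>\<^bsub>M\<^esub>i\<in>insert i I. h i \<triangleleft>\<^bsub>M\<^esub> a) = h i \<triangleleft>\<^bsub>M\<^esub> a \<oplus>\<^bsub>M\<^esub> (\<Oplus>\<^bsub>M\<^esub>i\<in>I. h i \<triangleleft>\<^bsub>M\<^esub> a)"
    by (rule M.finsum_insert) (use insert ract_closed assms(3) in auto)
  ultimately show ?case
    using insert assms(3) by (simp add: ract_l_distr M.finsum_closed)
qed

lemma ract_finsum:
  assumes "finite I" "\<And>i. i \<in> I \<Longrightarrow> h i \<in> carrier R" "x \<in> carrier M"
  shows "x \<triangleleft>\<^bsub>M\<^esub> finsum R h I = (\<Oplus>\<^bsub>M\<^esub>i\<in>I. x \<triangleleft>\<^bsub>M\<^esub> h i)"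
  using assms(1,2)
proof (induction I)
  case empty
  then show ?case using assms(3) by (simp add: ract_zero)
next
  case (insert i I)
  have "finsum R h (insert i I) = h i \<oplus> finsum R h I"
    by (rule R.finsum_insert) (use insert in auto)
  moreover have "(\<Oplus>\<^bsub>M\<^esub>i\<in>insert i I. x \<triangleleft>\<^bsub>M\<^esub> h i) = x \<triangleleft>\<^bsub>M\<^esub> h i \<oplus>\<^bsub>M\<^esub> (\<Oplus>\<^bsub>M\<^esub>i\<in>I. x \<triangleleft>\<^bsub>M\<^esub> h i)"
    by (rule M.finsum_insert) (use insert ract_closed assms(3) in auto)
  ultimately show ?case
    using insert assms(3) by (simp add: ract_r_distr R.finsum_closed)
qed

lemma act_sum_closed: "set L \<subseteq> carrier M \<times> carrier R \<Longrightarrow> act_sum M L \<in> carrier M"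
  by (induction L) (auto simp: ract_closed)

lemma act_sum_append:
  "set L \<subseteq> carrier M \<times> carrier R \<Longrightarrow> set L' \<subseteq> carrier M \<times> carrier R \<Longrightarrow>
    act_sum M (L @ L') = act_sum M L \<oplus>\<^bsub>M\<^esub> act_sum M L'"
  by (induction L) (auto simp: ract_closed act_sum_closed M.a_assoc)

lemma act_sum_minus:
  "set L \<subseteq> carrier M \<times> carrier R \<Longrightarrow>
    act_sum M (map (\<lambda>p. (\<ominus>\<^bsub>M\<^esub> fst p, snd p)) L) = \<ominus>\<^bsub>M\<^esub> act_sum M L"
proof (induction L)
  case Nil
  have "\<ominus>\<^bsub>M\<^esub> \<zero>\<^bsub>M\<^esub> = \<zero>\<^bsub>M\<^esub>" by (rule M.minus_equality) auto
  then show ?case using act_sum_simps(1) by (metis list.map(1))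
next
  case (Cons p L)
  then have "fst p \<triangleleft>\<^bsub>M\<^esub> snd p \<in> carrier M" "act_sum M L \<in> carrier M"
    using act_sum_closed by (auto intro: ract_closed)
  then show ?case using Cons by (auto simp: minus_ract M.minus_add)
qed

text \<open>This is applied over \<open>A\<close> in a lift and over the truncated algebra in X. In
  the second case \<open>times_right\<close> uses the truncated product, and a degree argument is
  needed to compare it with the product of \<open>A\<close>.\<close>

lemma act_sum_ract:
  "set L \<subseteq> carrier M \<times> carrier R \<Longrightarrow> b \<in> carrier R \<Longrightarrow>
    act_sum M L \<triangleleft>\<^bsub>M\<^esub> b = act_sum M (times_right R b L)"
  by (induction L) (auto simp: zero_ract ract_l_distr ract_closed act_sum_closed ract_assoc)

end

locale truncated_module =
  fixes K :: "'k ring" and A :: "('k, 'a) graded_algebra" and U :: "int set"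
    and X :: "('a, 'x) graded_right_module"
  assumes A: "graded_K_algebra K A" and X: "graded_right_module (alg_trunc A U) X" and U0: "0 \<in> U"
begin

abbreviation "B \<equiv> alg_trunc A U"
abbreviation "D \<equiv> alg_part A"
abbreviation "V \<equiv> mod_part X"

sublocale A: ring A using A by (simp add: graded_K_algebra_def K_algebra_def)

sublocale X: right_module B X using X by (simp add: graded_right_module_def)

lemma gA: "graded_by A D" using A by (simp add: graded_K_algebra_def)

lemma gX: "graded_by X V" using X by (simp add: graded_right_module_def)

lemma D_mult: "a \<in> D i \<Longrightarrow> b \<in> D j \<Longrightarrow> a \<otimes>\<^bsub>A\<^esub> b \<in> D (i + j)"
  using A by (simp add: graded_K_algebra_def)

lemma D_one: "\<one>\<^bsub>A\<^esub> \<in> D 0" using A by (simp add: graded_K_algebra_def)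

lemma Dc: "a \<in> D i \<Longrightarrow> a \<in> carrier A" by (rule A.graded_part_carrier[OF gA])

lemma Vc: "x \<in> V i \<Longrightarrow> x \<in> carrier X" by (rule X.M.graded_part_carrier[OF gX])

lemma B_sel [simp]: "\<zero>\<^bsub>B\<^esub> = \<zero>\<^bsub>A\<^esub>" "\<one>\<^bsub>B\<^esub> = \<one>\<^bsub>A\<^esub>" "add B = add A"
  by (simp_all add: alg_trunc_def)

lemma B_carrier: "a \<in> carrier B \<longleftrightarrow> a \<in> carrier A \<and> hsupp A D a \<subseteq> U"
  by (simp add: alg_trunc_def)

lemma D_B: "a \<in> D u \<Longrightarrow> u \<in> U \<Longrightarrow> a \<in> carrier B"
  using A.hsupp_homogeneous[OF gA, of a u] Dc by (auto simp: B_carrier)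

lemma B_part: "u \<in> U \<Longrightarrow> alg_part B u = D u"
  by (simp add: alg_trunc_def)

lemma B_mult:
  assumes a: "a \<in> D u" and b: "b \<in> D v"
  shows "a \<otimes>\<^bsub>B\<^esub> b = (if u + v \<in> U then a \<otimes>\<^bsub>A\<^esub> b else \<zero>\<^bsub>A\<^esub>)"
proof -
  have c: "a \<in> carrier A" "b \<in> carrier A" using a b Dc by auto
  \<comment> \<open>The support of a homogeneous element is a singleton, or empty if the element is
    zero; the double sum of \<open>alg_trunc\<close> then has one term or none.\<close>
  have "\<not> hsupp A D a = {u} \<Longrightarrow> a = \<zero>\<^bsub>A\<^esub>" "\<not> hsupp A D b = {v} \<Longrightarrow> b = \<zero>\<^bsub>A\<^esub>"
    using a b by (auto simp: hsupp_def A.hcomp_homogeneous[OF gA] split: if_splits)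
  moreover have "hsupp A D \<zero>\<^bsub>A\<^esub> = {}" by (auto simp: hsupp_def A.hcomp_zero[OF gA])
  ultimately show ?thesis
    using a b c
    by (cases "hsupp A D a = {u}"; cases "hsupp A D b = {v}")
      (simp_all add: alg_trunc_def A.hcomp_homogeneous[OF gA])
qed

lemma V_act: "x \<in> V s \<Longrightarrow> a \<in> D u \<Longrightarrow> u \<in> U \<Longrightarrow> x \<triangleleft>\<^bsub>X\<^esub> a \<in> V (s + u)"
  using X B_part unfolding graded_right_module_def by blast

text \<open>Associativity over \<open>B\<close> becomes associativity with the product of
  \<open>A\<close> only where that product is not truncated, whence \<open>u + v \<in> U\<close>.
  The degree arguments in the sequel serve to secure this condition.\<close>

lemma act_assoc:
  assumes "x \<in> carrier X" "a \<in> D u" "b \<in> D v" "u \<in> U" "v \<in> U" "u + v \<in> U"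
  shows "(x \<triangleleft>\<^bsub>X\<^esub> a) \<triangleleft>\<^bsub>X\<^esub> b = x \<triangleleft>\<^bsub>X\<^esub> (a \<otimes>\<^bsub>A\<^esub> b)"
  using X.ract_assoc[of x a b] assms D_B B_mult by simp

lemma act_one: "x \<in> carrier X \<Longrightarrow> x \<triangleleft>\<^bsub>X\<^esub> \<one>\<^bsub>A\<^esub> = x"
  using X.ract_one by simp

lemma act_add_right: "x \<in> carrier X \<Longrightarrow> a \<in> carrier B \<Longrightarrow> b \<in> carrier B \<Longrightarrow>
    x \<triangleleft>\<^bsub>X\<^esub> (a \<oplus>\<^bsub>A\<^esub> b) = x \<triangleleft>\<^bsub>X\<^esub> a \<oplus>\<^bsub>X\<^esub> x \<triangleleft>\<^bsub>X\<^esub> b"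
  using X.ract_r_distr[of x a b] by simp

lemma VD_carrier: "set L \<subseteq> V s \<times> D u \<Longrightarrow> u \<in> U \<Longrightarrow> set L \<subseteq> carrier X \<times> carrier B"
  using Vc D_B by (auto dest!: subsetD)

lemma VD_times_right: "set L \<subseteq> V s \<times> D u \<Longrightarrow> b \<in> D i \<Longrightarrow> set (times_right A b L) \<subseteq> V s \<times> D (u + i)"
  using D_mult by (auto dest!: subsetD)

lemma act_sum_V:
  assumes "set L \<subseteq> V s \<times> D u" "u \<in> U"
  shows "act_sum X L \<in> V (s + u)"
  using assms
proof (induction L)
  case Nil
  then show ?case using X.M.graded_part_zero[OF gX] by simp
next
  case (Cons p L)
  then show ?case using V_act[of "fst p" s "snd p" u] by (auto intro!: X.M.graded_part_add[OF gX])
qed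

section \<open>Multiplication maps, their kernels and the right action in terms of lists\<close>

abbreviation "tp s u \<equiv> tensor_sum (deg0_ring A) (comp_right X s) (comp_left A u)"

lemma comp_sel [simp]:
  "carrier (comp_right X s) = V s" "add (comp_right X s) = add X" "ract (comp_right X s) = ract X"
  "\<zero>\<^bsub>comp_right X s\<^esub> = \<zero>\<^bsub>X\<^esub>"
  "carrier (comp_left A u) = D u" "add (comp_left A u) = add A" "smult (comp_left A u) = monoid.mult A"
  "carrier (deg0_ring A) = D 0"
  by (simp_all add: comp_right_def comp_left_def deg0_ring_def)

lemma tensor_pair_comp: "tensor_pair (deg0_ring A) (comp_right X s) (comp_left A u)"
proof (intro tensor_pair.intro tensor_pair_axioms.intro abelian_groupI)
  show "\<exists>y\<in>carrier (comp_right X s). y \<oplus>\<^bsub>comp_right X s\<^esub> x = \<zero>\<^bsub>comp_right X s\<^esub>"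
    if "x \<in> carrier (comp_right X s)" for x
    using that X.M.graded_part_neg[OF gX] X.M.l_neg[OF Vc] by (intro bexI[of _ "\<ominus>\<^bsub>X\<^esub> x"]) auto
  show "x \<triangleleft>\<^bsub>comp_right X s\<^esub> c \<in> carrier (comp_right X s)"
    if "x \<in> carrier (comp_right X s)" "c \<in> carrier (deg0_ring A)" for x c
    using that V_act[of x s c 0] U0 by simp
  show "c \<odot>\<^bsub>comp_left A u\<^esub> q \<in> carrier (comp_left A u)"
    if "q \<in> carrier (comp_left A u)" "c \<in> carrier (deg0_ring A)" for q c
    using that D_mult[of c 0 q u] by simp
qed (auto simp: X.M.graded_part_add[OF gX] A.graded_part_add[OF gA] X.M.graded_part_zero[OF gX]
    X.M.a_ac Vc)

lemma mu_tensor_sum: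
  assumes u: "u \<in> U" and L: "set L \<subseteq> V s \<times> D u"
  shows "mu X (tp s u L) = act_sum X L"
proof -
  interpret tensor_pair "deg0_ring A" "comp_right X s" "comp_left A u" by (rule tensor_pair_comp)
  have "mu X (tp s u L) = foldr (\<lambda>p h. (fst p \<triangleleft>\<^bsub>X\<^esub> snd p) \<otimes>\<^bsub>add_monoid X\<^esub> h) L \<one>\<^bsub>add_monoid X\<^esub>"
    unfolding mu_def
  proof (rule tensor_lift_tensor_sum)
    show "comm_group (add_monoid X)" by (rule X.M.a_comm_group)
    show "set L \<subseteq> carrier (comp_right X s) \<times> carrier (comp_left A u)" using L by simp
    show "x \<triangleleft>\<^bsub>X\<^esub> (p \<oplus>\<^bsub>comp_left A u\<^esub> q) = (x \<triangleleft>\<^bsub>X\<^esub> p) \<otimes>\<^bsub>add_monoid X\<^esub> (x \<triangleleft>\<^bsub>X\<^esub> q)"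
      if "x \<in> carrier (comp_right X s)" "p \<in> carrier (comp_left A u)" "q \<in> carrier (comp_left A u)"
      for x p q
      using that act_add_right[of x p q] Vc D_B u by simp
    \<comment> \<open>Balance over A_0 is an instance of \<open>act_assoc\<close>, because the
      degrees 0, u and 0 + u all lie in U.\<close>
    show "(x \<triangleleft>\<^bsub>comp_right X s\<^esub> c) \<triangleleft>\<^bsub>X\<^esub> q = x \<triangleleft>\<^bsub>X\<^esub> (c \<odot>\<^bsub>comp_left A u\<^esub> q)"
      if "x \<in> carrier (comp_right X s)" "c \<in> carrier (deg0_ring A)" "q \<in> carrier (comp_left A u)"
      for x c q
      using that act_assoc[of x c 0 q u] Vc u U0 by simp
  qed (use X.ract_closed X.ract_l_distr Vc D_B u in auto)
  then show ?thesis by (simp add: act_sum_def)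
qed

lemma tensor_act_tensor_sum:
  assumes b: "b \<in> D i" and L: "set L \<subseteq> V s \<times> D u"
  shows "tensor_act A X s u i (tp s u L) b = tp s (u + i) (times_right A b L)"
proof -
  interpret L: tensor_pair "deg0_ring A" "comp_right X s" "comp_left A u" by (rule tensor_pair_comp)
  interpret R: tensor_pair "deg0_ring A" "comp_right X s" "comp_left A (u + i)"
    by (rule tensor_pair_comp)
  let ?te = "tensor_elem (deg0_ring A) (comp_right X s) (comp_left A (u + i))"
  have "tensor_act A X s u i (tp s u L) b =
    foldr (\<lambda>p h. ?te (fst p) (snd p \<otimes>\<^bsub>A\<^esub> b) \<otimes>\<^bsub>tensor_comp A X s (u + i)\<^esub> h) L
      \<one>\<^bsub>tensor_comp A X s (u + i)\<^esub>"
    unfolding tensor_act_def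
  proof (rule L.tensor_lift_tensor_sum)
    show "comm_group (tensor_comp A X s (u + i))"
      unfolding tensor_comp_def by (rule R.T_comm_group)
    show "set L \<subseteq> carrier (comp_right X s) \<times> carrier (comp_left A u)" using L by simp
    show "?te x (a \<otimes>\<^bsub>A\<^esub> b) \<in> carrier (tensor_comp A X s (u + i))"
      if "x \<in> carrier (comp_right X s)" "a \<in> carrier (comp_left A u)" for x a
      unfolding tensor_comp_def using that D_mult b by (intro R.tensor_elem_T) auto
    show "?te (x \<oplus>\<^bsub>comp_right X s\<^esub> y) (a \<otimes>\<^bsub>A\<^esub> b)
        = ?te x (a \<otimes>\<^bsub>A\<^esub> b) \<otimes>\<^bsub>tensor_comp A X s (u + i)\<^esub> ?te y (a \<otimes>\<^bsub>A\<^esub> b)"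
      if "x \<in> carrier (comp_right X s)" "y \<in> carrier (comp_right X s)" "a \<in> carrier (comp_left A u)"
      for x y a
      unfolding tensor_comp_def using that D_mult b by (intro R.tensor_elem_add_left) auto
    show "?te x ((a \<oplus>\<^bsub>comp_left A u\<^esub> a') \<otimes>\<^bsub>A\<^esub> b)
        = ?te x (a \<otimes>\<^bsub>A\<^esub> b) \<otimes>\<^bsub>tensor_comp A X s (u + i)\<^esub> ?te x (a' \<otimes>\<^bsub>A\<^esub> b)"
      if "x \<in> carrier (comp_right X s)" "a \<in> carrier (comp_left A u)" "a' \<in> carrier (comp_left A u)"
      for x a a'
      using R.tensor_elem_add_right[of x "a \<otimes>\<^bsub>A\<^esub> b" "a' \<otimes>\<^bsub>A\<^esub> b"] that D_mult b Dc
      by (simp add: tensor_comp_def A.l_distr)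
    show "?te (x \<triangleleft>\<^bsub>comp_right X s\<^esub> c) (a \<otimes>\<^bsub>A\<^esub> b) = ?te x ((c \<odot>\<^bsub>comp_left A u\<^esub> a) \<otimes>\<^bsub>A\<^esub> b)"
      if "x \<in> carrier (comp_right X s)" "c \<in> carrier (deg0_ring A)" "a \<in> carrier (comp_left A u)"
      for x c a
      using R.tensor_elem_act[of x c "a \<otimes>\<^bsub>A\<^esub> b"] that D_mult b Dc by (simp add: A.m_assoc)
  qed
  then show ?thesis by (simp add: tensor_sum_def tensor_comp_def foldr_map comp_def)
qed

lemma tp_Ker_mu:
  assumes u: "u \<in> U" and L: "set L \<subseteq> V s \<times> D u"
  shows "tp s u L \<in> Ker_mu A X s u \<longleftrightarrow> act_sum X L = \<zero>\<^bsub>X\<^esub>"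
proof -
  interpret tensor_pair "deg0_ring A" "comp_right X s" "comp_left A u" by (rule tensor_pair_comp)
  show ?thesis
    using mu_tensor_sum[OF u L] tensor_sum_T[of L] L by (simp add: Ker_mu_def kernel_def tensor_comp_def)
qed

lemma Ker_mu_subgroup:
  assumes u: "u \<in> U"
  shows "subgroup (Ker_mu A X s u) (tensor_comp A X s u)"
proof -
  interpret tensor_pair "deg0_ring A" "comp_right X s" "comp_left A u" by (rule tensor_pair_comp)
  have "mu X \<in> hom T (add_monoid X)"
  proof (rule homI)
    fix t assume "t \<in> carrier T"
    then obtain L where "set L \<subseteq> V s \<times> D u" "t = tp s u L" using ex_tensor_sum by auto
    then show "mu X t \<in> carrier (add_monoid X)"
      using mu_tensor_sum[OF u] Vc[OF act_sum_V[OF _ u]] by simp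
  next
    fix t t' assume "t \<in> carrier T" "t' \<in> carrier T"
    then obtain L L' where L: "set L \<subseteq> V s \<times> D u" "t = tp s u L"
      and L': "set L' \<subseteq> V s \<times> D u" "t' = tp s u L'"
      using ex_tensor_sum by (metis comp_sel(1,5))
    have "t \<otimes>\<^bsub>T\<^esub> t' = tp s u (L @ L')" using L L' tensor_sum_append by simp
    moreover have "set (L @ L') \<subseteq> V s \<times> D u" using L L' by simp
    ultimately show "mu X (t \<otimes>\<^bsub>T\<^esub> t') = mu X t \<otimes>\<^bsub>add_monoid X\<^esub> mu X t'"
      using L L' mu_tensor_sum[OF u] X.act_sum_append VD_carrier[OF _ u] by simp
  qed
  then interpret group_hom T "add_monoid X" "mu X"
    using T_comm_group X.M.a_comm_group
    by (simp add: group_hom_def group_hom_axioms_def comm_group_def)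
  show ?thesis unfolding Ker_mu_def tensor_comp_def by (rule subgroup_kernel)
qed

text \<open>This removes tensors from the kernel conditions. Every element of the first kernel is
  represented by a list, and since the second kernel is a subgroup the inclusion may be tested on
  the generating products.\<close>

lemma Ker_mu_times_subset_iff:
  assumes u: "u \<in> U" "u + i \<in> U"
  shows "Ker_mu_times A X s u i \<subseteq> Ker_mu A X s (u + i) \<longleftrightarrow>
    (\<forall>L b. set L \<subseteq> V s \<times> D u \<longrightarrow> act_sum X L = \<zero>\<^bsub>X\<^esub> \<longrightarrow> b \<in> D i \<longrightarrow>
       act_sum X (times_right A b L) = \<zero>\<^bsub>X\<^esub>)" (is "?l \<longleftrightarrow> ?r")
proof
  assume ?l
  show ?r
  proof (intro allI impI)
    fix L b assume h: "set L \<subseteq> V s \<times> D u" "act_sum X L = \<zero>\<^bsub>X\<^esub>" "b \<in> D i"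
    then have "tp s u L \<in> Ker_mu A X s u" using tp_Ker_mu u by simp
    then have "tensor_act A X s u i (tp s u L) b \<in> Ker_mu_times A X s u i"
      unfolding Ker_mu_times_def using h(3) by (intro generate.incl) blast
    then have "tp s (u + i) (times_right A b L) \<in> Ker_mu A X s (u + i)"
      using \<open>?l\<close> tensor_act_tensor_sum h by auto
    then show "act_sum X (times_right A b L) = \<zero>\<^bsub>X\<^esub>"
      using tp_Ker_mu[OF u(2) VD_times_right[OF h(1,3)]] by simp
  qed
next
  assume r: ?r
  interpret tensor_pair "deg0_ring A" "comp_right X s" "comp_left A u" by (rule tensor_pair_comp)
  interpret R: tensor_pair "deg0_ring A" "comp_right X s" "comp_left A (u + i)"
    by (rule tensor_pair_comp)
  interpret T: comm_group "tensor_comp A X s (u + i)"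
    unfolding tensor_comp_def by (rule R.T_comm_group)
  show ?l unfolding Ker_mu_times_def
  proof (rule T.generate_subgroup_incl[OF _ Ker_mu_subgroup[OF u(2)]], clarify)
    fix t b assume t: "t \<in> Ker_mu A X s u" and b: "b \<in> D i"
    then have "t \<in> carrier T" by (simp add: Ker_mu_def kernel_def tensor_comp_def)
    then obtain L where L: "set L \<subseteq> V s \<times> D u" "t = tp s u L" using ex_tensor_sum by auto
    then have "act_sum X L = \<zero>\<^bsub>X\<^esub>" using tp_Ker_mu[OF u(1)] t by simp
    then have "act_sum X (times_right A b L) = \<zero>\<^bsub>X\<^esub>" using r L b by blast
    then show "tensor_act A X s u i t b \<in> Ker_mu A X s (u + i)"
      using tp_Ker_mu[OF u(2) VD_times_right[OF L(1) b]] tensor_act_tensor_sum[OF b L(1)] L(2) by simp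
  qed
qed

end


section \<open>The coinduced lift of a partial module\<close>

text \<open>The span depends only on zero and addition, so it is the same in \<open>lift\<close> and
  in \<open>Homs\<close>, which have different carriers.\<close>

lemma add_span_cong:
  assumes "\<zero>\<^bsub>G\<^esub> = \<zero>\<^bsub>H\<^esub>" "add G = add H"
  shows "add_span G E = add_span H E"
proof -
  have "z \<in> add_span H E" if "z \<in> add_span G E" and "\<zero>\<^bsub>G\<^esub> = \<zero>\<^bsub>H\<^esub>" "add G = add H"
    for z and G :: "('a, 'b) ring_scheme" and H :: "('a, 'c) ring_scheme"
    using that by induction (simp_all add: add_span.intros)
  moreover have "z \<in> add_span G E" if "z \<in> add_span H E" for z
    using that by induction (simp_all add: add_span.intros flip: assms)
  ultimately show ?thesis using assms by blast
qed

context truncated_module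
begin

lemma finsum_B:
  assumes "finite I" "\<And>i. i \<in> I \<Longrightarrow> h i \<in> carrier B"
  shows "finsum B h I = finsum A h I"
  using assms
proof (induction I)
  case empty
  then show ?case using X.R.finsum_empty A.finsum_empty by simp
next
  case (insert i I)
  have "finsum B h (insert i I) = h i \<oplus>\<^bsub>B\<^esub> finsum B h I"
    by (rule X.R.finsum_insert) (use insert in auto)
  moreover have "finsum A h (insert i I) = h i \<oplus>\<^bsub>A\<^esub> finsum A h I"
    by (rule A.finsum_insert) (use insert B_carrier in auto)
  ultimately show ?case using insert by simp
qed

lemma hcomp_D: "a \<in> carrier A \<Longrightarrow> hcomp A D a i \<in> D i"
  by (rule A.hcomp_in[OF gA])

lemma hcomp_B: "b \<in> carrier B \<Longrightarrow> i \<in> hsupp A D b \<Longrightarrow> hcomp A D b i \<in> carrier B"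
  using hcomp_D D_B B_carrier by blast

definition homog_extend :: "(int \<Rightarrow> 'a \<Rightarrow> 'x) \<Rightarrow> 'a \<Rightarrow> 'x" where
  "homog_extend h a = finsum X (\<lambda>i. h i (hcomp A D a i)) (hsupp A D a)"

lemma homog_extend_superset:
  assumes "\<And>i a. a \<in> D i \<Longrightarrow> h i a \<in> carrier X" "\<And>i. h i \<zero>\<^bsub>A\<^esub> = \<zero>\<^bsub>X\<^esub>"
    and "a \<in> carrier A" "finite I" "hsupp A D a \<subseteq> I"
  shows "homog_extend h a = finsum X (\<lambda>i. h i (hcomp A D a i)) I"
  unfolding homog_extend_def
  by (rule X.M.add.finprod_mono_neutral_cong_left)
    (use assms hcomp_D in \<open>auto simp: hsupp_def\<close>)

lemma homog_extend_homogeneous: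
  assumes "\<And>i a. a \<in> D i \<Longrightarrow> h i a \<in> carrier X" "\<And>i. h i \<zero>\<^bsub>A\<^esub> = \<zero>\<^bsub>X\<^esub>" and a: "a \<in> D i"
  shows "homog_extend h a = h i a"
proof -
  have "homog_extend h a = finsum X (\<lambda>i. h i (hcomp A D a i)) {i}"
    by (rule homog_extend_superset) (use assms Dc A.hsupp_homogeneous[OF gA a] in auto)
  then show ?thesis using assms hcomp_D Dc by (simp add: A.hcomp_homogeneous[OF gA a])
qed

lemma homog_extend_add:
  assumes h: "\<And>i a. a \<in> D i \<Longrightarrow> h i a \<in> carrier X" "\<And>i. h i \<zero>\<^bsub>A\<^esub> = \<zero>\<^bsub>X\<^esub>"
    and add: "\<And>i a b. a \<in> D i \<Longrightarrow> b \<in> D i \<Longrightarrow> h i (a \<oplus>\<^bsub>A\<^esub> b) = h i a \<oplus>\<^bsub>X\<^esub> h i b"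
    and ab: "a \<in> carrier A" "b \<in> carrier A"
  shows "homog_extend h (a \<oplus>\<^bsub>A\<^esub> b) = homog_extend h a \<oplus>\<^bsub>X\<^esub> homog_extend h b"
proof -
  let ?I = "hsupp A D a \<union> hsupp A D b" and ?h = "\<lambda>a i. h i (hcomp A D a i)"
  have fin: "finite ?I" using A.finite_hsupp[OF gA] ab by blast
  have sub: "hsupp A D (a \<oplus>\<^bsub>A\<^esub> b) \<subseteq> ?I"
    using ab by (auto simp: hsupp_def A.hcomp_add[OF gA])
  have "homog_extend h (a \<oplus>\<^bsub>A\<^esub> b) = finsum X (?h (a \<oplus>\<^bsub>A\<^esub> b)) ?I"
    by (rule homog_extend_superset[of h, OF h _ fin sub]) (use ab in auto)
  also have "\<dots> = (\<Oplus>\<^bsub>X\<^esub>i\<in>?I. ?h a i \<oplus>\<^bsub>X\<^esub> ?h b i)"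
    using ab hcomp_D by (simp add: A.hcomp_add[OF gA] add)
  also have "\<dots> = finsum X (?h a) ?I \<oplus>\<^bsub>X\<^esub> finsum X (?h b) ?I"
    by (rule X.M.finsum_addf) (use h ab hcomp_D in auto)
  also have "finsum X (?h a) ?I = homog_extend h a"
    by (rule homog_extend_superset[of h, OF h _ fin, symmetric]) (use ab in auto)
  also have "finsum X (?h b) ?I = homog_extend h b"
    by (rule homog_extend_superset[of h, OF h _ fin, symmetric]) (use ab in auto)
  finally show ?thesis .
qed

end

text \<open>The functor of the overview in terms of elements: \<open>b\<close> of any degree i acts
  from V_s to V_(s+i) when both degrees lie in \<open>S\<close>, and \<open>star_act\<close> says
  that this extends the action of \<open>B\<close>. The degree \<open>s\<close> is an argument of
  \<open>star\<close> because zero belongs to every component.\<close>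

locale partial_module = truncated_module K A U X
  for K :: "'k ring" and A :: "('k, 'a) graded_algebra" and U :: "int set"
    and X :: "('a, 'x) graded_right_module" +
  fixes S :: "int set" and star :: "int \<Rightarrow> 'x \<Rightarrow> 'a \<Rightarrow> 'x"
  assumes V_outside: "s \<notin> S \<Longrightarrow> x \<in> V s \<Longrightarrow> x = \<zero>\<^bsub>X\<^esub>"
    and star_V: "\<lbrakk>s \<in> S; s + i \<in> S; x \<in> V s; b \<in> D i\<rbrakk> \<Longrightarrow> star s x b \<in> V (s + i)"
    and star_add_left: "\<lbrakk>s \<in> S; s + i \<in> S; x \<in> V s; y \<in> V s; b \<in> D i\<rbrakk> \<Longrightarrow>
        star s (x \<oplus>\<^bsub>X\<^esub> y) b = star s x b \<oplus>\<^bsub>X\<^esub> star s y b"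
    and star_add_right: "\<lbrakk>s \<in> S; s + i \<in> S; x \<in> V s; b \<in> D i; c \<in> D i\<rbrakk> \<Longrightarrow>
        star s x (b \<oplus>\<^bsub>A\<^esub> c) = star s x b \<oplus>\<^bsub>X\<^esub> star s x c"
    and star_assoc: "\<lbrakk>s \<in> S; s + i \<in> S; s + i + j \<in> S; x \<in> V s; b \<in> D i; c \<in> D j\<rbrakk> \<Longrightarrow>
        star (s + i) (star s x b) c = star s x (b \<otimes>\<^bsub>A\<^esub> c)"
    and star_one: "\<lbrakk>s \<in> S; x \<in> V s\<rbrakk> \<Longrightarrow> star s x \<one>\<^bsub>A\<^esub> = x"
    and star_act: "\<lbrakk>s \<in> S; u \<in> U; s + u \<in> S; x \<in> V s; a \<in> D u\<rbrakk> \<Longrightarrow> star s x a = x \<triangleleft>\<^bsub>X\<^esub> a"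
begin

lemma star_zero_left:
  assumes "s \<in> S" "s + i \<in> S" "b \<in> D i"
  shows "star s \<zero>\<^bsub>X\<^esub> b = \<zero>\<^bsub>X\<^esub>"
proof -
  have "star s \<zero>\<^bsub>X\<^esub> b \<oplus>\<^bsub>X\<^esub> star s \<zero>\<^bsub>X\<^esub> b = star s \<zero>\<^bsub>X\<^esub> b" "star s \<zero>\<^bsub>X\<^esub> b \<in> carrier X"
    using star_add_left[of s i "\<zero>\<^bsub>X\<^esub>" "\<zero>\<^bsub>X\<^esub>" b] Vc[OF star_V[of s i "\<zero>\<^bsub>X\<^esub>" b]] assms
      X.M.graded_part_zero[OF gX] by auto
  then show ?thesis using X.M.add.r_cancel_one by simp
qed

lemma star_zero_right:
  assumes "s \<in> S" "s + i \<in> S" "x \<in> V s"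
  shows "star s x \<zero>\<^bsub>A\<^esub> = \<zero>\<^bsub>X\<^esub>"
proof -
  have "star s x \<zero>\<^bsub>A\<^esub> \<oplus>\<^bsub>X\<^esub> star s x \<zero>\<^bsub>A\<^esub> = star s x \<zero>\<^bsub>A\<^esub>" "star s x \<zero>\<^bsub>A\<^esub> \<in> carrier X"
    using star_add_right[of s i x "\<zero>\<^bsub>A\<^esub>" "\<zero>\<^bsub>A\<^esub>"] Vc[OF star_V[of s i x "\<zero>\<^bsub>A\<^esub>"]] assms
      A.graded_part_zero[OF gA] by auto
  then show ?thesis using X.M.add.r_cancel_one by simp
qed

lemma star_minus:
  assumes s: "s \<in> S" "s + i \<in> S" and x: "x \<in> V s" and b: "b \<in> D i"
  shows "star s (\<ominus>\<^bsub>X\<^esub> x) b = \<ominus>\<^bsub>X\<^esub> star s x b"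
proof -
  have n: "\<ominus>\<^bsub>X\<^esub> x \<in> V s" by (rule X.M.graded_part_neg[OF gX x])
  have "star s (\<ominus>\<^bsub>X\<^esub> x) b \<oplus>\<^bsub>X\<^esub> star s x b = \<zero>\<^bsub>X\<^esub>"
    using star_add_left[OF s n x b] star_zero_left[OF s b] Vc[OF x] by (simp add: X.M.l_neg)
  then show ?thesis using X.M.minus_equality Vc star_V[OF s x b] star_V[OF s n b] by metis
qed

text \<open>The rule \<phi>(a b) = \<phi>(a) b is imposed only where \<open>star\<close> is
  meaningful, that is when t + i and t + i + j both lie in \<open>S\<close>. Fixing the value zero
  off \<open>carrier A\<close> makes equality of functions agree with equality of maps on
  \<open>A\<close>.\<close>

definition coind_part :: "int \<Rightarrow> ('a \<Rightarrow> 'x) set" where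
  "coind_part t = {\<phi>. (\<forall>a. a \<notin> carrier A \<longrightarrow> \<phi> a = \<zero>\<^bsub>X\<^esub>) \<and>
     (\<forall>a\<in>carrier A. \<forall>b\<in>carrier A. \<phi> (a \<oplus>\<^bsub>A\<^esub> b) = \<phi> a \<oplus>\<^bsub>X\<^esub> \<phi> b) \<and>
     (\<forall>a\<in>carrier A. \<phi> a \<in> carrier X) \<and>
     (\<forall>i. \<forall>a\<in>D i. \<phi> a \<in> V (t + i)) \<and>
     (\<forall>i j. \<forall>a\<in>D i. \<forall>b\<in>D j. t + i \<in> S \<longrightarrow> t + i + j \<in> S \<longrightarrow>
        \<phi> (a \<otimes>\<^bsub>A\<^esub> b) = star (t + i) (\<phi> a) b)}"

text \<open>The ambient module of all additive maps, from which the module laws are inherited. It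
  need not be the sum of the sets \<open>coind_part t\<close>, so the graded module
  \<open>lift\<close> is cut out as their span.\<close>

definition Homs :: "('a, 'a \<Rightarrow> 'x) graded_right_module" where
  "Homs = \<lparr>carrier = {\<phi>. (\<forall>a. a \<notin> carrier A \<longrightarrow> \<phi> a = \<zero>\<^bsub>X\<^esub>) \<and>
       (\<forall>a\<in>carrier A. \<forall>b\<in>carrier A. \<phi> (a \<oplus>\<^bsub>A\<^esub> b) = \<phi> a \<oplus>\<^bsub>X\<^esub> \<phi> b) \<and>
       (\<forall>a\<in>carrier A. \<phi> a \<in> carrier X)},
     monoid.mult = undefined, one = undefined, ring.zero = (\<lambda>_. \<zero>\<^bsub>X\<^esub>),
     add = (\<lambda>\<phi> \<psi> a. \<phi> a \<oplus>\<^bsub>X\<^esub> \<psi> a),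
     ract = (\<lambda>\<phi> c a. if a \<in> carrier A then \<phi> (c \<otimes>\<^bsub>A\<^esub> a) else \<zero>\<^bsub>X\<^esub>),
     mod_part = coind_part\<rparr>"

definition lift :: "('a, 'a \<Rightarrow> 'x) graded_right_module" where
  "lift = Homs\<lparr>carrier := add_span Homs (\<Union>t. coind_part t)\<rparr>"

lemma Homs_sel [simp]:
  "\<zero>\<^bsub>Homs\<^esub> = (\<lambda>_. \<zero>\<^bsub>X\<^esub>)" "\<phi> \<oplus>\<^bsub>Homs\<^esub> \<psi> = (\<lambda>a. \<phi> a \<oplus>\<^bsub>X\<^esub> \<psi> a)"
  "\<phi> \<triangleleft>\<^bsub>Homs\<^esub> c = (\<lambda>a. if a \<in> carrier A then \<phi> (c \<otimes>\<^bsub>A\<^esub> a) else \<zero>\<^bsub>X\<^esub>)"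
  by (simp_all add: Homs_def)

lemma carrier_Homs: "\<phi> \<in> carrier Homs \<longleftrightarrow> (\<forall>a. a \<notin> carrier A \<longrightarrow> \<phi> a = \<zero>\<^bsub>X\<^esub>) \<and>
       (\<forall>a\<in>carrier A. \<forall>b\<in>carrier A. \<phi> (a \<oplus>\<^bsub>A\<^esub> b) = \<phi> a \<oplus>\<^bsub>X\<^esub> \<phi> b) \<and>
       (\<forall>a\<in>carrier A. \<phi> a \<in> carrier X)"
  by (simp add: Homs_def)

lemma Homs_apply: "\<phi> \<in> carrier Homs \<Longrightarrow> \<phi> a \<in> carrier X"
  by (cases "a \<in> carrier A") (auto simp: carrier_Homs)

lemma coind_Homs: "\<phi> \<in> coind_part t \<Longrightarrow> \<phi> \<in> carrier Homs"
  by (simp add: coind_part_def carrier_Homs)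

lemma coind_V: "\<phi> \<in> coind_part t \<Longrightarrow> a \<in> D i \<Longrightarrow> \<phi> a \<in> V (t + i)"
  by (simp add: coind_part_def)

lemma coind_star: "\<phi> \<in> coind_part t \<Longrightarrow> a \<in> D i \<Longrightarrow> b \<in> D j \<Longrightarrow> t + i \<in> S \<Longrightarrow> t + i + j \<in> S \<Longrightarrow>
    \<phi> (a \<otimes>\<^bsub>A\<^esub> b) = star (t + i) (\<phi> a) b"
  by (simp add: coind_part_def)

lemma coind_partI:
  assumes "\<phi> \<in> carrier Homs" "\<And>i a. a \<in> D i \<Longrightarrow> \<phi> a \<in> V (t + i)"
    and "\<And>i j a b. \<lbrakk>a \<in> D i; b \<in> D j; t + i \<in> S; t + i + j \<in> S\<rbrakk> \<Longrightarrow>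
      \<phi> (a \<otimes>\<^bsub>A\<^esub> b) = star (t + i) (\<phi> a) b"
  shows "\<phi> \<in> coind_part t"
  using assms by (simp add: coind_part_def carrier_Homs)

lemma Homs_minus:
  assumes "\<phi> \<in> carrier Homs"
  shows "(\<lambda>a. \<ominus>\<^bsub>X\<^esub> \<phi> a) \<in> carrier Homs"
proof -
  have "\<ominus>\<^bsub>X\<^esub> \<zero>\<^bsub>X\<^esub> = \<zero>\<^bsub>X\<^esub>" by (rule X.M.minus_equality) auto
  then show ?thesis using assms by (auto simp: carrier_Homs X.M.minus_add)
qed

lemma abelian_group_Homs: "abelian_group Homs"
proof (rule abelian_groupI)
  show "\<exists>\<psi>\<in>carrier Homs. \<psi> \<oplus>\<^bsub>Homs\<^esub> \<phi> = \<zero>\<^bsub>Homs\<^esub>" if "\<phi> \<in> carrier Homs" for \<phi>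
    using that by (intro bexI[OF _ Homs_minus[OF that]]) (simp add: Homs_apply X.M.l_neg)
  show "\<phi> \<oplus>\<^bsub>Homs\<^esub> \<psi> \<in> carrier Homs" if "\<phi> \<in> carrier Homs" "\<psi> \<in> carrier Homs" for \<phi> \<psi>
    using that by (auto simp: carrier_Homs X.M.a_ac)
  show "\<zero>\<^bsub>Homs\<^esub> \<in> carrier Homs" by (simp add: carrier_Homs)
qed (auto simp: Homs_apply X.M.a_ac)

lemma right_module_Homs: "right_module A Homs"
proof (intro right_module.intro right_module_axioms.intro)
  show "ring A" by (rule A.ring_axioms)
  show "abelian_group Homs" by (rule abelian_group_Homs)
  show "\<phi> \<triangleleft>\<^bsub>Homs\<^esub> c \<in> carrier Homs" if "\<phi> \<in> carrier Homs" "c \<in> carrier A" for \<phi> c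
    using that by (auto simp: carrier_Homs A.r_distr)
  show "\<phi> \<triangleleft>\<^bsub>Homs\<^esub> \<one>\<^bsub>A\<^esub> = \<phi>" if "\<phi> \<in> carrier Homs" for \<phi>
    using that by (auto simp: carrier_Homs)
qed (auto simp: carrier_Homs A.l_distr A.m_assoc)

sublocale Homs: right_module A Homs by (rule right_module_Homs)

lemma Homs_minus_eq: "\<phi> \<in> carrier Homs \<Longrightarrow> \<ominus>\<^bsub>Homs\<^esub> \<phi> = (\<lambda>a. \<ominus>\<^bsub>X\<^esub> \<phi> a)"
  by (rule Homs.M.minus_equality) (auto simp: Homs_minus Homs_apply X.M.l_neg)

lemma coind_zero: "(\<lambda>_. \<zero>\<^bsub>X\<^esub>) \<in> coind_part t"
  using Homs.M.zero_closed
  by (intro coind_partI) (auto simp: X.M.graded_part_zero[OF gX] star_zero_left)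

lemma coind_add:
  assumes "\<phi> \<in> coind_part t" "\<psi> \<in> coind_part t"
  shows "(\<lambda>a. \<phi> a \<oplus>\<^bsub>X\<^esub> \<psi> a) \<in> coind_part t"
proof (rule coind_partI)
  show "(\<lambda>a. \<phi> a \<oplus>\<^bsub>X\<^esub> \<psi> a) \<in> carrier Homs"
    using Homs.M.a_closed[of \<phi> \<psi>] assms coind_Homs by simp
  show "\<phi> a \<oplus>\<^bsub>X\<^esub> \<psi> a \<in> V (t + i)" if "a \<in> D i" for a i
    using assms that coind_V X.M.graded_part_add[OF gX] by blast
  show "\<phi> (a \<otimes>\<^bsub>A\<^esub> b) \<oplus>\<^bsub>X\<^esub> \<psi> (a \<otimes>\<^bsub>A\<^esub> b) = star (t + i) (\<phi> a \<oplus>\<^bsub>X\<^esub> \<psi> a) b"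
    if "a \<in> D i" "b \<in> D j" "t + i \<in> S" "t + i + j \<in> S" for a b i j
    using that assms by (simp add: coind_star star_add_left coind_V)
qed

lemma coind_minus:
  assumes "\<phi> \<in> coind_part t"
  shows "(\<lambda>a. \<ominus>\<^bsub>X\<^esub> \<phi> a) \<in> coind_part t"
proof (rule coind_partI)
  show "(\<lambda>a. \<ominus>\<^bsub>X\<^esub> \<phi> a) \<in> carrier Homs" using Homs_minus assms coind_Homs by simp
  show "\<ominus>\<^bsub>X\<^esub> \<phi> a \<in> V (t + i)" if "a \<in> D i" for a i
    using assms that coind_V X.M.graded_part_neg[OF gX] by blast
  show "\<ominus>\<^bsub>X\<^esub> \<phi> (a \<otimes>\<^bsub>A\<^esub> b) = star (t + i) (\<ominus>\<^bsub>X\<^esub> \<phi> a) b"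
    if "a \<in> D i" "b \<in> D j" "t + i \<in> S" "t + i + j \<in> S" for a b i j
    using that assms by (simp add: coind_star star_minus coind_V)
qed

text \<open>By associativity in \<open>A\<close>, the rule for \<phi> c at (a, b) is the rule for
  \<phi> at (c a, b), with the same degree conditions.\<close>

lemma coind_act:
  assumes \<phi>: "\<phi> \<in> coind_part t" and c: "c \<in> D k"
  shows "\<phi> \<triangleleft>\<^bsub>Homs\<^esub> c \<in> coind_part (t + k)"
proof (rule coind_partI)
  show "\<phi> \<triangleleft>\<^bsub>Homs\<^esub> c \<in> carrier Homs" using Homs.ract_closed coind_Homs[OF \<phi>] Dc[OF c] .
  show "(\<phi> \<triangleleft>\<^bsub>Homs\<^esub> c) a \<in> V (t + k + i)" if "a \<in> D i" for a i
    using that coind_V[OF \<phi> D_mult[OF c that]] Dc by (simp add: add.assoc)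
  show "(\<phi> \<triangleleft>\<^bsub>Homs\<^esub> c) (a \<otimes>\<^bsub>A\<^esub> b) = star (t + k + i) ((\<phi> \<triangleleft>\<^bsub>Homs\<^esub> c) a) b"
    if "a \<in> D i" "b \<in> D j" "t + k + i \<in> S" "t + k + i + j \<in> S" for a b i j
    using that coind_star[OF \<phi> D_mult[OF c that(1)] that(2)] Dc[OF c] Dc[OF that(1)] Dc[OF that(2)]
    by (simp add: add.assoc A.m_assoc)
qed

abbreviation E where "E \<equiv> \<Union>t. coind_part t"

lemma E_Homs: "E \<subseteq> carrier Homs" using coind_Homs by blast

lemma lift_Homs: "\<phi> \<in> carrier lift \<Longrightarrow> \<phi> \<in> carrier Homs"
  using Homs.M.add_span_carrier[OF E_Homs] by (auto simp: lift_def)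

lemma lift_sel [simp]:
  "\<zero>\<^bsub>lift\<^esub> = (\<lambda>_. \<zero>\<^bsub>X\<^esub>)" "add lift = add Homs" "ract lift = ract Homs"
  "mod_part lift = coind_part"
  by (simp_all add: lift_def Homs_def)

lemma lift_add_closed: "\<phi> \<in> carrier lift \<Longrightarrow> \<psi> \<in> carrier lift \<Longrightarrow> \<phi> \<oplus>\<^bsub>Homs\<^esub> \<psi> \<in> carrier lift"
  unfolding lift_def using Homs.M.add_span_add[OF E_Homs] by simp

lemma lift_minus_closed: "\<phi> \<in> carrier lift \<Longrightarrow> \<ominus>\<^bsub>Homs\<^esub> \<phi> \<in> carrier lift"
proof -
  have "\<ominus>\<^bsub>Homs\<^esub> e \<in> E" if "e \<in> E" for e
    using that coind_minus Homs_minus_eq[OF coind_Homs] by fastforce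
  then show "\<phi> \<in> carrier lift \<Longrightarrow> \<ominus>\<^bsub>Homs\<^esub> \<phi> \<in> carrier lift"
    using Homs.M.add_span_neg[OF E_Homs, of \<phi>] by (simp add: lift_def)
qed

lemma coind_lift: "\<phi> \<in> coind_part t \<Longrightarrow> \<phi> \<in> carrier lift"
  using Homs.M.add_span_incl[of \<phi> E] coind_Homs by (auto simp: lift_def)

lemma lift_zero_closed: "(\<lambda>_. \<zero>\<^bsub>X\<^esub>) \<in> carrier lift"
  using coind_lift[OF coind_zero] .

lemma lift_act_closed:
  assumes "\<phi> \<in> carrier lift" and c: "c \<in> carrier A"
  shows "\<phi> \<triangleleft>\<^bsub>Homs\<^esub> c \<in> carrier lift"
proof -
  have 1: "\<psi> \<triangleleft>\<^bsub>Homs\<^esub> c \<in> carrier lift" if \<psi>: "\<psi> \<in> coind_part t" for \<psi> t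
    using gA c
  proof (rule A.graded_induct)
    show "\<psi> \<triangleleft>\<^bsub>Homs\<^esub> \<zero>\<^bsub>A\<^esub> \<in> carrier lift"
      using Homs.ract_zero[OF coind_Homs[OF \<psi>]] lift_zero_closed by simp
    show "\<psi> \<triangleleft>\<^bsub>Homs\<^esub> b \<in> carrier lift" if "b \<in> D i" for b i
      using coind_lift[OF coind_act[OF \<psi> that]] .
    show "\<psi> \<triangleleft>\<^bsub>Homs\<^esub> (a \<oplus>\<^bsub>A\<^esub> b) \<in> carrier lift"
      if "a \<in> carrier A" "b \<in> carrier A" "\<psi> \<triangleleft>\<^bsub>Homs\<^esub> a \<in> carrier lift" "\<psi> \<triangleleft>\<^bsub>Homs\<^esub> b \<in> carrier lift"
      for a b
      using lift_add_closed[OF that(3,4)] Homs.ract_r_distr[OF coind_Homs[OF \<psi>] that(1,2)] by metis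
  qed
  have "\<phi> \<in> add_span Homs E" using assms(1) by (simp add: lift_def)
  then show ?thesis
  proof induction
    case zero
    then show ?case using Homs.zero_ract[OF c] lift_zero_closed by simp
  next
    case (step e z)
    then have "z \<in> carrier Homs" "e \<in> carrier Homs"
      using Homs.M.add_span_carrier[OF E_Homs] coind_Homs by auto
    then have "(e \<oplus>\<^bsub>Homs\<^esub> z) \<triangleleft>\<^bsub>Homs\<^esub> c = e \<triangleleft>\<^bsub>Homs\<^esub> c \<oplus>\<^bsub>Homs\<^esub> z \<triangleleft>\<^bsub>Homs\<^esub> c"
      using Homs.ract_l_distr c by blast
    moreover have "e \<triangleleft>\<^bsub>Homs\<^esub> c \<in> carrier lift" using step(1) 1 by blast
    ultimately show ?case using lift_add_closed step(3) by metis
  qed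
qed

lemma abelian_group_lift: "abelian_group lift"
proof (rule abelian_groupI)
  show "\<exists>\<psi>\<in>carrier lift. \<psi> \<oplus>\<^bsub>lift\<^esub> \<phi> = \<zero>\<^bsub>lift\<^esub>" if "\<phi> \<in> carrier lift" for \<phi>
    using Homs.M.l_neg[OF lift_Homs[OF that]] by (intro bexI[OF _ lift_minus_closed[OF that]]) simp
  show "\<phi> \<oplus>\<^bsub>lift\<^esub> \<psi> \<in> carrier lift" if "\<phi> \<in> carrier lift" "\<psi> \<in> carrier lift" for \<phi> \<psi>
    using lift_add_closed[OF that] by simp
  show "\<phi> \<oplus>\<^bsub>lift\<^esub> \<psi> \<oplus>\<^bsub>lift\<^esub> \<chi> = \<phi> \<oplus>\<^bsub>lift\<^esub> (\<psi> \<oplus>\<^bsub>lift\<^esub> \<chi>)"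
    if "\<phi> \<in> carrier lift" "\<psi> \<in> carrier lift" "\<chi> \<in> carrier lift" for \<phi> \<psi> \<chi>
    using Homs.M.a_assoc[of \<phi> \<psi> \<chi>] that lift_Homs by simp
  show "\<phi> \<oplus>\<^bsub>lift\<^esub> \<psi> = \<psi> \<oplus>\<^bsub>lift\<^esub> \<phi>" if "\<phi> \<in> carrier lift" "\<psi> \<in> carrier lift" for \<phi> \<psi>
    using Homs.M.a_comm[of \<phi> \<psi>] that lift_Homs by simp
  show "\<zero>\<^bsub>lift\<^esub> \<oplus>\<^bsub>lift\<^esub> \<phi> = \<phi>" if "\<phi> \<in> carrier lift" for \<phi>
    using Homs.M.l_zero[of \<phi>] that lift_Homs by simp
  show "\<zero>\<^bsub>lift\<^esub> \<in> carrier lift" using lift_zero_closed by simp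
qed

lemma right_module_lift: "right_module A lift"
proof (intro right_module.intro right_module_axioms.intro)
  show "ring A" by (rule A.ring_axioms)
  show "abelian_group lift" by (rule abelian_group_lift)
  show "\<phi> \<triangleleft>\<^bsub>lift\<^esub> c \<in> carrier lift" if "\<phi> \<in> carrier lift" "c \<in> carrier A" for \<phi> c
    using lift_act_closed[OF that] by (simp only: lift_sel)
qed (auto simp del: Homs_sel
    dest!: lift_Homs simp: Homs.ract_l_distr Homs.ract_r_distr Homs.ract_assoc Homs.ract_one)

sublocale lift: right_module A lift by (rule right_module_lift)

lemma finsum_lift_apply:
  assumes "finite I" "\<And>i. i \<in> I \<Longrightarrow> h i \<in> carrier lift"
  shows "finsum lift h I a = (\<Oplus>\<^bsub>X\<^esub>i\<in>I. h i a)"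
  using assms
proof (induction I)
  case empty
  then show ?case by simp
next
  case (insert i I)
  have "finsum lift h (insert i I) = h i \<oplus>\<^bsub>lift\<^esub> finsum lift h I"
    by (rule lift.M.finsum_insert) (use insert in auto)
  moreover have "(\<Oplus>\<^bsub>X\<^esub>i\<in>insert i I. h i a) = h i a \<oplus>\<^bsub>X\<^esub> (\<Oplus>\<^bsub>X\<^esub>i\<in>I. h i a)"
    by (rule X.M.finsum_insert) (use insert Homs_apply lift_Homs in auto)
  ultimately show ?case using insert by simp
qed

text \<open>At a fixed homogeneous argument of degree i the summands take values in the distinct
  components t + i, so each can be recovered from the sum. This yields independence of the graded
  parts and, at the argument 1, compatibility of evaluation with components.\<close>

lemma hcomp_finsum_coind:
  assumes I: "finite I" and f: "\<And>t. f t \<in> coind_part t" and a: "a \<in> D i"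
  shows "hcomp X V (finsum lift f I a) (t + i) = (if t \<in> I then f t a else \<zero>\<^bsub>X\<^esub>)"
proof -
  have fa: "f t a \<in> V (t + i)" for t using coind_V[OF f a] .
  have "hcomp X V (finsum lift f I a) (t + i) = hcomp X V (\<Oplus>\<^bsub>X\<^esub>t\<in>I. f t a) (t + i)"
    using finsum_lift_apply[OF I, of f a] coind_lift[OF f] by simp
  also have "\<dots> = (\<Oplus>\<^bsub>X\<^esub>t'\<in>I. hcomp X V (f t' a) (t + i))"
    by (rule X.M.hcomp_finsum[OF gX I]) (use fa Vc in auto)
  also have "\<dots> = (\<Oplus>\<^bsub>X\<^esub>t'\<in>I. if t = t' then f t' a else \<zero>\<^bsub>X\<^esub>)"
    by (rule X.M.finsum_cong')
      (use Vc[OF fa] in \<open>auto simp: X.M.hcomp_homogeneous[OF gX fa] split: if_splits\<close>)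
  also have "\<dots> = (if t \<in> I then f t a else \<zero>\<^bsub>X\<^esub>)"
  proof (cases "t \<in> I")
    case True
    then show ?thesis using X.M.finsum_singleton[OF True I, of "\<lambda>t. f t a"] Vc[OF fa] by simp
  next
    case False
    then have "(\<Oplus>\<^bsub>X\<^esub>t'\<in>I. if t = t' then f t' a else \<zero>\<^bsub>X\<^esub>) = (\<Oplus>\<^bsub>X\<^esub>t'\<in>I. \<zero>\<^bsub>X\<^esub>)"
      by (intro X.M.finsum_cong') auto
    then show ?thesis using False by simp
  qed
  finally show ?thesis .
qed

lemma Homs_eqI:
  assumes "\<phi> \<in> carrier Homs" "\<psi> \<in> carrier Homs" "\<And>i a. a \<in> D i \<Longrightarrow> \<phi> a = \<psi> a"
  shows "\<phi> = \<psi>"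
proof
  fix a
  show "\<phi> a = \<psi> a"
  proof (cases "a \<in> carrier A")
    case True
    with gA show ?thesis
    proof (rule A.graded_induct)
      show "\<phi> \<zero>\<^bsub>A\<^esub> = \<psi> \<zero>\<^bsub>A\<^esub>" using assms(3) A.graded_part_zero[OF gA] by blast
    qed (use assms in \<open>auto simp: carrier_Homs\<close>)
  qed (use assms in \<open>simp add: carrier_Homs\<close>)
qed

lemma graded_lift: "graded_by lift coind_part"
proof (rule lift.M.graded_byI)
  fix t
  show "additive_subgroup (coind_part t) lift"
  proof (intro additive_subgroup.intro lift.M.add.subgroupI)
    show "coind_part t \<noteq> {}" using coind_zero by blast
    show "\<ominus>\<^bsub>lift\<^esub> \<phi> \<in> coind_part t" if "\<phi> \<in> coind_part t" for \<phi>
    proof -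
      have "\<ominus>\<^bsub>lift\<^esub> \<phi> = (\<lambda>a. \<ominus>\<^bsub>X\<^esub> \<phi> a)"
        using that coind_lift[OF coind_minus[OF that]] coind_lift[OF that] coind_Homs[OF that]
        by (intro lift.M.minus_equality) (auto simp: Homs_apply X.M.l_neg)
      then show ?thesis using coind_minus[OF that] by simp
    qed
  qed (use coind_lift coind_add in auto)
next
  show "carrier lift \<subseteq> add_span lift E"
    using add_span_cong[of lift Homs E] by (simp add: lift_def Homs_def)
next
  fix f I t
  assume h: "finite I" "\<And>t. f t \<in> coind_part t" "finsum lift f I = \<zero>\<^bsub>lift\<^esub>" "t \<in> I"
  show "f t = \<zero>\<^bsub>lift\<^esub>"
  proof (rule Homs_eqI)
    show "f t a = \<zero>\<^bsub>lift\<^esub> a" if "a \<in> D i" for a i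
      using hcomp_finsum_coind[OF h(1,2) that, of t] h(3,4) X.M.hcomp_zero[OF gX] by simp
  qed (use coind_Homs[OF h(2)] coind_Homs[OF coind_zero] in auto)
qed

lemma graded_right_module_lift: "graded_right_module A lift"
  unfolding graded_right_module_def using right_module_lift graded_lift coind_act by simp

section \<open>Identification of the truncated lift with X by evaluation at 1\<close>

abbreviation "tr \<equiv> mod_trunc A lift S"

lemma carrier_tr: "\<phi> \<in> carrier tr \<longleftrightarrow> \<phi> \<in> carrier lift \<and> hsupp lift coind_part \<phi> \<subseteq> S"
  by (simp add: mod_trunc_def)

lemma tr_sel [simp]: "add tr = add Homs" "\<zero>\<^bsub>tr\<^esub> = (\<lambda>_. \<zero>\<^bsub>X\<^esub>)"
  by (simp_all add: mod_trunc_def)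

lemma tr_add_closed:
  assumes "\<phi> \<in> carrier tr" "\<psi> \<in> carrier tr"
  shows "\<phi> \<oplus>\<^bsub>lift\<^esub> \<psi> \<in> carrier tr"
proof -
  have c: "\<phi> \<in> carrier lift" "\<psi> \<in> carrier lift" using assms by (auto simp: carrier_tr)
  have "hsupp lift coind_part (\<phi> \<oplus>\<^bsub>lift\<^esub> \<psi>) \<subseteq> hsupp lift coind_part \<phi> \<union> hsupp lift coind_part \<psi>"
    unfolding hsupp_def lift.M.hcomp_add[OF graded_lift c] using lift.M.l_zero lift_zero_closed by auto
  then show ?thesis using assms lift.M.a_closed[OF c] by (auto simp: carrier_tr)
qed

lemma coind_tr: "\<phi> \<in> coind_part t \<Longrightarrow> t \<in> S \<Longrightarrow> \<phi> \<in> carrier tr"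
  using coind_lift lift.M.hsupp_homogeneous[OF graded_lift, of \<phi> t] by (auto simp: carrier_tr dest: subsetD)

lemma zero_tr: "(\<lambda>_. \<zero>\<^bsub>X\<^esub>) \<in> carrier tr"
  using lift_zero_closed lift.M.hcomp_zero[OF graded_lift] by (auto simp: carrier_tr hsupp_def)

lemma hcomp_apply_one:
  assumes "\<phi> \<in> carrier lift"
  shows "hcomp X V (\<phi> \<one>\<^bsub>A\<^esub>) t = hcomp lift coind_part \<phi> t \<one>\<^bsub>A\<^esub>"
proof -
  let ?h = "hcomp lift coind_part \<phi>"
  have "hcomp X V (finsum lift ?h (hsupp lift coind_part \<phi>) \<one>\<^bsub>A\<^esub>) (t + 0)
      = (if t \<in> hsupp lift coind_part \<phi> then ?h t \<one>\<^bsub>A\<^esub> else \<zero>\<^bsub>X\<^esub>)"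
    using lift.M.finite_hsupp[OF graded_lift assms] lift.M.hcomp_in[OF graded_lift assms] D_one
    by (rule hcomp_finsum_coind)
  then show ?thesis
    unfolding lift.M.finsum_hcomp[OF graded_lift assms] by (simp add: hsupp_def split: if_splits)
qed

text \<open>On degree i, \<phi>(a) = \<phi>(1 a) is \<open>star t\<close> applied to \<phi>(1) and a
  if t + i lies in \<open>S\<close>; otherwise it is zero with its whole component. The rule at the
  argument 1 is available because t itself lies in \<open>S\<close>.\<close>

lemma coind_determined:
  assumes "t \<in> S" "\<phi> \<in> coind_part t" "\<psi> \<in> coind_part t" "\<phi> \<one>\<^bsub>A\<^esub> = \<psi> \<one>\<^bsub>A\<^esub>"
  shows "\<phi> = \<psi>"
proof (rule Homs_eqI)
  fix i a assume a: "a \<in> D i"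
  have "\<chi> a = star t (\<chi> \<one>\<^bsub>A\<^esub>) a" if "t + i \<in> S" "\<chi> \<in> coind_part t" for \<chi>
    using coind_star[OF that(2) D_one a] assms(1) that(1) Dc[OF a] by simp
  then show "\<phi> a = \<psi> a"
    using assms coind_V[OF _ a] V_outside by (cases "t + i \<in> S") (metis, metis)
qed (use assms coind_Homs in auto)

text \<open>The required map is a \<mapsto> x a. In degrees i with s + i outside \<open>S\<close> it
  is put to zero, the only value that the component of X there allows.\<close>

lemma ex_coind:
  assumes s: "s \<in> S" and x: "x \<in> V s"
  shows "\<exists>\<phi>\<in>coind_part s. \<phi> \<one>\<^bsub>A\<^esub> = x"
proof -
  define h where "h i a = (if s + i \<in> S then star s x a else \<zero>\<^bsub>X\<^esub>)" for i a
  have hV: "h i a \<in> V (s + i)" if "a \<in> D i" for i a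
    using that star_V[OF s _ x that] X.M.graded_part_zero[OF gX] by (simp add: h_def)
  have hc: "h i a \<in> carrier X" if "a \<in> D i" for i a using Vc[OF hV[OF that]] .
  have h0: "h i \<zero>\<^bsub>A\<^esub> = \<zero>\<^bsub>X\<^esub>" for i using star_zero_right[OF s _ x] by (simp add: h_def)
  have hadd: "h i (a \<oplus>\<^bsub>A\<^esub> b) = h i a \<oplus>\<^bsub>X\<^esub> h i b" if "a \<in> D i" "b \<in> D i" for i a b
    using star_add_right[OF s _ x that] by (simp add: h_def)
  define \<phi> where "\<phi> a = (if a \<in> carrier A then homog_extend h a else \<zero>\<^bsub>X\<^esub>)" for a
  have hom: "\<phi> a = h i a" if "a \<in> D i" for i a
    using homog_extend_homogeneous[of h, OF hc h0 that] Dc[OF that] by (simp add: \<phi>_def)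
  have "\<phi> \<in> coind_part s"
  proof (rule coind_partI)
    show "\<phi> \<in> carrier Homs"
      using homog_extend_add[of h, OF hc h0 hadd] hcomp_D hc
      by (auto simp: carrier_Homs \<phi>_def homog_extend_def intro!: X.M.finsum_closed)
    show "\<phi> a \<in> V (s + i)" if "a \<in> D i" for a i using hom[OF that] hV[OF that] by simp
    show "\<phi> (a \<otimes>\<^bsub>A\<^esub> b) = star (s + i) (\<phi> a) b"
      if "a \<in> D i" "b \<in> D j" "s + i \<in> S" "s + i + j \<in> S" for a b i j
      using hom[OF that(1)] hom[OF D_mult[OF that(1,2)]] star_assoc[OF s that(3,4) x that(1,2)] that
      by (simp add: h_def add.assoc)
  qed
  moreover have "\<phi> \<one>\<^bsub>A\<^esub> = x" using hom[OF D_one] s star_one[OF s x] by (simp add: h_def)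
  ultimately show ?thesis by blast
qed

abbreviation "ev \<equiv> \<lambda>\<phi> :: 'a \<Rightarrow> 'x. \<phi> \<one>\<^bsub>A\<^esub>"

text \<open>Evaluation at 1 respects components, so injectivity reduces to
  \<open>coind_determined\<close> and surjectivity to \<open>ex_coind\<close>. Components outside
  \<open>S\<close> vanish on one side by truncation and on the other by
  \<open>V_outside\<close>.\<close>

lemma ev_bij: "bij_betw ev (carrier tr) (carrier X)"
proof (rule bij_betwI')
  fix \<phi> \<psi> assume c: "\<phi> \<in> carrier tr" "\<psi> \<in> carrier tr"
  then have l: "\<phi> \<in> carrier lift" "\<psi> \<in> carrier lift" by (auto simp: carrier_tr)
  have "\<phi> = \<psi>" if e: "\<phi> \<one>\<^bsub>A\<^esub> = \<psi> \<one>\<^bsub>A\<^esub>"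
  proof -
    have "hcomp lift coind_part \<phi> t = hcomp lift coind_part \<psi> t" for t
    proof (cases "t \<in> S")
      case True
      have "hcomp lift coind_part \<phi> t \<one>\<^bsub>A\<^esub> = hcomp lift coind_part \<psi> t \<one>\<^bsub>A\<^esub>"
        using hcomp_apply_one[OF l(1)] hcomp_apply_one[OF l(2)] e by metis
      with coind_determined[OF True] lift.M.hcomp_in[OF graded_lift] l show ?thesis by blast
    next
      case False
      then have "t \<notin> hsupp lift coind_part \<phi>" "t \<notin> hsupp lift coind_part \<psi>"
        using c by (auto simp: carrier_tr dest: subsetD)
      then show ?thesis by (simp add: hsupp_def)
    qed
    then have "hcomp lift coind_part \<phi> = hcomp lift coind_part \<psi>" by blast
    then show ?thesis
      using lift.M.finsum_hcomp[OF graded_lift] l unfolding hsupp_def by metis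
  qed
  then show "\<phi> \<one>\<^bsub>A\<^esub> = \<psi> \<one>\<^bsub>A\<^esub> \<longleftrightarrow> \<phi> = \<psi>" by blast
  show "\<phi> \<one>\<^bsub>A\<^esub> \<in> carrier X" using l lift_Homs Homs_apply by blast
next
  fix x assume "x \<in> carrier X"
  with gX have "\<exists>\<phi>\<in>carrier tr. \<phi> \<one>\<^bsub>A\<^esub> = x"
  proof (rule X.M.graded_induct)
    show "\<exists>\<phi>\<in>carrier tr. \<phi> \<one>\<^bsub>A\<^esub> = \<zero>\<^bsub>X\<^esub>"
      by (rule bexI[OF _ zero_tr]) simp
    show "\<exists>\<phi>\<in>carrier tr. \<phi> \<one>\<^bsub>A\<^esub> = y" if "y \<in> V s" for y s
    proof (cases "s \<in> S")
      case True
      then show ?thesis using ex_coind[OF True that] coind_tr by blast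
    next
      case False
      then show ?thesis using V_outside[OF False that] by (intro bexI[OF _ zero_tr]) simp
    qed
    fix y z assume "\<exists>\<phi>\<in>carrier tr. \<phi> \<one>\<^bsub>A\<^esub> = y" "\<exists>\<phi>\<in>carrier tr. \<phi> \<one>\<^bsub>A\<^esub> = z"
    then obtain \<phi> \<psi> where h: "\<phi> \<in> carrier tr" "\<phi> \<one>\<^bsub>A\<^esub> = y" "\<psi> \<in> carrier tr" "\<psi> \<one>\<^bsub>A\<^esub> = z"
      by blast
    have "(\<phi> \<oplus>\<^bsub>lift\<^esub> \<psi>) \<one>\<^bsub>A\<^esub> = y \<oplus>\<^bsub>X\<^esub> z" using h by simp
    then show "\<exists>\<phi>\<in>carrier tr. \<phi> \<one>\<^bsub>A\<^esub> = y \<oplus>\<^bsub>X\<^esub> z" using tr_add_closed[OF h(1,3)] by blast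
  qed
  then show "\<exists>\<phi>\<in>carrier tr. x = \<phi> \<one>\<^bsub>A\<^esub>" by blast
qed

text \<open>The truncated product is compared term by term. If i + j lies in \<open>S\<close>, the
  term evaluates to \<open>star\<close>, which is the given action as j \<in> U; otherwise the term
  is truncated and the corresponding product in X lies in a zero component.\<close>

lemma ev_act:
  assumes \<phi>: "\<phi> \<in> carrier tr" and b: "b \<in> carrier B"
  shows "\<phi> \<triangleleft>\<^bsub>tr\<^esub> b \<in> carrier tr" "(\<phi> \<triangleleft>\<^bsub>tr\<^esub> b) \<one>\<^bsub>A\<^esub> = \<phi> \<one>\<^bsub>A\<^esub> \<triangleleft>\<^bsub>X\<^esub> b"
proof -
  let ?P = "hcomp lift coind_part \<phi>" and ?I = "hsupp lift coind_part \<phi>"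
  let ?b = "hcomp A D b" and ?J = "hsupp A D b"
  let ?t = "\<lambda>i j. if i + j \<in> S then ?P i \<triangleleft>\<^bsub>lift\<^esub> ?b j else \<zero>\<^bsub>lift\<^esub>"
  have l: "\<phi> \<in> carrier lift" and IS: "?I \<subseteq> S" using \<phi> by (auto simp: carrier_tr)
  have bA: "b \<in> carrier A" and JU: "?J \<subseteq> U" using b by (auto simp: B_carrier)
  have fI: "finite ?I" by (rule lift.M.finite_hsupp[OF graded_lift l])
  have fJ: "finite ?J" by (rule A.finite_hsupp[OF gA bA])
  have P: "?P i \<in> coind_part i" for i by (rule lift.M.hcomp_in[OF graded_lift l])
  have bD: "?b j \<in> D j" for j by (rule hcomp_D[OF bA])
  have t_tr: "?t i j \<in> carrier tr" for i j
    using coind_tr[OF coind_act[OF P bD, of i j]] zero_tr by (simp del: Homs_sel)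
  have tr_lift: "\<psi> \<in> carrier lift" if "\<psi> \<in> carrier tr" for \<psi> using that by (simp add: carrier_tr)
  have eq: "\<phi> \<triangleleft>\<^bsub>tr\<^esub> b = finsum lift (\<lambda>i. finsum lift (?t i) ?J) ?I"
    by (simp add: mod_trunc_def cong: if_cong)
  have tr_sum: "finsum lift h I \<in> carrier tr" if "finite I" "\<And>i. i \<in> I \<Longrightarrow> h i \<in> carrier tr"
    for h :: "int \<Rightarrow> 'a \<Rightarrow> 'x" and I
    by (rule lift.M.finsum_induct[OF that(1), where P = "\<lambda>z. z \<in> carrier tr"])
      (use that tr_lift zero_tr tr_add_closed in auto)
  have inner: "finsum lift (?t i) ?J \<in> carrier tr" for i
    by (rule tr_sum[OF fJ]) (rule t_tr)
  show "\<phi> \<triangleleft>\<^bsub>tr\<^esub> b \<in> carrier tr" unfolding eq by (rule tr_sum[OF fI]) (rule inner)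
  have P1: "?P i \<one>\<^bsub>A\<^esub> \<in> V i" for i using coind_V[OF P D_one, of i] by simp
  have summand: "?t i j \<one>\<^bsub>A\<^esub> = ?P i \<one>\<^bsub>A\<^esub> \<triangleleft>\<^bsub>X\<^esub> ?b j" if "i \<in> ?I" "j \<in> ?J" for i j
  proof (cases "i + j \<in> S")
    case True
    have i: "i \<in> S" "j \<in> U" using that IS JU by auto
    have "?t i j \<one>\<^bsub>A\<^esub> = ?P i (\<one>\<^bsub>A\<^esub> \<otimes>\<^bsub>A\<^esub> ?b j)" using True Dc[OF bD] by simp
    also have "\<dots> = star i (?P i \<one>\<^bsub>A\<^esub>) (?b j)"
      using coind_star[OF P D_one bD, of i j] i True by simp
    also have "\<dots> = ?P i \<one>\<^bsub>A\<^esub> \<triangleleft>\<^bsub>X\<^esub> ?b j"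
      by (rule star_act[OF i True P1 bD])
    finally show ?thesis .
  next
    case False
    have "?P i \<one>\<^bsub>A\<^esub> \<triangleleft>\<^bsub>X\<^esub> ?b j \<in> V (i + j)" using V_act[OF P1 bD] that JU by blast
    then show ?thesis using V_outside[OF False] False by simp
  qed
  have bB: "?b j \<in> carrier B" if "j \<in> ?J" for j by (rule hcomp_B[OF b that])
  \<comment> \<open>X is a module over \<open>B\<close>, so the decomposition of \<open>b\<close>
    found in \<open>A\<close> must be read as a sum in \<open>B\<close> before the action is
    distributed over it.\<close>
  have b_sum: "b = finsum B ?b ?J"
    using finsum_B[OF fJ, of ?b] bB A.finsum_hcomp[OF gA bA] by simp
  have "(\<phi> \<triangleleft>\<^bsub>tr\<^esub> b) \<one>\<^bsub>A\<^esub> = (\<Oplus>\<^bsub>X\<^esub>i\<in>?I. finsum lift (?t i) ?J \<one>\<^bsub>A\<^esub>)"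
    unfolding eq by (rule finsum_lift_apply[OF fI tr_lift[OF inner]])
  also have "\<dots> = (\<Oplus>\<^bsub>X\<^esub>i\<in>?I. \<Oplus>\<^bsub>X\<^esub>j\<in>?J. ?t i j \<one>\<^bsub>A\<^esub>)"
    by (simp only: finsum_lift_apply[OF fJ tr_lift[OF t_tr]])
  also have "\<dots> = (\<Oplus>\<^bsub>X\<^esub>i\<in>?I. \<Oplus>\<^bsub>X\<^esub>j\<in>?J. ?P i \<one>\<^bsub>A\<^esub> \<triangleleft>\<^bsub>X\<^esub> ?b j)"
    by (intro X.M.finsum_cong' X.M.finsum_closed Pi_I refl) (use summand Vc[OF P1] bB X.ract_closed in auto)
  also have "\<dots> = (\<Oplus>\<^bsub>X\<^esub>i\<in>?I. ?P i \<one>\<^bsub>A\<^esub> \<triangleleft>\<^bsub>X\<^esub> b)"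
  proof (rule X.M.finsum_cong')
    show "(\<Oplus>\<^bsub>X\<^esub>j\<in>?J. ?P i \<one>\<^bsub>A\<^esub> \<triangleleft>\<^bsub>X\<^esub> ?b j) = ?P i \<one>\<^bsub>A\<^esub> \<triangleleft>\<^bsub>X\<^esub> b" for i
      using X.ract_finsum[OF fJ, of ?b, OF bB Vc[OF P1[of i]]] b_sum[symmetric] by simp
  qed (use Vc[OF P1] b X.ract_closed in auto)
  also have "\<dots> = (\<Oplus>\<^bsub>X\<^esub>i\<in>?I. ?P i \<one>\<^bsub>A\<^esub>) \<triangleleft>\<^bsub>X\<^esub> b"
    by (rule X.finsum_ract[OF fI, of "\<lambda>i. ?P i \<one>\<^bsub>A\<^esub>", OF Vc[OF P1] b, symmetric])
  also have "(\<Oplus>\<^bsub>X\<^esub>i\<in>?I. ?P i \<one>\<^bsub>A\<^esub>) = finsum lift ?P ?I \<one>\<^bsub>A\<^esub>"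
    by (rule finsum_lift_apply[OF fI, of ?P, OF coind_lift[OF P], symmetric])
  also have "finsum lift ?P ?I = \<phi>" by (rule lift.M.finsum_hcomp[OF graded_lift l])
  finally show "(\<phi> \<triangleleft>\<^bsub>tr\<^esub> b) \<one>\<^bsub>A\<^esub> = \<phi> \<one>\<^bsub>A\<^esub> \<triangleleft>\<^bsub>X\<^esub> b" .
qed

text \<open>\<open>graded_isos\<close> asks for a map out of X, hence the inverse of evaluation. The
  coinduced lift consists of functions, and \<open>liftable_if_lift_in_any_type\<close> replaces it
  by a lift over the type fixed in \<open>liftable\<close>.\<close>

lemma liftable: "liftable A S U X"
proof (rule liftable_if_lift_in_any_type[OF A X graded_right_module_lift])
  let ?f = "inv_into (carrier tr) ev"
  have inj: "inj_on ev (carrier tr)" and im: "ev ` carrier tr = carrier X"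
    using ev_bij by (auto simp: bij_betw_def)
  have f: "?f x \<in> carrier tr" "?f x \<one>\<^bsub>A\<^esub> = x" if "x \<in> carrier X" for x
    using that inv_into_into[of x ev "carrier tr"] f_inv_into_f[of x ev "carrier tr"] im by auto
  have f_eq: "?f x = \<phi>" if "\<phi> \<in> carrier tr" "\<phi> \<one>\<^bsub>A\<^esub> = x" for x \<phi>
    using inv_into_f_f[OF inj that(1)] that(2) by simp
  have "?f x \<in> mod_part tr i" if x: "x \<in> V i" for x i
  proof (cases "i \<in> S")
    case True
    obtain \<phi> where "\<phi> \<in> coind_part i" "\<phi> \<one>\<^bsub>A\<^esub> = x" using ex_coind[OF True x] by blast
    then show ?thesis using f_eq[of \<phi> x] coind_tr True by (simp add: mod_trunc_def)
  next
    case False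
    then show ?thesis using f_eq[OF zero_tr] V_outside[OF False x] by (simp add: mod_trunc_def)
  qed
  moreover have "?f (x \<oplus>\<^bsub>X\<^esub> y) = ?f x \<oplus>\<^bsub>tr\<^esub> ?f y" if "x \<in> carrier X" "y \<in> carrier X" for x y
    using f[OF that(1)] f[OF that(2)] tr_add_closed by (intro f_eq) auto
  moreover have "?f (x \<triangleleft>\<^bsub>X\<^esub> b) = ?f x \<triangleleft>\<^bsub>tr\<^esub> b" if "x \<in> carrier X" "b \<in> carrier B" for x b
    using f[OF that(1)] ev_act[OF f(1) that(2)] that by (intro f_eq) auto
  ultimately show "?f \<in> graded_isos B X tr"
    using bij_betw_inv_into[OF ev_bij] by (auto simp: graded_isos_def)
qed

end


section \<open>Extending the action\<close>

text \<open>This turns a condition s + i \<in> S into s + i - m \<in> U, the condition for products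
  of degree s + i - m to act on X_m.\<close>

lemma mem_colon_iff: "m \<in> colon S U \<Longrightarrow> s \<in> S \<longleftrightarrow> s - m \<in> U"
  unfolding colon_def by (force simp: image_iff)

locale colon_generated = truncated_module K A U X
  for K :: "'k ring" and A :: "('k, 'a) graded_algebra" and U :: "int set"
    and X :: "('a, 'x) graded_right_module" +
  fixes S :: "int set"
  assumes gen: "mod_generated_in_degrees (alg_trunc A U) X (colon S U)"
begin

lemma B_span:
  assumes "b \<in> carrier B"
  shows "b \<in> add_span A (\<Union>u\<in>U. D u)"
proof -
  have b: "b \<in> carrier A" "hsupp A D b \<subseteq> U" using assms by (auto simp: B_carrier)
  have E: "(\<Union>u\<in>U. D u) \<subseteq> carrier A" using Dc by blast
  have "finsum A (hcomp A D b) (hsupp A D b) \<in> add_span A (\<Union>u\<in>U. D u)"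
    by (rule A.finsum_induct[OF A.finite_hsupp[OF gA b(1)], where P = "\<lambda>z. z \<in> add_span A (\<Union>u\<in>U. D u)"])
      (use b hcomp_D[OF b(1)] Dc A.add_span_incl A.add_span_add[OF E] add_span.zero in \<open>blast+\<close>)
  then show ?thesis by (simp add: A.finsum_hcomp[OF gA b(1)])
qed

text \<open>A list \<open>L\<close> in \<open>reps s\<close> is an explicit element of the sum of the
  \<open>X\<^sub>m \<otimes> A\<^sub>s\<^sub>-\<^sub>m\<close> over \<open>m \<in> (S : U)\<close>.\<close>

definition reps :: "int \<Rightarrow> ('x \<times> 'a) list set" where
  "reps s = {L. \<forall>p\<in>set L. \<exists>m\<in>colon S U. s - m \<in> U \<and> fst p \<in> V m \<and> snd p \<in> D (s - m)}"

lemma reps_simps [simp]: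
  "[] \<in> reps s"
  "p # L \<in> reps s \<longleftrightarrow> (\<exists>m\<in>colon S U. s - m \<in> U \<and> fst p \<in> V m \<and> snd p \<in> D (s - m)) \<and> L \<in> reps s"
  "L @ L' \<in> reps s \<longleftrightarrow> L \<in> reps s \<and> L' \<in> reps s"
  by (auto simp: reps_def)

lemma reps_carrier: "L \<in> reps s \<Longrightarrow> set L \<subseteq> carrier X \<times> carrier B"
  unfolding reps_def using Vc D_B by (force simp: mem_Times_iff)

lemma reps_V: "L \<in> reps s \<Longrightarrow> act_sum X L \<in> V s"
proof (induction L)
  case Nil
  then show ?case by (simp add: X.M.graded_part_zero[OF gX])
next
  case (Cons p L)
  then obtain m where "s - m \<in> U" "fst p \<in> V m" "snd p \<in> D (s - m)" by auto
  then have "fst p \<triangleleft>\<^bsub>X\<^esub> snd p \<in> V s" using V_act[of "fst p" m "snd p" "s - m"] by simp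
  then show ?case using Cons by (simp add: X.M.graded_part_add[OF gX])
qed

lemma single_reps: "m \<in> colon S U \<Longrightarrow> s - m \<in> U \<Longrightarrow> set L \<subseteq> V m \<times> D (s - m) \<Longrightarrow> L \<in> reps s"
  unfolding reps_def by force

text \<open>The degree i of \<open>b\<close> may lie outside U. What matters is that each product a
  b has degree s + i - m, which is in U because s + i \<in> S.\<close>

lemma reps_times_right:
  assumes s: "s + i \<in> S" and L: "L \<in> reps s" and b: "b \<in> D i"
  shows "times_right A b L \<in> reps (s + i)"
  using L
proof (induction L)
  case (Cons p L)
  then obtain m where m: "m \<in> colon S U" "fst p \<in> V m" "snd p \<in> D (s - m)" by auto
  then have "snd p \<otimes>\<^bsub>A\<^esub> b \<in> D (s + i - m)" using D_mult[OF m(3) b] by (simp add: algebra_simps)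
  moreover have "s + i - m \<in> U" using mem_colon_iff[OF m(1)] s by blast
  ultimately show ?case using Cons m by auto
qed simp

lemma reps_minus: "L \<in> reps s \<Longrightarrow> map (\<lambda>p. (\<ominus>\<^bsub>X\<^esub> fst p, snd p)) L \<in> reps s"
  unfolding reps_def using X.M.graded_part_neg[OF gX] by fastforce

text \<open>The sums of products x a with x in X_m, m \<in> (S : U), and a homogeneous in
  \<open>B\<close> form a submodule containing the generating components, hence equal X. The
  degree-s terms of such a sum form the list sought.\<close>

lemma ex_reps:
  assumes x: "x \<in> V s"
  shows "\<exists>L\<in>reps s. act_sum X L = x"
proof -
  define E where "E = {x \<triangleleft>\<^bsub>X\<^esub> a | x a m u. m \<in> colon S U \<and> u \<in> U \<and> x \<in> V m \<and> a \<in> D u}"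
  let ?N = "add_span X E"
  have Ec: "E \<subseteq> carrier X" using Vc D_B X.ract_closed by (auto simp: E_def)
  have Eneg: "\<ominus>\<^bsub>X\<^esub> e \<in> E" if "e \<in> E" for e
  proof -
    obtain x a m u where e: "e = x \<triangleleft>\<^bsub>X\<^esub> a" "m \<in> colon S U" "u \<in> U" "x \<in> V m" "a \<in> D u"
      using \<open>e \<in> E\<close> by (auto simp: E_def)
    then have "\<ominus>\<^bsub>X\<^esub> e = (\<ominus>\<^bsub>X\<^esub> x) \<triangleleft>\<^bsub>X\<^esub> a" using X.minus_ract Vc D_B by simp
    then show ?thesis unfolding E_def using e X.M.graded_part_neg[OF gX] by blast
  qed
  have Nc: "?N \<subseteq> carrier X" by (rule X.M.add_span_carrier[OF Ec])
  have V_B: "x \<triangleleft>\<^bsub>X\<^esub> c \<in> ?N" if x: "x \<in> V m" and m: "m \<in> colon S U" and c: "c \<in> carrier B" for x m c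
  proof -
    have "c \<in> carrier B \<and> x \<triangleleft>\<^bsub>X\<^esub> c \<in> ?N" using B_span[OF c]
    proof induction
      case zero
      then show ?case using X.ract_zero[OF Vc[OF x]] add_span.zero[of X E] X.R.zero_closed by simp
    next
      case (step e z)
      then obtain u where u: "u \<in> U" "e \<in> D u" by blast
      have "x \<triangleleft>\<^bsub>X\<^esub> e \<in> E" unfolding E_def using x m u by blast
      moreover have eB: "e \<in> carrier B" using D_B u by blast
      moreover have "x \<triangleleft>\<^bsub>X\<^esub> (e \<oplus>\<^bsub>A\<^esub> z) = x \<triangleleft>\<^bsub>X\<^esub> e \<oplus>\<^bsub>X\<^esub> x \<triangleleft>\<^bsub>X\<^esub> z"
        using act_add_right[OF Vc[OF x]] step eB by blast
      moreover have "e \<oplus>\<^bsub>A\<^esub> z \<in> carrier B" using X.R.a_closed[of e z] eB step by simp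
      ultimately show ?case using step add_span.step by metis
    qed
    then show ?thesis by blast
  qed
  have N_act: "z \<triangleleft>\<^bsub>X\<^esub> b \<in> ?N" if z: "z \<in> ?N" and b: "b \<in> carrier B" for z b
    using z
  proof induction
    case zero
    then show ?case using X.zero_ract[OF b] add_span.zero[of X E] by simp
  next
    case (step e z)
    obtain x a m u where e: "e = x \<triangleleft>\<^bsub>X\<^esub> a" "m \<in> colon S U" "u \<in> U" "x \<in> V m" "a \<in> D u"
      using step(1) by (auto simp: E_def)
    \<comment> \<open>With the product of \<open>B\<close> associativity holds without a degree
      condition, and \<open>V_B\<close> accepts any factor in \<open>B\<close>.\<close>
    have "e \<triangleleft>\<^bsub>X\<^esub> b = x \<triangleleft>\<^bsub>X\<^esub> (a \<otimes>\<^bsub>B\<^esub> b)"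
      using X.ract_assoc[of x a b] e Vc D_B b by simp
    then have "e \<triangleleft>\<^bsub>X\<^esub> b \<in> ?N" using V_B[OF e(4,2)] X.R.m_closed D_B e b by simp
    moreover have "(e \<oplus>\<^bsub>X\<^esub> z) \<triangleleft>\<^bsub>X\<^esub> b = e \<triangleleft>\<^bsub>X\<^esub> b \<oplus>\<^bsub>X\<^esub> z \<triangleleft>\<^bsub>X\<^esub> b"
      using X.ract_l_distr[of e z b] step Ec Nc b by blast
    ultimately show ?case using step X.M.add_span_add[OF Ec] by metis
  qed
  have "right_submodule B X ?N"
    unfolding right_submodule_def using X.M.add_span_subgroup[OF Ec Eneg] N_act by blast
  moreover have "y \<in> ?N" if "m \<in> colon S U" "y \<in> V m" for m y
    using V_B[OF that(2,1) X.R.one_closed] act_one Vc that by simp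
  ultimately have "?N = carrier X" using gen unfolding mod_generated_in_degrees_def by blast
  then have "x \<in> ?N" using Vc[OF x] by simp
  then have "\<exists>L\<in>reps s. act_sum X L = hcomp X V x s"
  proof induction
    case zero
    show ?case by (rule bexI[of _ "[]"]) (simp_all add: X.M.hcomp_zero[OF gX])
  next
    case (step e z)
    obtain y a m u where e: "e = y \<triangleleft>\<^bsub>X\<^esub> a" "m \<in> colon S U" "u \<in> U" "y \<in> V m" "a \<in> D u"
      using step(1) by (auto simp: E_def)
    obtain L where L: "L \<in> reps s" "act_sum X L = hcomp X V z s" using step by blast
    have ec: "e \<in> V (m + u)" using V_act e by simp
    have c: "e \<in> carrier X" "z \<in> carrier X" "hcomp X V z s \<in> carrier X"
      using Vc[OF ec] step Nc Vc[OF X.M.hcomp_in[OF gX]] by auto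
    have h: "hcomp X V (e \<oplus>\<^bsub>X\<^esub> z) s = (if s = m + u then e else \<zero>\<^bsub>X\<^esub>) \<oplus>\<^bsub>X\<^esub> hcomp X V z s"
      by (simp add: X.M.hcomp_add[OF gX c(1,2)] X.M.hcomp_homogeneous[OF gX ec])
    show ?case
    proof (cases "s = m + u")
      case True
      then have "\<exists>m\<in>colon S U. s - m \<in> U \<and> y \<in> V m \<and> a \<in> D (s - m)"
        using e by (intro bexI[OF _ e(2)]) simp
      then have "(y, a) # L \<in> reps s" using L by simp
      moreover have "act_sum X ((y, a) # L) = hcomp X V (e \<oplus>\<^bsub>X\<^esub> z) s" using True h L e by simp
      ultimately show ?thesis by blast
    next
      case False
      then show ?thesis using h L c by auto
    qed
  qed
  then show ?thesis by (simp add: X.M.hcomp_homogeneous[OF gX x])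
qed

text \<open>A pair in a list of \<open>reps s\<close> would give s - m \<in> U and thus s \<in> S,
  so the empty list is the only representation.\<close>

lemma V_outside_S:
  assumes s: "s \<notin> S" and x: "x \<in> V s"
  shows "x = \<zero>\<^bsub>X\<^esub>"
proof -
  obtain L where L: "L \<in> reps s" "act_sum X L = x" using ex_reps[OF x] by blast
  have "L = []"
    using L(1) s mem_colon_iff by (cases L) auto
  then show ?thesis using L by simp
qed

lemma act_sum_times_add:
  assumes s: "s + i \<in> S" and L: "L \<in> reps s" and b: "b \<in> D i" "c \<in> D i"
  shows "act_sum X (times_right A (b \<oplus>\<^bsub>A\<^esub> c) L)
    = act_sum X (times_right A b L) \<oplus>\<^bsub>X\<^esub> act_sum X (times_right A c L)"
  using L
proof (induction L)
  case Nil
  then show ?case by simp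
next
  case (Cons p L)
  then obtain m where m: "m \<in> colon S U" "fst p \<in> V m" "snd p \<in> D (s - m)" by auto
  have "s + i - m \<in> U" using mem_colon_iff[OF m(1)] s by blast
  then have e: "snd p \<otimes>\<^bsub>A\<^esub> b \<in> carrier B" "snd p \<otimes>\<^bsub>A\<^esub> c \<in> carrier B"
    using D_B D_mult[OF m(3) b(1)] D_mult[OF m(3) b(2)] by (simp_all add: algebra_simps)
  have x: "fst p \<in> carrier X" using Vc[OF m(2)] .
  have d: "snd p \<otimes>\<^bsub>A\<^esub> (b \<oplus>\<^bsub>A\<^esub> c) = snd p \<otimes>\<^bsub>A\<^esub> b \<oplus>\<^bsub>A\<^esub> snd p \<otimes>\<^bsub>A\<^esub> c"
    using Dc m b by (simp add: A.r_distr)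
  have "act_sum X (times_right A b L) \<in> carrier X" "act_sum X (times_right A c L) \<in> carrier X"
    using Cons Vc[OF reps_V[OF reps_times_right[OF s _ b(1)]]]
      Vc[OF reps_V[OF reps_times_right[OF s _ b(2)]]] by auto
  then show ?case
    using Cons X.ract_closed[OF x e(1)] X.ract_closed[OF x e(2)]
    by (simp add: d act_add_right[OF x e] X.M.a_ac)
qed

lemma times_right_one: "L \<in> reps s \<Longrightarrow> times_right A \<one>\<^bsub>A\<^esub> L = L"
  using reps_carrier B_carrier by (intro map_idI) (force simp: mem_Times_iff)

lemma times_right_mult:
  assumes "L \<in> reps s" "b \<in> carrier A" "c \<in> carrier A"
  shows "times_right A c (times_right A b L) = times_right A (b \<otimes>\<^bsub>A\<^esub> c) L"
  using reps_carrier[OF assms(1)] assms(2,3) B_carrier by (auto simp: A.m_assoc)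

text \<open>On the pairs of \<open>L\<close> the products of \<open>A\<close> and \<open>B\<close>
  agree: s + u \<in> S places every degree s - m + u in U.\<close>

lemma act_sum_times_B:
  assumes s: "s \<in> S" "s + u \<in> S" and u: "u \<in> U" and L: "L \<in> reps s" and b: "b \<in> D u"
  shows "act_sum X (times_right A b L) = act_sum X L \<triangleleft>\<^bsub>X\<^esub> b"
proof -
  have "snd p \<otimes>\<^bsub>B\<^esub> b = snd p \<otimes>\<^bsub>A\<^esub> b" if "p \<in> set L" for p
  proof -
    have "\<forall>p\<in>set L. \<exists>m\<in>colon S U. s - m \<in> U \<and> fst p \<in> V m \<and> snd p \<in> D (s - m)"
      using L by (simp add: reps_def)
    from bspec[OF this that] obtain m where m: "m \<in> colon S U" "snd p \<in> D (s - m)" by blast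
    have "s + u - m \<in> U" using mem_colon_iff[OF m(1)] s(2) by blast
    then have "s - m + u \<in> U" by (simp add: algebra_simps)
    then show ?thesis using B_mult[OF m(2) b] by simp
  qed
  then have "times_right B b L = times_right A b L" by simp
  then show ?thesis using X.act_sum_ract[OF reps_carrier[OF L] D_B[OF b u]] by (simp only:)
qed

end

text \<open>In a coherent module a relation \<open>\<Sum> x\<^sub>k a\<^sub>k = 0\<close> implies \<open>\<Sum> x\<^sub>k (a\<^sub>k b) = 0\<close>,
  so that \<open>\<Sum> x\<^sub>k a\<^sub>k \<mapsto> \<Sum> x\<^sub>k (a\<^sub>k b)\<close> is a well-defined action.\<close>

locale coherent_module = colon_generated K A U X S
  for K :: "'k ring" and A :: "('k, 'a) graded_algebra" and U :: "int set"
    and X :: "('a, 'x) graded_right_module" and S :: "int set" +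
  assumes coherent: "\<lbrakk>s \<in> S; s + i \<in> S; L \<in> reps s; act_sum X L = \<zero>\<^bsub>X\<^esub>; b \<in> D i\<rbrakk> \<Longrightarrow>
    act_sum X (times_right A b L) = \<zero>\<^bsub>X\<^esub>"
begin

definition star :: "int \<Rightarrow> 'x \<Rightarrow> 'a \<Rightarrow> 'x" where
  "star s x b = act_sum X (times_right A b (SOME L. L \<in> reps s \<and> act_sum X L = x))"

text \<open>Appending the negative of one representing list to another gives a relation; coherence
  keeps it a relation after multiplication by \<open>b\<close>, so the chosen list may be replaced
  by any other.\<close>

lemma star_eq:
  assumes s: "s \<in> S" "s + i \<in> S" and L: "L \<in> reps s" and b: "b \<in> D i"
  shows "star s (act_sum X L) b = act_sum X (times_right A b L)"
proof -
  define L' where "L' = (SOME L'. L' \<in> reps s \<and> act_sum X L' = act_sum X L)"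
  have L': "L' \<in> reps s" "act_sum X L' = act_sum X L"
    unfolding L'_def using L by (metis (mono_tags, lifting) someI_ex)+
  let ?n = "map (\<lambda>p. (\<ominus>\<^bsub>X\<^esub> fst p, snd p)) L"
  have n: "?n \<in> reps s" by (rule reps_minus[OF L])
  have c: "act_sum X L \<in> carrier X" using Vc[OF reps_V[OF L]] .
  have "act_sum X (L' @ ?n) = \<zero>\<^bsub>X\<^esub>"
    using X.act_sum_append[OF reps_carrier[OF L'(1)] reps_carrier[OF n]]
      X.act_sum_minus[OF reps_carrier[OF L]] L' c X.M.r_neg by simp
  then have z: "act_sum X (times_right A b (L' @ ?n)) = \<zero>\<^bsub>X\<^esub>"
    using coherent[OF s _ _ b, of "L' @ ?n"] L' n by simp
  have r: "times_right A b L \<in> reps (s + i)" "times_right A b L' \<in> reps (s + i)"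
    using reps_times_right[OF s(2) _ b] L L' by auto
  have tr: "times_right A b (L' @ ?n)
      = times_right A b L' @ map (\<lambda>p. (\<ominus>\<^bsub>X\<^esub> fst p, snd p)) (times_right A b L)" by simp
  have "act_sum X (times_right A b (L' @ ?n))
      = act_sum X (times_right A b L') \<oplus>\<^bsub>X\<^esub> \<ominus>\<^bsub>X\<^esub> act_sum X (times_right A b L)"
    unfolding tr X.act_sum_append[OF reps_carrier[OF r(2)] reps_carrier[OF reps_minus[OF r(1)]]]
      X.act_sum_minus[OF reps_carrier[OF r(1)]] ..
  then have "act_sum X (times_right A b L') = act_sum X (times_right A b L)"
    using X.M.eq_if_add_minus[OF Vc[OF reps_V[OF r(2)]] Vc[OF reps_V[OF r(1)]]] z by metis
  then show ?thesis by (simp add: star_def L'_def)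
qed

text \<open>Every law is read off from a list \<open>L\<close> representing x: sums correspond to
  concatenation, and \<open>times_right A b L\<close> represents \<open>star s x b\<close>, which
  reduces associativity and unit law to those of \<open>A\<close>.\<close>

sublocale partial_module K A U X S star
proof unfold_locales
  note ex = ex_reps
  show "x = \<zero>\<^bsub>X\<^esub>" if "s \<notin> S" "x \<in> V s" for s x using V_outside_S that .
  fix s i x b assume s: "s \<in> S" "s + i \<in> S" and x: "x \<in> V s" and b: "b \<in> D i"
  obtain L where L: "L \<in> reps s" "act_sum X L = x" using ex[OF x] by blast
  have sb: "star s x c = act_sum X (times_right A c L)" if "s + j \<in> S" "c \<in> D j" for c j
    using star_eq[OF s(1) that(1) L(1) that(2)] L by simp
  have rb: "times_right A b L \<in> reps (s + i)" by (rule reps_times_right[OF s(2) L(1) b])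
  show "star s x b \<in> V (s + i)" using reps_V[OF rb] sb[OF s(2) b] by simp
  show "star s (x \<oplus>\<^bsub>X\<^esub> y) b = star s x b \<oplus>\<^bsub>X\<^esub> star s y b" if y: "y \<in> V s" for y
  proof -
    obtain L' where L': "L' \<in> reps s" "act_sum X L' = y" using ex[OF y] by blast
    have r': "times_right A b L' \<in> reps (s + i)" by (rule reps_times_right[OF s(2) L'(1) b])
    have "act_sum X (L @ L') = x \<oplus>\<^bsub>X\<^esub> y"
      using X.act_sum_append[OF reps_carrier[OF L(1)] reps_carrier[OF L'(1)]] L L' by simp
    then show ?thesis
      using star_eq[OF s _ b, of "L @ L'"] star_eq[OF s L'(1) b] sb[OF s(2) b] L L'
        X.act_sum_append[OF reps_carrier[OF rb] reps_carrier[OF r']] by simp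
  qed
  show "star s x (b \<oplus>\<^bsub>A\<^esub> c) = star s x b \<oplus>\<^bsub>X\<^esub> star s x c" if c: "c \<in> D i" for c
    using sb[OF s(2)] b c A.graded_part_add[OF gA b c] act_sum_times_add[OF s(2) L(1) b c] by simp
  show "star (s + i) (star s x b) c = star s x (b \<otimes>\<^bsub>A\<^esub> c)" if "s + i + j \<in> S" "c \<in> D j" for j c
  proof -
    have "star (s + i) (star s x b) c = act_sum X (times_right A c (times_right A b L))"
      using star_eq[OF s(2) that(1) rb that(2)] sb[OF s(2) b] by simp
    also have "\<dots> = act_sum X (times_right A (b \<otimes>\<^bsub>A\<^esub> c) L)"
      by (simp only: times_right_mult[OF L(1) Dc[OF b] Dc[OF that(2)]])
    also have "\<dots> = star s x (b \<otimes>\<^bsub>A\<^esub> c)"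
      using sb[OF _ D_mult[OF b that(2)]] that(1) by (simp add: add.assoc)
    finally show ?thesis .
  qed
next
  fix s x assume s: "s \<in> S" and x: "x \<in> V s"
  obtain L where L: "L \<in> reps s" "act_sum X L = x" using ex_reps[OF x] by blast
  show "star s x \<one>\<^bsub>A\<^esub> = x"
    using star_eq[OF s _ L(1) D_one] times_right_one[OF L(1)] L s by simp
  show "star s x a = x \<triangleleft>\<^bsub>X\<^esub> a" if "u \<in> U" "s + u \<in> S" "a \<in> D u" for u a
    using star_eq[OF s that(2) L(1) that(3)] act_sum_times_B[OF s that(2,1) L(1) that(3)] L by simp
qed

end


section \<open>Periodic truncations\<close>

context truncated_module
begin

text \<open>As s and s + u lie in \<open>S\<close>, the product in M is not cut off by
  \<open>mod_trunc\<close>. Zero factors have empty support and are the separate cases.\<close>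

lemma graded_iso_ract:
  assumes M: "graded_right_module A M" and f: "f \<in> graded_isos B X (mod_trunc A M S)"
    and s: "s \<in> S" "s + u \<in> S" "u \<in> U" and x: "x \<in> V s" and a: "a \<in> D u"
  shows "f x \<in> mod_part M s" "f (x \<triangleleft>\<^bsub>X\<^esub> a) = f x \<triangleleft>\<^bsub>M\<^esub> a"
proof -
  interpret M: right_module A M using M by (simp add: graded_right_module_def)
  have gM: "graded_by M (mod_part M)" using M by (simp add: graded_right_module_def)
  have "f x \<in> mod_part (mod_trunc A M S) s" using f x unfolding graded_isos_def by blast
  then show fx: "f x \<in> mod_part M s" using s(1) by (simp add: mod_trunc_def)
  have fc: "f x \<in> carrier M" "a \<in> carrier A" using M.M.graded_part_carrier[OF gM fx] Dc[OF a] by auto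
  have 0: "hsupp M (mod_part M) \<zero>\<^bsub>M\<^esub> = {}" "hsupp A D \<zero>\<^bsub>A\<^esub> = {}"
    by (auto simp: hsupp_def A.hcomp_zero[OF gA] M.M.hcomp_zero[OF gM])
  have "hsupp M (mod_part M) (f x) = {s} \<or> f x = \<zero>\<^bsub>M\<^esub>" "hsupp A D a = {u} \<or> a = \<zero>\<^bsub>A\<^esub>"
    using fx a by (auto simp: hsupp_def A.hcomp_homogeneous[OF gA] M.M.hcomp_homogeneous[OF gM]
        split: if_splits)
  then have "f x \<triangleleft>\<^bsub>mod_trunc A M S\<^esub> a = f x \<triangleleft>\<^bsub>M\<^esub> a"
    using 0 fc M.ract_closed[OF fc] s M.ract_zero M.zero_ract
    by (elim disjE) (simp_all add: mod_trunc_def M.M.hcomp_homogeneous[OF gM fx] A.hcomp_homogeneous[OF gA a])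
  moreover have "f (x \<triangleleft>\<^bsub>X\<^esub> a) = f x \<triangleleft>\<^bsub>mod_trunc A M S\<^esub> a"
    using f Vc[OF x] D_B[OF a s(3)] by (simp add: graded_isos_def)
  ultimately show "f (x \<triangleleft>\<^bsub>X\<^esub> a) = f x \<triangleleft>\<^bsub>M\<^esub> a" by simp
qed

lemma graded_iso_act_sum:
  assumes M: "graded_right_module A M" and f: "f \<in> graded_isos B X (mod_trunc A M S)"
    and s: "s \<in> S" "s + u \<in> S" "u \<in> U" and L: "set L \<subseteq> V s \<times> D u"
  shows "f (act_sum X L) = act_sum M (map (\<lambda>p. (f (fst p), snd p)) L)"
    and "f (act_sum X L) = \<zero>\<^bsub>M\<^esub> \<longleftrightarrow> act_sum X L = \<zero>\<^bsub>X\<^esub>"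
    and "set (map (\<lambda>p. (f (fst p), snd p)) L) \<subseteq> carrier M \<times> carrier A"
proof -
  interpret M: right_module A M using M by (simp add: graded_right_module_def)
  have add: "f (x \<oplus>\<^bsub>X\<^esub> y) = f x \<oplus>\<^bsub>M\<^esub> f y" if "x \<in> carrier X" "y \<in> carrier X" for x y
    using f that by (simp add: graded_isos_def mod_trunc_def)
  have bij: "bij_betw f (carrier X) (carrier (mod_trunc A M S))" using f by (simp add: graded_isos_def)
  have fc: "f x \<in> carrier M" if "x \<in> carrier X" for x
    using bij_betwE[OF bij] that by (simp add: mod_trunc_def)
  have f0: "f \<zero>\<^bsub>X\<^esub> = \<zero>\<^bsub>M\<^esub>"
    using add[of "\<zero>\<^bsub>X\<^esub>" "\<zero>\<^bsub>X\<^esub>"] fc[of "\<zero>\<^bsub>X\<^esub>"] M.M.add.r_cancel_one by simp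
  show "f (act_sum X L) = act_sum M (map (\<lambda>p. (f (fst p), snd p)) L)"
    using L
  proof (induction L)
    case Nil
    then show ?case by (simp add: f0)
  next
    case (Cons p L)
    then have p: "fst p \<in> V s" "snd p \<in> D u" and L: "set L \<subseteq> V s \<times> D u" by auto
    have "fst p \<triangleleft>\<^bsub>X\<^esub> snd p \<in> carrier X" using Vc[OF V_act[OF p s(3)]] .
    moreover have "act_sum X L \<in> carrier X" using Vc[OF act_sum_V[OF L s(3)]] .
    ultimately show ?case using Cons L graded_iso_ract(2)[OF M f s p] by (simp add: add)
  qed
  have c: "act_sum X L \<in> carrier X" using Vc[OF act_sum_V[OF L s(3)]] .
  show "f (act_sum X L) = \<zero>\<^bsub>M\<^esub> \<longleftrightarrow> act_sum X L = \<zero>\<^bsub>X\<^esub>"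
    using inj_on_eq_iff[OF bij_betw_imp_inj_on[OF bij] c X.M.zero_closed] f0 by simp
  show "set (map (\<lambda>p. (f (fst p), snd p)) L) \<subseteq> carrier M \<times> carrier A"
    using L fc Vc Dc by auto
qed

text \<open>The relation is carried into M, where it may be multiplied by \<open>b\<close> of any
  degree, and the result is carried back by injectivity. The conditions on u + i ensure that the
  products a b act on X and are preserved by the isomorphism.\<close>

lemma liftable_imp_relations:
  assumes "liftable A S U X" and s: "s \<in> S" "s + u \<in> S" "s + (u + i) \<in> S" and u: "u \<in> U" "u + i \<in> U"
    and L: "set L \<subseteq> V s \<times> D u" "act_sum X L = \<zero>\<^bsub>X\<^esub>" and b: "b \<in> D i"
  shows "act_sum X (times_right A b L) = \<zero>\<^bsub>X\<^esub>"
proof -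
  obtain M :: "('a, ('x \<times> 'a) list) graded_right_module" and f where M: "graded_right_module A M"
    and f: "f \<in> graded_isos B X (mod_trunc A M S)"
    using assms(1) unfolding liftable_def by blast
  interpret M: right_module A M using M by (simp add: graded_right_module_def)
  let ?g = "map (\<lambda>p. (f (fst p), snd p))"
  note L1 = graded_iso_act_sum[OF M f s(1,2) u(1) L(1)]
  note L2 = graded_iso_act_sum[OF M f s(1,3) u(2) VD_times_right[OF L(1) b]]
  have "act_sum M (times_right A b (?g L)) = act_sum M (?g L) \<triangleleft>\<^bsub>M\<^esub> b"
    by (rule M.act_sum_ract[OF L1(3) Dc[OF b], symmetric])
  also have "act_sum M (?g L) = \<zero>\<^bsub>M\<^esub>" using L1(1,2) L(2) by metis
  also have "\<zero>\<^bsub>M\<^esub> \<triangleleft>\<^bsub>M\<^esub> b = \<zero>\<^bsub>M\<^esub>" by (rule M.zero_ract[OF Dc[OF b]])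
  also have "times_right A b (?g L) = ?g (times_right A b L)" by simp
  finally show ?thesis using L2(1,2) by metis
qed

lemma liftable_imp_Ker_subset:
  assumes lift: "liftable A S U X" and m: "m \<in> colon S U" and u: "u \<in> U" "v \<in> U"
  shows "Ker_mu_times A X m u (v - u) \<subseteq> Ker_mu A X m v"
proof -
  have S: "m \<in> S" "m + u \<in> S" "m + v \<in> S"
    using mem_colon_iff[OF m] u U0 by auto
  have "Ker_mu_times A X m u (v - u) \<subseteq> Ker_mu A X m (u + (v - u))"
    by (subst Ker_mu_times_subset_iff)
      (use liftable_imp_relations[OF lift S(1,2), of "v - u"] S u in auto)
  then show ?thesis by simp
qed

lemma Ker_subset_imp_relations:
  assumes sub: "Ker_mu_times A X m u (v - u) \<subseteq> Ker_mu A X m v" and u: "u \<in> U" "v \<in> U"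
    and L: "set L \<subseteq> V m \<times> D u" "act_sum X L = \<zero>\<^bsub>X\<^esub>" and b: "b \<in> D (v - u)"
  shows "act_sum X (times_right A b L) = \<zero>\<^bsub>X\<^esub>"
  using Ker_mu_times_subset_iff[of u "v - u" m] assms by auto

end

text \<open>The features of U shared by both cases: period n, and no elements of U \<inter> -U other
  than multiples of n.\<close>

locale periodic_truncation = colon_generated K A U X S
  for K :: "'k ring" and A :: "('k, 'a) graded_algebra" and U :: "int set"
    and X :: "('a, 'x) graded_right_module" and S :: "int set" +
  fixes n :: int
  assumes A_pos: "positively_graded_K_algebra K A"
    and A_gen: "alg_generated_in_degrees K A {0, 1}"
    and n_pos: "0 < n"
    and periodic: "u + k * n \<in> U \<longleftrightarrow> u \<in> U"
    and stabilizer: "u \<in> U \<Longrightarrow> - u \<in> U \<Longrightarrow> n dvd u"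
begin

lemma D_neg: "i < 0 \<Longrightarrow> a \<in> D i \<Longrightarrow> a = \<zero>\<^bsub>A\<^esub>"
  using A_pos by (auto simp: positively_graded_K_algebra_def)

lemmas D_split = generated_degree_add[OF A_pos A_gen]

lemma colon_shift:
  assumes "m \<in> colon S U"
  shows "m + k * n \<in> colon S U"
proof -
  have "s \<in> (\<lambda>u. m + k * n + u) ` U \<longleftrightarrow> s \<in> S" for s
  proof -
    have "s \<in> (\<lambda>u. m + k * n + u) ` U \<longleftrightarrow> s - m + (- k) * n \<in> U" by (force simp: image_iff)
    then show ?thesis using periodic mem_colon_iff[OF assms] by blast
  qed
  then show ?thesis by (auto simp: colon_def)
qed

text \<open>Since 0 \<in> U, both m and m' lie in S = m + U = m' + U, so their difference and its
  negative lie in U.\<close>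

lemma colon_dvd:
  assumes "m \<in> colon S U" "m' \<in> colon S U"
  shows "n dvd m - m'"
proof (rule stabilizer)
  have "m \<in> S" "m' \<in> S" using mem_colon_iff[OF assms(1), of m] mem_colon_iff[OF assms(2), of m'] U0 by simp_all
  then show "m - m' \<in> U" "- (m - m') \<in> U"
    using mem_colon_iff[OF assms(2), of m] mem_colon_iff[OF assms(1), of m'] by simp_all
qed

text \<open>For fixed \<open>L\<close> the value is additive in a, and A_(i+j) is spanned by A_i
  A_j. It therefore suffices to multiply by the two factors in succession.\<close>

lemma times_right_vanish:
  assumes L: "L \<in> reps s" and s: "s + (i + j) \<in> S" and ij: "0 \<le> i" "0 \<le> j"
    and vanish: "\<And>b c. b \<in> D i \<Longrightarrow> c \<in> D j \<Longrightarrow> act_sum X (times_right A c (times_right A b L)) = \<zero>\<^bsub>X\<^esub>"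
    and a: "a \<in> D (i + j)"
  shows "act_sum X (times_right A a L) = \<zero>\<^bsub>X\<^esub>"
proof -
  have zero: "act_sum X (times_right A \<zero>\<^bsub>A\<^esub> L) = \<zero>\<^bsub>X\<^esub>"
  proof -
    have z: "\<zero>\<^bsub>A\<^esub> \<in> D (i + j)" by (rule A.graded_part_zero[OF gA])
    have "act_sum X (times_right A \<zero>\<^bsub>A\<^esub> L) \<in> carrier X"
      using Vc[OF reps_V[OF reps_times_right[OF s L z]]] .
    then show ?thesis using act_sum_times_add[OF s L z z] X.M.add.r_cancel_one by simp
  qed
  have "a \<in> D (i + j) \<and> act_sum X (times_right A a L) = \<zero>\<^bsub>X\<^esub>"
    using D_split[OF a ij]
  proof induction
    case zero
    then show ?case using \<open>act_sum X (times_right A \<zero>\<^bsub>A\<^esub> L) = \<zero>\<^bsub>X\<^esub>\<close> A.graded_part_zero[OF gA] by blast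
  next
    case (step e z)
    then obtain b c where e: "b \<in> D i" "c \<in> D j" "e = b \<otimes>\<^bsub>A\<^esub> c" by blast
    have "act_sum X (times_right A e L) = \<zero>\<^bsub>X\<^esub>"
      using vanish[OF e(1,2)] unfolding times_right_mult[OF L Dc[OF e(1)] Dc[OF e(2)]] e(3) .
    moreover have eD: "e \<in> D (i + j)" using D_mult e by simp
    moreover have "z \<in> D (i + j)" "act_sum X (times_right A z L) = \<zero>\<^bsub>X\<^esub>" using step by auto
    ultimately show ?case
      using act_sum_times_add[OF s L eD, of z] A.graded_part_add[OF gA eD, of z] by simp
  qed
  then show ?thesis by blast
qed

text \<open>An element \<open>x a\<close> with \<open>x \<in> X\<^sub>m\<close>, \<open>m \<in> (S : U)\<close>, is moved to the largest \<open>p \<le> s\<close> in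
  \<open>(S : U)\<close>: as \<open>a\<close> is a sum of products \<open>c d\<close> with \<open>deg c = p - m\<close>, the element
  \<open>x a\<close> is the sum of the \<open>(x c) d\<close> with \<open>x c \<in> X\<^sub>p\<close>.\<close>

lemma move_pair:
  assumes p: "p \<in> colon S U" "p \<le> s" "s < p + n" and m: "m \<in> colon S U"
    and x: "x \<in> V m" and a: "a \<in> D (s - m)"
  shows "\<exists>L. set L \<subseteq> V p \<times> D (s - p) \<and>
    (\<forall>i b. b \<in> D i \<longrightarrow> s + i \<in> S \<longrightarrow> act_sum X (times_right A b L) = x \<triangleleft>\<^bsub>X\<^esub> (a \<otimes>\<^bsub>A\<^esub> b))"
proof (cases "s < m")
  case True
  then have "a = \<zero>\<^bsub>A\<^esub>" using D_neg[OF _ a] by simp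
  then have "x \<triangleleft>\<^bsub>X\<^esub> (a \<otimes>\<^bsub>A\<^esub> b) = \<zero>\<^bsub>X\<^esub>" if "b \<in> D i" for b i
    using that Dc X.ract_zero[OF Vc[OF x]] by simp
  then show ?thesis by (intro exI[of _ "[]"]) simp
next
  case False
  obtain k where k: "m - p = n * k" using colon_dvd[OF m p(1)] by (auto simp: dvd_def)
  \<comment> \<open>From m \<le> s < p + n the multiple m - p of n is smaller than n, hence at most
    zero.\<close>
  have "n * k < n * 1" using k False p by linarith
  then have "k < 1" using mult_less_cancel_left_pos[OF n_pos, of k 1] by blast
  then have "k \<le> 0" by simp
  then have mp: "0 \<le> p - m" using k mult_nonneg_nonpos[of n k] n_pos by simp
  have pm: "p - m \<in> U" using periodic[of 0 "- k"] U0 k by (simp add: algebra_simps)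
  have "a \<in> D ((p - m) + (s - p))" using a by simp
  from D_split[OF this mp] have
    "a \<in> add_span A {c \<otimes>\<^bsub>A\<^esub> d | c d. c \<in> D (p - m) \<and> d \<in> D (s - p)}" using p by simp
  then have "a \<in> D (s - m) \<and> (\<exists>L. set L \<subseteq> V p \<times> D (s - p) \<and>
    (\<forall>i b. b \<in> D i \<longrightarrow> s + i \<in> S \<longrightarrow> act_sum X (times_right A b L) = x \<triangleleft>\<^bsub>X\<^esub> (a \<otimes>\<^bsub>A\<^esub> b)))"
  proof induction
    case zero
    have "x \<triangleleft>\<^bsub>X\<^esub> (\<zero>\<^bsub>A\<^esub> \<otimes>\<^bsub>A\<^esub> b) = \<zero>\<^bsub>X\<^esub>" if "b \<in> D i" for b i
      using that Dc X.ract_zero[OF Vc[OF x]] by simp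
    then show ?case using A.graded_part_zero[OF gA] by (intro conjI exI[of _ "[]"]) simp_all
  next
    case (step e z)
    then obtain c d L where e: "c \<in> D (p - m)" "d \<in> D (s - p)" "e = c \<otimes>\<^bsub>A\<^esub> d"
      and z: "z \<in> D (s - m)" and L: "set L \<subseteq> V p \<times> D (s - p)"
        "\<And>i b. b \<in> D i \<Longrightarrow> s + i \<in> S \<Longrightarrow> act_sum X (times_right A b L) = x \<triangleleft>\<^bsub>X\<^esub> (z \<otimes>\<^bsub>A\<^esub> b)"
      by blast
    have eD: "e \<in> D (s - m)" using D_mult[OF e(1,2)] e(3) by simp
    have xc: "x \<triangleleft>\<^bsub>X\<^esub> c \<in> V p" using V_act[OF x e(1) pm] by simp
    have "act_sum X (times_right A b ((x \<triangleleft>\<^bsub>X\<^esub> c, d) # L)) = x \<triangleleft>\<^bsub>X\<^esub> ((e \<oplus>\<^bsub>A\<^esub> z) \<otimes>\<^bsub>A\<^esub> b)"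
      if b: "b \<in> D i" and i: "s + i \<in> S" for b i
    proof -
      have U: "s - p + i \<in> U" "s - m + i \<in> U"
        using mem_colon_iff[OF p(1), of "s + i"] mem_colon_iff[OF m, of "s + i"] i
        by (simp_all add: algebra_simps)
      \<comment> \<open>The middle factor is d b rather than d: the degrees p - m, s - p + i and s -
        m + i lie in U, whereas the degree of b is unrestricted.\<close>
      have "(x \<triangleleft>\<^bsub>X\<^esub> c) \<triangleleft>\<^bsub>X\<^esub> (d \<otimes>\<^bsub>A\<^esub> b) = x \<triangleleft>\<^bsub>X\<^esub> (c \<otimes>\<^bsub>A\<^esub> (d \<otimes>\<^bsub>A\<^esub> b))"
        by (rule act_assoc[OF Vc[OF x] e(1) D_mult[OF e(2) b] pm U(1)])
          (use U(2) in \<open>simp add: algebra_simps\<close>)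
      also have "c \<otimes>\<^bsub>A\<^esub> (d \<otimes>\<^bsub>A\<^esub> b) = e \<otimes>\<^bsub>A\<^esub> b" using e b Dc by (simp add: A.m_assoc)
      finally have "act_sum X (times_right A b ((x \<triangleleft>\<^bsub>X\<^esub> c, d) # L))
          = x \<triangleleft>\<^bsub>X\<^esub> (e \<otimes>\<^bsub>A\<^esub> b) \<oplus>\<^bsub>X\<^esub> x \<triangleleft>\<^bsub>X\<^esub> (z \<otimes>\<^bsub>A\<^esub> b)"
        using L(2)[OF b i] by simp
      also have "\<dots> = x \<triangleleft>\<^bsub>X\<^esub> (e \<otimes>\<^bsub>A\<^esub> b \<oplus>\<^bsub>A\<^esub> z \<otimes>\<^bsub>A\<^esub> b)"
        by (rule act_add_right[OF Vc[OF x] D_B[OF D_mult[OF eD b] U(2)] D_B[OF D_mult[OF z b] U(2)], symmetric])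
      also have "e \<otimes>\<^bsub>A\<^esub> b \<oplus>\<^bsub>A\<^esub> z \<otimes>\<^bsub>A\<^esub> b = (e \<oplus>\<^bsub>A\<^esub> z) \<otimes>\<^bsub>A\<^esub> b"
        using eD z b Dc by (simp add: A.l_distr)
      finally show ?thesis .
    qed
    moreover have "set ((x \<triangleleft>\<^bsub>X\<^esub> c, d) # L) \<subseteq> V p \<times> D (s - p)" using L xc e by simp
    moreover have "e \<oplus>\<^bsub>A\<^esub> z \<in> D (s - m)" by (rule A.graded_part_add[OF gA eD z])
    ultimately show ?case by blast
  qed
  then show ?thesis by blast
qed

text \<open>The lists found for the single pairs are concatenated. Agreement for all admissible
  \<open>b\<close>, and not only for 1, permits both moving a relation to X_p and returning with its
  multiples.\<close>

lemma move_reps: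
  assumes p: "p \<in> colon S U" "p \<le> s" "s < p + n" and L: "L \<in> reps s"
  shows "\<exists>L'. set L' \<subseteq> V p \<times> D (s - p) \<and>
    (\<forall>i b. b \<in> D i \<longrightarrow> s + i \<in> S \<longrightarrow> act_sum X (times_right A b L') = act_sum X (times_right A b L))"
  using L
proof (induction L)
  case Nil
  then show ?case by (intro exI[of _ "[]"]) simp
next
  case (Cons q L)
  then obtain m where m: "m \<in> colon S U" "fst q \<in> V m" "snd q \<in> D (s - m)" by auto
  from move_pair[OF p m] obtain L1 where L1: "set L1 \<subseteq> V p \<times> D (s - p)"
    "\<And>i b. b \<in> D i \<Longrightarrow> s + i \<in> S \<Longrightarrow> act_sum X (times_right A b L1) = fst q \<triangleleft>\<^bsub>X\<^esub> (snd q \<otimes>\<^bsub>A\<^esub> b)"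
    by blast
  from Cons obtain L2 where L2: "set L2 \<subseteq> V p \<times> D (s - p)"
    "\<And>i b. b \<in> D i \<Longrightarrow> s + i \<in> S \<Longrightarrow> act_sum X (times_right A b L2) = act_sum X (times_right A b L)"
    by auto
  have "act_sum X (times_right A b (L1 @ L2)) = act_sum X (times_right A b (q # L))"
    if b: "b \<in> D i" and i: "s + i \<in> S" for b i
  proof -
    have u: "s - p + i \<in> U" using mem_colon_iff[OF p(1), of "s + i"] i by (simp add: algebra_simps)
    have "act_sum X (times_right A b L1 @ times_right A b L2)
        = act_sum X (times_right A b L1) \<oplus>\<^bsub>X\<^esub> act_sum X (times_right A b L2)"
      by (rule X.act_sum_append[OF VD_carrier[OF VD_times_right[OF L1(1) b] u]
            VD_carrier[OF VD_times_right[OF L2(1) b] u]])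
    then show ?thesis using L1(2)[OF b i] L2(2)[OF b i] by simp
  qed
  moreover have "set (L1 @ L2) \<subseteq> V p \<times> D (s - p)" using L1 L2 by simp
  ultimately show ?case by blast
qed

text \<open>Coherence concerns lists with several m; moving them to one p leaves relations in X_p
  \<otimes> A_j with j = s - p between 0 and n - 1.\<close>

lemma liftable_if_relations:
  assumes rel: "\<And>m j i L b. \<lbrakk>m \<in> colon S U; 0 \<le> j; j < n; 0 \<le> i; j \<in> U; j + i \<in> U;
      set L \<subseteq> V m \<times> D j; act_sum X L = \<zero>\<^bsub>X\<^esub>; b \<in> D i\<rbrakk> \<Longrightarrow> act_sum X (times_right A b L) = \<zero>\<^bsub>X\<^esub>"
  shows "liftable A S U X"
proof -
  interpret coherent_module K A U X S
  proof
    fix s i L b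
    assume s: "s \<in> S" "s + i \<in> S" and L: "L \<in> reps s" "act_sum X L = \<zero>\<^bsub>X\<^esub>" and b: "b \<in> D i"
    show "act_sum X (times_right A b L) = \<zero>\<^bsub>X\<^esub>"
    proof (cases "L = []")
      case True
      then show ?thesis by simp
    next
      case False
      then obtain m where m: "m \<in> colon S U" using L(1) by (cases L) auto
      \<comment> \<open>The largest element of the class m + nZ not exceeding s, so that s - p is
        the residue of s - m.\<close>
      define p where "p = m + ((s - m) div n) * n"
      have p: "p \<in> colon S U" unfolding p_def by (rule colon_shift[OF m])
      have sp: "s - p = (s - m) mod n" by (simp add: p_def minus_div_mult_eq_mod[symmetric])
      then have ps: "p \<le> s" "s < p + n"
        using pos_mod_bound[OF n_pos, of "s - m"] pos_mod_sign[OF n_pos, of "s - m"] by linarith+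
      obtain L' where L': "set L' \<subseteq> V p \<times> D (s - p)"
        "\<And>i b. b \<in> D i \<Longrightarrow> s + i \<in> S \<Longrightarrow> act_sum X (times_right A b L') = act_sum X (times_right A b L)"
        using move_reps[OF p ps L(1)] by blast
      have U: "s - p \<in> U" "s - p + i \<in> U"
        using mem_colon_iff[OF p, of s] mem_colon_iff[OF p, of "s + i"] s by (simp_all add: algebra_simps)
      have r': "L' \<in> reps s" by (rule single_reps[OF p U(1) L'(1)])
      \<comment> \<open>The case \<open>b = 1\<close> of the agreement transfers the relation from
        \<open>L\<close> to \<open>L'\<close>.\<close>
      have z': "act_sum X L' = \<zero>\<^bsub>X\<^esub>"
        using L'(2)[OF D_one] s L(2) times_right_one[OF r'] times_right_one[OF L(1)] by simp
      show ?thesis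
      proof (cases "0 \<le> i")
        case True
        have "act_sum X (times_right A b L') = \<zero>\<^bsub>X\<^esub>"
          by (rule rel[OF p _ _ True U L'(1) z' b]) (use ps in auto)
        then show ?thesis using L'(2)[OF b s(2)] by simp
      next
        case False
        then have b0: "b = \<zero>\<^bsub>A\<^esub>" using D_neg[OF _ b] by simp
        have "act_sum X (times_right A b L) \<in> carrier X"
          using Vc[OF reps_V[OF reps_times_right[OF s(2) L(1) b]]] .
        \<comment> \<open>For b = 0, additivity in b reads z = z + z.\<close>
        then show ?thesis
          using act_sum_times_add[OF s(2) L(1) b b] b0 X.M.add.r_cancel_one by simp
      qed
    qed
  qed
  show ?thesis by (rule liftable)
qed

text \<open>Here \<open>b\<close> belongs to \<open>B\<close> and acts on X, and none of the
  products involved is truncated. The relation is simply multiplied by \<open>b\<close> in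
  X.\<close>

lemma relations_in_U:
  assumes m: "m \<in> colon S U" and U: "j \<in> U" "i \<in> U" "j + i \<in> U"
    and L: "set L \<subseteq> V m \<times> D j" "act_sum X L = \<zero>\<^bsub>X\<^esub>" and b: "b \<in> D i"
  shows "act_sum X (times_right A b L) = \<zero>\<^bsub>X\<^esub>"
proof -
  have S: "m + j \<in> S" "m + j + i \<in> S" using mem_colon_iff[OF m] U by (simp_all add: add.assoc)
  have "L \<in> reps (m + j)" by (rule single_reps[OF m]) (use U L in simp_all)
  then show ?thesis
    using act_sum_times_B[OF S U(2) _ b] L(2) X.zero_ract[OF D_B[OF b U(2)]] by simp
qed

text \<open>The instance s = m + j of \<open>times_right_vanish\<close>. Only the end degrees j and
  j + (i + k) are tied to U; suitable intermediate degrees are chosen in each application.\<close>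

lemma relations_split:
  assumes m: "m \<in> colon S U" and U: "j \<in> U" "j + (i + k) \<in> U" and ik: "0 \<le> i" "0 \<le> k"
    and L: "set L \<subseteq> V m \<times> D j"
    and vanish: "\<And>b c. b \<in> D i \<Longrightarrow> c \<in> D k \<Longrightarrow> act_sum X (times_right A c (times_right A b L)) = \<zero>\<^bsub>X\<^esub>"
    and a: "a \<in> D (i + k)"
  shows "act_sum X (times_right A a L) = \<zero>\<^bsub>X\<^esub>"
proof -
  have "L \<in> reps (m + j)" by (rule single_reps[OF m]) (use U L in simp_all)
  moreover have "m + j + (i + k) \<in> S" using mem_colon_iff[OF m] U by (simp add: add.assoc)
  ultimately show ?thesis using times_right_vanish ik vanish a by blast
qed

end

section \<open>The two families of intervals as conditions on residues\<close>

lemma mem_upper_intervals: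
  fixes n r u :: int
  assumes "0 \<le> r" "r < n"
  shows "u \<in> (\<Union>k. {k * n..k * n + r}) \<longleftrightarrow> u mod n \<le> r"
proof
  assume "u \<in> (\<Union>k. {k * n..k * n + r})"
  then obtain k where k: "k * n \<le> u" "u \<le> k * n + r" by auto
  have "u mod n = (u - k * n) mod n" by (simp add: mod_diff_eq[symmetric])
  also have "\<dots> = u - k * n" using k assms by (intro mod_pos_pos_trivial) auto
  finally show "u mod n \<le> r" using k by simp
next
  assume h: "u mod n \<le> r"
  have "u = u div n * n + u mod n" by simp
  moreover have "0 \<le> u mod n" using assms by simp
  ultimately have "u \<in> {u div n * n..u div n * n + r}" using h by (simp only: atLeastAtMost_iff) linarith
  then show "u \<in> (\<Union>k. {k * n..k * n + r})" by blast
qed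

text \<open>The reflection u \<mapsto> -u, together with k \<mapsto> -k, exchanges the two families
  of blocks.\<close>

lemma mem_lower_intervals:
  fixes n r u :: int
  assumes "0 \<le> r" "r < n"
  shows "u \<in> (\<Union>k. {k * n - r..k * n}) \<longleftrightarrow> (- u) mod n \<le> r"
proof -
  have "u \<in> (\<Union>k. {k * n - r..k * n}) \<longleftrightarrow> (\<exists>k. k * n - r \<le> u \<and> u \<le> k * n)" by auto
  also have "\<dots> \<longleftrightarrow> (\<exists>k. k * n \<le> - u \<and> - u \<le> k * n + r)"
    by (rule iffI; elim exE; rename_tac k; rule_tac x = "- k" in exI) auto
  also have "\<dots> \<longleftrightarrow> - u \<in> (\<Union>k. {k * n..k * n + r})" by auto
  finally show ?thesis using mem_upper_intervals[OF assms, of "- u"] by simp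
qed

theorem corollary4p7:
  fixes K :: "'k ring"
    and A :: "('k, 'a) graded_algebra"
    and X :: "('a, 'x) graded_right_module"
    and S U :: "int set"
    and n r :: int
  assumes "field K"
    and "positively_graded_K_algebra K A"
    and "alg_generated_in_degrees K A {0, 1}"
    and "semisimple_ring (deg0_ring A)"
    and "right_modular S U"
    and "graded_right_module (alg_trunc A U) X"
    and "mod_generated_in_degrees (alg_trunc A U) X (colon S U)"
    and "2 \<le> n" and "0 \<le> r" and "0 \<le> 2 * r" and "2 * r < n"
  shows
    "(U = (\<Union>k. {k * n..k * n + r}) \<longrightarrow>
       (liftable A S U X \<longleftrightarrow>
         (\<forall>m\<in>colon S U. Ker_mu_times A X m r (n - r) \<subseteq> Ker_mu A X m n))) \<and>
     (U = (\<Union>k. {k * n - r..k * n}) \<longrightarrow>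
       (liftable A S U X \<longleftrightarrow>
         (\<forall>m\<in>colon S U. \<forall>u v. n - r \<le> u \<and> u < v \<and> v \<le> n \<longrightarrow>
            Ker_mu_times A X m u (v - u) \<subseteq> Ker_mu A X m v)))"
proof -
  have rn: "r < n" "0 < n" using assms(8,9,11) by linarith+
  have U0: "0 \<in> U" using assms(5) by (simp add: right_modular_def ring_supporting_def)
  interpret colon_generated K A U X S
    using assms(2,6,7) U0 by unfold_locales (simp_all add: positively_graded_K_algebra_def)
  \<comment> \<open>If n does not divide u, the two residues add up to n, which exceeds 2 r.\<close>
  have stab: "n dvd u" if "u mod n \<le> r" "(- u) mod n \<le> r" for u
    using that assms(11) by (auto simp: zmod_zminus1_eq_if dvd_eq_mod_eq_0 split: if_splits)
  have "liftable A S U X \<longleftrightarrow> (\<forall>m\<in>colon S U. Ker_mu_times A X m r (n - r) \<subseteq> Ker_mu A X m n)"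
    if "U = (\<Union>k. {k * n..k * n + r})"
  proof -
    have U: "u \<in> U \<longleftrightarrow> u mod n \<le> r" for u
      unfolding that by (rule mem_upper_intervals[OF assms(9) rn(1)])
    interpret periodic_truncation K A U X S n
    proof unfold_locales
      show "u + k * n \<in> U \<longleftrightarrow> u \<in> U" for u k by (simp add: U)
      show "n dvd u" if "u \<in> U" "- u \<in> U" for u using stab that unfolding U .
    qed (use assms(2,3) rn in simp_all)
    have small: "u \<in> U \<longleftrightarrow> u \<le> r" if "0 \<le> u" "u < n" for u using U that by simp
    have n: "n \<in> U" "r \<in> U" using U rn assms(9) by auto
    show ?thesis
    proof
      show "\<forall>m\<in>colon S U. Ker_mu_times A X m r (n - r) \<subseteq> Ker_mu A X m n" if "liftable A S U X"
        using liftable_imp_Ker_subset[OF that _ n(2,1)] by blast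
    next
      assume ker: "\<forall>m\<in>colon S U. Ker_mu_times A X m r (n - r) \<subseteq> Ker_mu A X m n"
      show "liftable A S U X"
      proof (rule liftable_if_relations)
        fix m j i L b
        assume m: "m \<in> colon S U" and j: "0 \<le> j" "j < n" "j \<in> U" and i: "0 \<le> i" "j + i \<in> U"
          and L: "set L \<subseteq> V m \<times> D j" "act_sum X L = \<zero>\<^bsub>X\<^esub>" and b: "b \<in> D i"
        have jr: "j \<le> r" using small j by blast
        show "act_sum X (times_right A b L) = \<zero>\<^bsub>X\<^esub>"
        proof (cases "j + i < n")
          case True
          \<comment> \<open>Below n only the block [0, r] occurs, so j and j + i lie in it and so
            does their difference i.\<close>
          then have "j + i \<le> r" using small[of "j + i"] j i by simp
          then have "i \<in> U" using small[of i] i j rn by simp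
          then show ?thesis using relations_in_U[OF m j(3) _ i(2) L b] by blast
        next
          case False
          \<comment> \<open>The degree i is cut into r - j, \<open>?k\<close> and \<open>?l\<close>,
            so that the relation passes through the degrees j, r, n and j + i. The outer two pieces
            lie in U; \<open>?k\<close> is the step from the end of one block to the start of the
            next, where the kernel condition is used.\<close>
          let ?k = "n - r" and ?l = "j + i - n"
          have kl: "0 \<le> ?k" "0 \<le> ?l" using False rn by auto
          have l: "?l \<in> U" using periodic[of "j + i" "-1"] i by simp
          have rj: "r - j \<in> U" using small[of "r - j"] j jr rn by simp
          have eq: "(r - j) + (?k + ?l) = i" by simp
          show ?thesis
          proof (rule relations_split[OF m j(3), of "r - j" "?k + ?l"])
            show "b \<in> D ((r - j) + (?k + ?l))" using b eq by simp
            show "j + ((r - j) + (?k + ?l)) \<in> U" using i eq by simp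
            fix c d assume c: "c \<in> D (r - j)" and d: "d \<in> D (?k + ?l)"
            have L1: "set (times_right A c L) \<subseteq> V m \<times> D r"
              using VD_times_right[OF L(1) c] by simp
            have z1: "act_sum X (times_right A c L) = \<zero>\<^bsub>X\<^esub>"
              by (rule relations_in_U[OF m j(3) rj _ L c]) (use n in simp)
            show "act_sum X (times_right A d (times_right A c L)) = \<zero>\<^bsub>X\<^esub>"
            proof (rule relations_split[OF m n(2) _ kl L1 _ d])
              show "r + (?k + ?l) \<in> U" using i by simp
              fix e g assume e: "e \<in> D ?k" and g: "g \<in> D ?l"
              have L2: "set (times_right A e (times_right A c L)) \<subseteq> V m \<times> D n"
                using VD_times_right[OF L1 e] by (simp only: diff_add_eq add_diff_cancel_left' add_diff_eq)
              have z2: "act_sum X (times_right A e (times_right A c L)) = \<zero>\<^bsub>X\<^esub>"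
                by (rule Ker_subset_imp_relations[OF _ n(2,1) L1 z1 e]) (use ker m in blast)
              show "act_sum X (times_right A g (times_right A e (times_right A c L))) = \<zero>\<^bsub>X\<^esub>"
                by (rule relations_in_U[OF m n(1) l _ L2 z2 g]) (use i in simp)
            qed
          qed (use j jr kl L in auto)
        qed
      qed
    qed
  qed
  moreover have "liftable A S U X \<longleftrightarrow> (\<forall>m\<in>colon S U. \<forall>u v. n - r \<le> u \<and> u < v \<and> v \<le> n \<longrightarrow>
      Ker_mu_times A X m u (v - u) \<subseteq> Ker_mu A X m v)"
    if "U = (\<Union>k. {k * n - r..k * n})"
  proof -
    have U: "u \<in> U \<longleftrightarrow> (- u) mod n \<le> r" for u
      unfolding that by (rule mem_lower_intervals[OF assms(9) rn(1)])
    have per: "u + k * n \<in> U \<longleftrightarrow> u \<in> U" for u k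
    proof -
      have "(- (u + k * n)) mod n = (- u) mod n"
        using mod_mult_self1[of "- u" "- k" n] by (simp add: algebra_simps)
      then show ?thesis using U by simp
    qed
    interpret periodic_truncation K A U X S n
    proof unfold_locales
      show "u + k * n \<in> U \<longleftrightarrow> u \<in> U" for u k by (rule per)
      show "n dvd u" if "u \<in> U" "- u \<in> U" for u using stab[of u] that unfolding U by simp
    qed (use assms(2,3) rn in simp_all)
    \<comment> \<open>The range is (0, n] rather than [0, n), since the block ending at n contains
      n; this matches the bounds on u and v in the kernel conditions.\<close>
    have top: "u \<in> U \<longleftrightarrow> n - r \<le> u" if "0 < u" "u \<le> n" for u
    proof -
      have "(- u) mod n = (n - u) mod n" using mod_add_self1[of n "- u"] by simp
      also have "\<dots> = n - u" using that by (intro mod_pos_pos_trivial) auto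
      finally show ?thesis using U by auto
    qed
    have n: "n \<in> U" using top[of n] assms(9) rn by simp
    show ?thesis
    proof
      assume lift: "liftable A S U X"
      show "\<forall>m\<in>colon S U. \<forall>u v. n - r \<le> u \<and> u < v \<and> v \<le> n \<longrightarrow>
        Ker_mu_times A X m u (v - u) \<subseteq> Ker_mu A X m v"
        using liftable_imp_Ker_subset[OF lift] top rn by auto
    next
      assume ker: "\<forall>m\<in>colon S U. \<forall>u v. n - r \<le> u \<and> u < v \<and> v \<le> n \<longrightarrow>
        Ker_mu_times A X m u (v - u) \<subseteq> Ker_mu A X m v"
      show "liftable A S U X"
      proof (rule liftable_if_relations)
        fix m j i L b
        assume m: "m \<in> colon S U" and j: "0 \<le> j" "j < n" "j \<in> U" and i: "0 \<le> i" "j + i \<in> U"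
          and L: "set L \<subseteq> V m \<times> D j" "act_sum X L = \<zero>\<^bsub>X\<^esub>" and b: "b \<in> D i"
        \<comment> \<open>The kernel condition with u = j: a positive j < n in U satisfies n - r
          \<le> j by \<open>top\<close>.\<close>
        have rel: "act_sum X (times_right A c L) = \<zero>\<^bsub>X\<^esub>"
          if "0 < j" "j < v" "v \<le> n" "v \<in> U" and c: "c \<in> D (v - j)" for v c
          by (rule Ker_subset_imp_relations[OF _ j(3) that(4) L c])
            (use ker m that top[of j] j in auto)
        show "act_sum X (times_right A b L) = \<zero>\<^bsub>X\<^esub>"
        \<comment> \<open>The kernel conditions start at n - r > 0 and do not reach j = 0. In this
          case, however, i equals j + i or 0 and hence lies in U.\<close>
        proof (cases "j = 0 \<or> i = 0")
          case True
          then have "i \<in> U" using i U0 by auto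
          then show ?thesis using relations_in_U[OF m j(3) _ i(2) L b] by blast
        next
          case False
          then have pos: "0 < j" "0 < i" using j i by auto
          show ?thesis
          proof (cases "j + i \<le> n")
            case True
            then show ?thesis using rel[OF pos(1), of "j + i" b] pos i b by simp
          next
            case False
            \<comment> \<open>The path is broken at n: \<open>rel\<close> leads from j to n, and the
              remaining degree \<open>?l\<close> lies in U by periodicity.\<close>
            let ?l = "j + i - n"
            have l: "?l \<in> U" using periodic[of "j + i" "-1"] i by simp
            show ?thesis
            proof (rule relations_split[OF m j(3), of "n - j" ?l])
              show "b \<in> D ((n - j) + ?l)" using b by simp
              show "j + ((n - j) + ?l) \<in> U" using i by simp
              fix c d assume c: "c \<in> D (n - j)" and d: "d \<in> D ?l"
              have L1: "set (times_right A c L) \<subseteq> V m \<times> D n"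
                using VD_times_right[OF L(1) c] by simp
              have z1: "act_sum X (times_right A c L) = \<zero>\<^bsub>X\<^esub>" by (rule rel[OF pos(1) j(2) _ n c]) simp
              show "act_sum X (times_right A d (times_right A c L)) = \<zero>\<^bsub>X\<^esub>"
                by (rule relations_in_U[OF m n l _ L1 z1 d]) (use i in simp)
            qed (use j False L in auto)
          qed
        qed
      qed
    qed
  qed
  ultimately show ?thesis by blast
qed

end
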